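(* Let $K_0\subseteq K_1\subseteq K_2$ be a tower of separable algebraic field extensions. If both $K_2/K_1$ and $K_1/K_0$ are PAC extensions, then $K_2/K_0$ is a PAC extension.
   Context: A field extension $K/K_0$ is called a PAC extension if for every absolutely irreducible variety $V$ of dimension $r\geq 1$ defined over $K$ and every separable dominating rational map $\nu\colon V\to\mathbb{A}^r$ defined over $K$ there exists $a\in V(K)$ for which $\nu(a)\in K_0^r$. *)

theory Defs
  imports
    "HOL-Algebra.Algebraic_Closure_Type"
    "HOL-Algebra.Generated_Fields"
    "HOL-Library.Poly_Mapping"
begin

section \<open>Field extensions inside an ambient field\<close>

definition field_extension :: "'a::field set \<Rightarrow> 'a set \<Rightarrow> bool" where
  "field_extension F E \<longleftrightarrow>
     subfield F ring_of_type_algebra \<and> subfield E ring_of_type_algebra \<and> F \<subseteq> E"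

definition adjoin :: "'a::field set \<Rightarrow> 'a set \<Rightarrow> 'a set" where
  "adjoin F S = generate_field ring_of_type_algebra (F \<union> S)"

definition polys_over :: "'a::field set \<Rightarrow> 'a poly set" where
  "polys_over F = {p. \<forall>i. poly.coeff p i \<in> F}"

definition algebraic_over :: "'a::field set \<Rightarrow> 'a \<Rightarrow> bool" where
  "algebraic_over F a \<longleftrightarrow> (\<exists>p\<in>polys_over F. p \<noteq> 0 \<and> poly p a = 0)"

definition is_minimal_poly :: "'a::field set \<Rightarrow> 'a \<Rightarrow> 'a poly \<Rightarrow> bool" where
  "is_minimal_poly F a p \<longleftrightarrow>
     p \<in> polys_over F \<and> lead_coeff p = 1 \<and> poly p a = 0 \<and>
     (\<forall>q\<in>polys_over F. q \<noteq> 0 \<and> poly q a = 0 \<longrightarrow> Polynomial.degree p \<le> Polynomial.degree q)"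

definition separable_over :: "'a::field set \<Rightarrow> 'a \<Rightarrow> bool" where
  "separable_over F a \<longleftrightarrow> (\<exists>p. is_minimal_poly F a p \<and> coprime p (pderiv p))"

definition separable_algebraic_extension :: "'a::field set \<Rightarrow> 'a set \<Rightarrow> bool" where
  "separable_algebraic_extension F E \<longleftrightarrow> field_extension F E \<and> (\<forall>a\<in>E. separable_over F a)"


section \<open>Polynomials in several variables\<close>

text \<open>A polynomial maps each monomial (a finitely supported exponent vector indexed by the
  variables) to its coefficient; addition and multiplication are those of
  \<open>Poly_Mapping\<close>.\<close>

type_synonym 'a mpoly = "(nat \<Rightarrow>\<^sub>0 nat) \<Rightarrow>\<^sub>0 'a"

definition mpolys :: "'a::zero set \<Rightarrow> nat \<Rightarrow> 'a mpoly set" where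
  "mpolys F n = {p. \<forall>m\<in>Poly_Mapping.keys p.
     Poly_Mapping.lookup p m \<in> F \<and> Poly_Mapping.keys m \<subseteq> {..<n}}"

definition meval :: "'a::comm_semiring_1 mpoly \<Rightarrow> (nat \<Rightarrow> 'a) \<Rightarrow> 'a" where
  "meval p x = (\<Sum>m\<in>Poly_Mapping.keys p.
     Poly_Mapping.lookup p m * (\<Prod>i\<in>Poly_Mapping.keys m. x i ^ Poly_Mapping.lookup m i))"

definition alg_independent :: "'a::field set \<Rightarrow> nat \<Rightarrow> (nat \<Rightarrow> 'a) \<Rightarrow> bool" where
  "alg_independent F r b \<longleftrightarrow> (\<forall>p\<in>mpolys F r. meval p b = 0 \<longrightarrow> p = 0)"

definition has_trdeg :: "'a::field set \<Rightarrow> 'a set \<Rightarrow> nat \<Rightarrow> bool" where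
  "has_trdeg F E r \<longleftrightarrow> (\<exists>b. b ` {..<r} \<subseteq> E \<and> alg_independent F r b \<and>
     (\<forall>a\<in>E. algebraic_over (adjoin F (b ` {..<r})) a))"


section \<open>Affine varieties over an algebraically closed field\<close>

text \<open>Points of affine \<open>n\<close>-space are the sequences vanishing from index \<open>n\<close> on.\<close>

definition affine_space :: "nat \<Rightarrow> (nat \<Rightarrow> 'a::zero) set" where
  "affine_space n = {x. \<forall>i\<ge>n. x i = 0}"

definition zero_set :: "nat \<Rightarrow> 'a::alg_closed_field mpoly set \<Rightarrow> (nat \<Rightarrow> 'a) set" where
  "zero_set n S = {x \<in> affine_space n. \<forall>p\<in>S. meval p x = 0}"

definition zariski_closed :: "nat \<Rightarrow> (nat \<Rightarrow> 'a::alg_closed_field) set \<Rightarrow> bool" where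
  "zariski_closed n V \<longleftrightarrow> (\<exists>S \<subseteq> mpolys UNIV n. V = zero_set n S)"

definition vanishing_ideal ::
    "'a::alg_closed_field set \<Rightarrow> nat \<Rightarrow> (nat \<Rightarrow> 'a) set \<Rightarrow> 'a mpoly set" where
  "vanishing_ideal F n V = {p \<in> mpolys F n. \<forall>x\<in>V. meval p x = 0}"

definition zariski_closure ::
    "nat \<Rightarrow> (nat \<Rightarrow> 'a::alg_closed_field) set \<Rightarrow> (nat \<Rightarrow> 'a) set" where
  "zariski_closure n A = \<Inter>{V. zariski_closed n V \<and> A \<subseteq> V}"

text \<open>Closed sets are taken over the whole algebraically closed coordinate field, so
  irreducibility here is absolute irreducibility.\<close>

definition abs_irreducible :: "nat \<Rightarrow> (nat \<Rightarrow> 'a::alg_closed_field) set \<Rightarrow> bool" where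
  "abs_irreducible n V \<longleftrightarrow> zariski_closed n V \<and> V \<noteq> {} \<and>
     (\<forall>A B. zariski_closed n A \<and> zariski_closed n B \<and> V = A \<union> B \<longrightarrow> V = A \<or> V = B)"

definition generated_ideal :: "nat \<Rightarrow> 'a::alg_closed_field mpoly set \<Rightarrow> 'a mpoly set" where
  "generated_ideal n S =
     {\<Sum>g\<in>T. c g * g | T c. finite T \<and> T \<subseteq> S \<and> c ` T \<subseteq> mpolys UNIV n}"

definition defined_over ::
    "'a::alg_closed_field set \<Rightarrow> nat \<Rightarrow> (nat \<Rightarrow> 'a) set \<Rightarrow> bool" where
  "defined_over F n V \<longleftrightarrow>
     vanishing_ideal UNIV n V = generated_ideal n (vanishing_ideal F n V)"

definition rational_points ::
    "'a::alg_closed_field set \<Rightarrow> (nat \<Rightarrow> 'a) set \<Rightarrow> (nat \<Rightarrow> 'a) set" where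
  "rational_points F V = {x \<in> V. \<forall>i. x i \<in> F}"

text \<open>The function field of \<open>V\<close> over \<open>F\<close> is \<open>F(x)\<close> for a generic point \<open>x\<close> of \<open>V\<close> over \<open>F\<close>;
  up to isomorphism over \<open>F\<close> it does not depend on \<open>x\<close>. Generic points exist as soon as the
  coordinate field has infinite transcendence degree over \<open>F\<close>.\<close>

definition generic_point ::
    "'a::alg_closed_field set \<Rightarrow> nat \<Rightarrow> (nat \<Rightarrow> 'a) set \<Rightarrow> (nat \<Rightarrow> 'a) \<Rightarrow> bool" where
  "generic_point F n V x \<longleftrightarrow> x \<in> V \<and> (\<forall>p\<in>mpolys F n. meval p x = 0 \<longrightarrow> (\<forall>y\<in>V. meval p y = 0))"

definition function_field ::
    "'a::alg_closed_field set \<Rightarrow> nat \<Rightarrow> (nat \<Rightarrow> 'a) \<Rightarrow> 'a set" where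
  "function_field F n x = adjoin F (x ` {..<n})"

definition has_dimension ::
    "'a::alg_closed_field set \<Rightarrow> nat \<Rightarrow> (nat \<Rightarrow> 'a) set \<Rightarrow> nat \<Rightarrow> bool" where
  "has_dimension F n V r \<longleftrightarrow>
     (\<exists>x. generic_point F n V x \<and> has_trdeg F (function_field F n x) r)"


section \<open>Rational maps to affine space\<close>

text \<open>A rational function on \<open>V\<close> is given by a fraction \<open>p / q\<close> whose denominator does not vanish
  identically on \<open>V\<close>; it is defined at \<open>a\<close> if some fraction equal to \<open>p / q\<close> on \<open>V\<close> has a
  denominator not vanishing at \<open>a\<close>.\<close>

definition rational_map ::
    "'a::alg_closed_field set \<Rightarrow> nat \<Rightarrow> (nat \<Rightarrow> 'a) set \<Rightarrow> nat \<Rightarrow>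
     (nat \<Rightarrow> 'a mpoly \<times> 'a mpoly) \<Rightarrow> bool" where
  "rational_map F n V r \<nu> \<longleftrightarrow> (\<forall>i<r. fst (\<nu> i) \<in> mpolys F n \<and>
     snd (\<nu> i) \<in> mpolys F n - vanishing_ideal F n V)"

definition rational_fun_at ::
    "nat \<Rightarrow> (nat \<Rightarrow> 'a::alg_closed_field) set \<Rightarrow> 'a mpoly \<times> 'a mpoly \<Rightarrow> (nat \<Rightarrow> 'a) \<Rightarrow> 'a \<Rightarrow> bool"
  where
  "rational_fun_at n V f a c \<longleftrightarrow>
     (\<exists>p\<in>mpolys UNIV n. \<exists>q\<in>mpolys UNIV n.
        (\<forall>x\<in>V. meval p x * meval (snd f) x = meval (fst f) x * meval q x) \<and>
        meval q a \<noteq> 0 \<and> c = meval p a / meval q a)"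

text \<open>\<open>\<nu>\<close> is defined at \<open>a\<close> and takes the value \<open>c\<close> there.\<close>

definition rational_map_at ::
    "nat \<Rightarrow> (nat \<Rightarrow> 'a::alg_closed_field) set \<Rightarrow> nat \<Rightarrow> (nat \<Rightarrow> 'a mpoly \<times> 'a mpoly) \<Rightarrow>
     (nat \<Rightarrow> 'a) \<Rightarrow> (nat \<Rightarrow> 'a) \<Rightarrow> bool" where
  "rational_map_at n V r \<nu> a c \<longleftrightarrow>
     a \<in> V \<and> c \<in> affine_space r \<and> (\<forall>i<r. rational_fun_at n V (\<nu> i) a (c i))"

definition dominating ::
    "nat \<Rightarrow> (nat \<Rightarrow> 'a::alg_closed_field) set \<Rightarrow> nat \<Rightarrow> (nat \<Rightarrow> 'a mpoly \<times> 'a mpoly) \<Rightarrow> bool" where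
  "dominating n V r \<nu> \<longleftrightarrow>
     zariski_closure r {c. \<exists>a. rational_map_at n V r \<nu> a c} = affine_space r"

text \<open>At a generic point \<open>x\<close> the denominators do not vanish, so
  \<open>\<nu>(x)\<close> can be computed from the given fractions.\<close>

definition separable_map ::
    "'a::alg_closed_field set \<Rightarrow> nat \<Rightarrow> (nat \<Rightarrow> 'a) set \<Rightarrow> nat \<Rightarrow>
     (nat \<Rightarrow> 'a mpoly \<times> 'a mpoly) \<Rightarrow> bool" where
  "separable_map F n V r \<nu> \<longleftrightarrow> (\<exists>x. generic_point F n V x \<and>
     separable_algebraic_extension
       (adjoin F ((\<lambda>i. meval (fst (\<nu> i)) x / meval (snd (\<nu> i)) x) ` {..<r}))
       (function_field F n x))"


section \<open>PAC extensions\<close>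

definition pac_in_domain :: "'a::alg_closed_field set \<Rightarrow> 'a set \<Rightarrow> bool" where
  "pac_in_domain K\<^sub>0 K \<longleftrightarrow>
     (\<forall>n V r \<nu>. r \<ge> 1 \<and>
        abs_irreducible n V \<and> defined_over K n V \<and> has_dimension K n V r \<and>
        rational_map K n V r \<nu> \<and> dominating n V r \<nu> \<and> separable_map K n V r \<nu> \<longrightarrow>
        (\<exists>a\<in>rational_points K V. \<exists>c. rational_map_at n V r \<nu> a c \<and> (\<forall>i<r. c i \<in> K\<^sub>0)))"

text \<open>The points of varieties over subfields of \<open>'a\<close> have their coordinates in a universal domain,
  the algebraic closure of the field of rational functions in countably many variables over \<open>'a\<close>.
  It has infinite transcendence degree over \<open>'a\<close>, so generic points always exist.\<close>

type_synonym 'a universal_domain = "'a mpoly fract alg_closure"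

definition to_domain :: "'a::field \<Rightarrow> 'a universal_domain" where
  "to_domain c = to_ac (Fract (Poly_Mapping.single 0 c) 1)"

definition pac_extension :: "'a::field set \<Rightarrow> 'a set \<Rightarrow> bool" where
  "pac_extension K\<^sub>0 K \<longleftrightarrow>
     field_extension K\<^sub>0 K \<and> pac_in_domain (to_domain ` K\<^sub>0) (to_domain ` K)"

end

theory Submission
  imports Defs
begin

text \<open>
  Let \<open>x\<close> be a generic point of \<open>V\<close> over \<open>K\<^sub>2\<close> and \<open>t = \<nu>(x)\<close>. Since \<open>K\<^sub>2/K\<^sub>1\<close> is PAC, there is a
  \<open>K\<^sub>2\<close>-rational point of \<open>V\<close>, outside any given proper closed subset, whose image \<open>b\<close> under \<open>\<nu>\<close>
  is \<open>K\<^sub>1\<close>-rational; choose it where \<open>\<nu>\<close> is etale. By Hensel's lemma the coordinates of \<open>x\<close> become power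
  series in \<open>t - b\<close> with coefficients in a finite extension \<open>L = K\<^sub>1(\<theta>)\<close> of \<open>K\<^sub>1\<close> inside \<open>K\<^sub>2\<close>. Expand them
  in the basis \<open>1, \<theta>, \<theta>\<^sup>2, \<dots>\<close> of \<open>L/K\<^sub>1\<close>: the components are power series \<open>\<eta>\<close> over \<open>K\<^sub>1\<close>, and they
  are separable over \<open>K\<^sub>1(t)\<close> because they are linear combinations of the conjugates of the coordinates.
  A field generated by power series over \<open>K\<^sub>1\<close> is regular over \<open>K\<^sub>1\<close>, so \<open>(t, \<eta>)\<close> is a generic point of
  an absolutely irreducible variety \<open>W\<close> over \<open>K\<^sub>1\<close> with a separable dominating projection to \<open>t\<close>. As
  \<open>K\<^sub>1/K\<^sub>0\<close> is PAC, \<open>W\<close> has a \<open>K\<^sub>1\<close>-rational point lying over a \<open>K\<^sub>0\<close>-rational value of \<open>t\<close>; recombining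
  its components with the powers of \<open>\<theta>\<close> gives the required point in \<open>V(K\<^sub>2)\<close>.
\<close>

section \<open>Subrings of integral domains\<close>

text \<open>Over a finite extension \<open>L\<close> of \<open>K\<^sub>1\<close>, the part of the
  Weil restriction of \<open>V\<close> on which the map takes values in affine
  \<open>r\<close>-space has dimension \<open>r\<close> but may be reducible over the algebraic
  closure, so the PAC property of \<open>K\<^sub>1\<close> over \<open>K\<^sub>0\<close> cannot be
  applied to it directly. The rational point obtained first selects a component: etaleness and the
  \<open>K\<^sub>1\<close>-rational image turn the coordinates into power series around that image.
  Series with coefficients in \<open>K\<^sub>1\<close> are linearly disjoint from the ambient
  constants over \<open>K\<^sub>1\<close>, by comparison of coefficients, and this makes the locus
  of a tuple of them absolutely irreducible and defined over \<open>K\<^sub>1\<close>. Series rings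
  are domains but not fields. The algebra is therefore done over subrings of integral domains, with
  pseudo-division in place of division, and separability is expressed by a relation whose derivative
  does not vanish at the element. Such relations are preserved by injective homomorphisms, which
  carry information back and forth between series and the algebraically closed field.\<close>

definition is_subring :: "'a::comm_ring_1 set \<Rightarrow> bool" where
  "is_subring A \<longleftrightarrow> 1 \<in> A \<and> (\<forall>a\<in>A. \<forall>b\<in>A. a - b \<in> A \<and> a * b \<in> A)"

lemma is_subringI:
  assumes "1 \<in> A" "\<And>a b. a \<in> A \<Longrightarrow> b \<in> A \<Longrightarrow> a - b \<in> A" "\<And>a b. a \<in> A \<Longrightarrow> b \<in> A \<Longrightarrow> a * b \<in> A"
  shows "is_subring A"
  using assms by (auto simp: is_subring_def)

context
  fixes A :: "'a::comm_ring_1 set"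
  assumes A: "is_subring A"
begin

lemma subring_one: "1 \<in> A" and subring_diff: "a \<in> A \<Longrightarrow> b \<in> A \<Longrightarrow> a - b \<in> A"
  and subring_mult: "a \<in> A \<Longrightarrow> b \<in> A \<Longrightarrow> a * b \<in> A"
  using A by (auto simp: is_subring_def)

lemma subring_zero: "0 \<in> A"
  using subring_diff[OF subring_one subring_one] by simp

lemma subring_uminus: "a \<in> A \<Longrightarrow> - a \<in> A"
  using subring_diff[OF subring_zero] by fastforce

lemma subring_add: "a \<in> A \<Longrightarrow> b \<in> A \<Longrightarrow> a + b \<in> A"
  using subring_diff[of a "- b"] subring_uminus[of b] by simp

lemma subring_power: "a \<in> A \<Longrightarrow> a ^ n \<in> A"
  by (induction n) (auto intro: subring_one subring_mult)

lemma subring_sum: "(\<And>i. i \<in> I \<Longrightarrow> f i \<in> A) \<Longrightarrow> sum f I \<in> A"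
  by (induction I rule: infinite_finite_induct) (auto intro: subring_zero subring_add)

lemma subring_prod: "(\<And>i. i \<in> I \<Longrightarrow> f i \<in> A) \<Longrightarrow> prod f I \<in> A"
  by (induction I rule: infinite_finite_induct) (auto intro: subring_one subring_mult)

lemma subring_of_nat: "of_nat n \<in> A"
  by (induction n) (auto intro: subring_one subring_add subring_zero)

lemmas subring_closed = subring_one subring_zero subring_diff subring_uminus subring_add
  subring_mult subring_power subring_sum subring_prod subring_of_nat

end

definition hom_on :: "'a::comm_ring_1 set \<Rightarrow> ('a \<Rightarrow> 'b::comm_ring_1) \<Rightarrow> bool" where
  "hom_on A h \<longleftrightarrow> h 1 = 1 \<and> (\<forall>a\<in>A. \<forall>b\<in>A. h (a - b) = h a - h b \<and> h (a * b) = h a * h b)"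

lemma hom_onI:
  assumes "h 1 = 1" "\<And>a b. a \<in> A \<Longrightarrow> b \<in> A \<Longrightarrow> h (a - b) = h a - h b"
    "\<And>a b. a \<in> A \<Longrightarrow> b \<in> A \<Longrightarrow> h (a * b) = h a * h b"
  shows "hom_on A h"
  using assms by (auto simp: hom_on_def)

context
  fixes A :: "'a::comm_ring_1 set" and h :: "'a \<Rightarrow> 'b::comm_ring_1"
  assumes A: "is_subring A" and h: "hom_on A h"
begin

lemma hom_on_one: "h 1 = 1"
  and hom_on_diff: "a \<in> A \<Longrightarrow> b \<in> A \<Longrightarrow> h (a - b) = h a - h b"
  and hom_on_mult: "a \<in> A \<Longrightarrow> b \<in> A \<Longrightarrow> h (a * b) = h a * h b"
  using h by (auto simp: hom_on_def)

lemma hom_on_zero: "h 0 = 0"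
  using hom_on_diff[OF subring_one[OF A] subring_one[OF A]] by simp

lemma hom_on_uminus: "a \<in> A \<Longrightarrow> h (- a) = - h a"
  using hom_on_diff[OF subring_zero[OF A]] hom_on_zero by fastforce

lemma hom_on_add: "a \<in> A \<Longrightarrow> b \<in> A \<Longrightarrow> h (a + b) = h a + h b"
  using hom_on_diff[of a "- b"] hom_on_uminus[of b] subring_uminus[OF A, of b] by simp

lemma hom_on_power: "a \<in> A \<Longrightarrow> h (a ^ n) = h a ^ n"
  by (induction n) (auto simp: hom_on_one hom_on_mult subring_power[OF A])

lemma hom_on_sum: "(\<And>i. i \<in> I \<Longrightarrow> f i \<in> A) \<Longrightarrow> h (sum f I) = (\<Sum>i\<in>I. h (f i))"
  by (induction I rule: infinite_finite_induct)
     (auto simp: hom_on_zero hom_on_add subring_sum[OF A])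

lemma hom_on_prod: "(\<And>i. i \<in> I \<Longrightarrow> f i \<in> A) \<Longrightarrow> h (prod f I) = (\<Prod>i\<in>I. h (f i))"
  by (induction I rule: infinite_finite_induct)
     (auto simp: hom_on_one hom_on_mult subring_prod[OF A])

lemma hom_on_of_nat: "h (of_nat n) = of_nat n"
  by (induction n) (auto simp: hom_on_zero hom_on_add hom_on_one subring_of_nat[OF A] subring_one[OF A])

lemmas hom_on_simps = hom_on_one hom_on_zero hom_on_diff hom_on_uminus hom_on_add hom_on_mult
  hom_on_power hom_on_sum hom_on_prod

end

section \<open>Polynomials with coefficients in a subring\<close>

definition pol :: "'a::comm_ring_1 set \<Rightarrow> 'a poly set" where
  "pol A = {p. \<forall>i. poly.coeff p i \<in> A}"

lemma polI: "(\<And>i. poly.coeff p i \<in> A) \<Longrightarrow> p \<in> pol A"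
  and polD: "p \<in> pol A \<Longrightarrow> poly.coeff p i \<in> A"
  by (auto simp: pol_def)

lemma pol_mono: "A \<subseteq> B \<Longrightarrow> pol A \<subseteq> pol B"
  by (auto simp: pol_def)

lemma is_subring_pol: "is_subring A \<Longrightarrow> is_subring (pol A)"
  by (rule is_subringI)
     (auto simp: pol_def coeff_mult coeff_1 intro!: subring_closed)

lemma pol_monom: "is_subring A \<Longrightarrow> c \<in> A \<Longrightarrow> monom c n \<in> pol A"
  by (auto simp: pol_def coeff_monom intro: subring_zero)

lemma pol_const: "is_subring A \<Longrightarrow> c \<in> A \<Longrightarrow> [:c:] \<in> pol A"
  by (auto simp: pol_def coeff_pCons split: nat.splits intro: subring_zero)

lemma pol_pCons: "p \<in> pol A \<Longrightarrow> c \<in> A \<Longrightarrow> pCons c p \<in> pol A"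
  by (auto simp: pol_def coeff_pCons split: nat.splits)

lemma pol_pCons_iff: "pCons c p \<in> pol A \<longleftrightarrow> c \<in> A \<and> p \<in> pol A"
proof
  assume *: "pCons c p \<in> pol A"
  show "c \<in> A \<and> p \<in> pol A"
    using polD[OF *, of 0] polD[OF *, of "Suc _"] by (auto intro: polI)
qed (auto intro: pol_pCons)

lemma pol_smult: "is_subring A \<Longrightarrow> p \<in> pol A \<Longrightarrow> c \<in> A \<Longrightarrow> smult c p \<in> pol A"
  by (auto simp: pol_def intro: subring_mult)

lemma pol_pderiv: "is_subring (A :: 'a::idom set) \<Longrightarrow> p \<in> pol A \<Longrightarrow> pderiv p \<in> pol A"
  by (auto simp: pol_def coeff_pderiv simp del: of_nat_Suc intro!: subring_mult intro: subring_of_nat)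

lemma poly_in_subring: "is_subring A \<Longrightarrow> p \<in> pol A \<Longrightarrow> x \<in> A \<Longrightarrow> poly p x \<in> A"
  by (auto simp: poly_altdef pol_def intro!: subring_closed)

context
  fixes A :: "'a::comm_ring_1 set" and h :: "'a \<Rightarrow> 'b::comm_ring_1"
  assumes A: "is_subring A" and h: "hom_on A h"
begin

lemma coeff_map_poly_hom: "poly.coeff (map_poly h p) i = h (poly.coeff p i)"
  by (rule coeff_map_poly) (rule hom_on_zero[OF A h])

lemma map_poly_hom_on: "hom_on (pol A) (map_poly h)"
proof (rule hom_onI)
  show "map_poly h 1 = 1"
    by (rule poly_eqI) (simp add: coeff_map_poly_hom coeff_1 hom_on_one[OF A h] hom_on_zero[OF A h])
next
  fix p q assume "p \<in> pol A" "q \<in> pol A"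
  thus "map_poly h (p - q) = map_poly h p - map_poly h q"
    by (intro poly_eqI) (auto simp: coeff_map_poly_hom hom_on_diff[OF A h] polD)
next
  fix p q assume "p \<in> pol A" "q \<in> pol A"
  thus "map_poly h (p * q) = map_poly h p * map_poly h q"
    by (intro poly_eqI)
       (simp add: coeff_map_poly_hom coeff_mult hom_on_sum[OF A h] hom_on_mult[OF A h] polD
          subring_mult[OF A])
qed

lemma map_poly_hom_pCons:
  "p \<in> pol A \<Longrightarrow> c \<in> A \<Longrightarrow> map_poly h (pCons c p) = pCons (h c) (map_poly h p)"
  by (rule poly_eqI) (simp add: coeff_map_poly_hom coeff_pCons split: nat.splits)

lemma hom_on_poly: "p \<in> pol A \<Longrightarrow> x \<in> A \<Longrightarrow> h (poly p x) = poly (map_poly h p) (h x)"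
proof (induction p)
  case 0
  show ?case by (simp add: hom_on_zero[OF A h])
next
  case (pCons a p)
  hence "a \<in> A" "p \<in> pol A" by (auto simp: pol_pCons_iff)
  thus ?case
    using pCons
    by (simp add: map_poly_hom_pCons hom_on_add[OF A h] hom_on_mult[OF A h] subring_mult[OF A]
        poly_in_subring[OF A])
qed

end

lemma map_poly_hom_pderiv:
  fixes h :: "'a::idom \<Rightarrow> 'b::idom"
  assumes A: "is_subring A" and h: "hom_on A h" and p: "p \<in> pol A"
  shows "map_poly h (pderiv p) = pderiv (map_poly h p)"
  by (rule poly_eqI)
     (simp add: coeff_map_poly_hom[OF A h] coeff_pderiv hom_on_mult[OF A h] hom_on_of_nat[OF A h]
        polD[OF p] subring_of_nat[OF A] del: of_nat_Suc)

section \<open>Subrings generated by a set\<close>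

definition gen :: "'a::comm_ring_1 set \<Rightarrow> 'a set" where
  "gen S = \<Inter>{B. is_subring B \<and> S \<subseteq> B}"

lemma is_subring_gen: "is_subring (gen S)"
  unfolding gen_def is_subring_def by blast

lemma gen_superset: "S \<subseteq> gen S"
  unfolding gen_def by blast

lemma gen_least: "is_subring B \<Longrightarrow> S \<subseteq> B \<Longrightarrow> gen S \<subseteq> B"
  unfolding gen_def by blast

lemma gen_mono: "S \<subseteq> S' \<Longrightarrow> gen S \<subseteq> gen S'"
  by (rule gen_least[OF is_subring_gen]) (use gen_superset in blast)

lemma gen_subring: "is_subring A \<Longrightarrow> gen A = A"
  using gen_superset[of A] gen_least[of A A] by blast

lemma gen_insert_gen: "gen (insert x (gen S)) = gen (insert x S)"
proof
  show "gen (insert x (gen S)) \<subseteq> gen (insert x S)"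
    by (rule gen_least[OF is_subring_gen]) (use gen_superset gen_mono[of S "insert x S"] in blast)
  show "gen (insert x S) \<subseteq> gen (insert x (gen S))"
    by (rule gen_mono) (use gen_superset in blast)
qed

lemma gen_insert_eq:
  assumes A: "is_subring A"
  shows "gen (insert x A) = (\<lambda>p. poly p x) ` pol A"
proof
  have "is_subring ((\<lambda>p. poly p x) ` pol A)"
  proof (rule is_subringI)
    show "1 \<in> (\<lambda>p. poly p x) ` pol A"
      using subring_one[OF is_subring_pol[OF A]] by (force intro: image_eqI[of _ _ 1])
  next
    fix a b assume "a \<in> (\<lambda>p. poly p x) ` pol A" "b \<in> (\<lambda>p. poly p x) ` pol A"
    then obtain p q where pq: "p \<in> pol A" "q \<in> pol A" "a = poly p x" "b = poly q x" by blast
    show "a - b \<in> (\<lambda>p. poly p x) ` pol A"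
      using pq subring_diff[OF is_subring_pol[OF A]] by (intro image_eqI[of _ _ "p - q"]) auto
    show "a * b \<in> (\<lambda>p. poly p x) ` pol A"
      using pq subring_mult[OF is_subring_pol[OF A]] by (intro image_eqI[of _ _ "p * q"]) auto
  qed
  moreover have "insert x A \<subseteq> (\<lambda>p. poly p x) ` pol A"
  proof -
    have "x \<in> (\<lambda>p. poly p x) ` pol A"
      by (rule image_eqI[of _ _ "[:0, 1:]"])
         (auto intro!: pol_pCons pol_const subring_closed A)
    moreover have "a \<in> (\<lambda>p. poly p x) ` pol A" if "a \<in> A" for a
      by (rule image_eqI[of _ _ "[:a:]"]) (auto intro!: pol_const A that)
    ultimately show ?thesis by blast
  qed
  ultimately show "gen (insert x A) \<subseteq> (\<lambda>p. poly p x) ` pol A" by (rule gen_least)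
  show "(\<lambda>p. poly p x) ` pol A \<subseteq> gen (insert x A)"
  proof
    fix y assume "y \<in> (\<lambda>p. poly p x) ` pol A"
    then obtain p where "p \<in> pol A" "y = poly p x" by blast
    moreover have "A \<subseteq> gen (insert x A)" "x \<in> gen (insert x A)" using gen_superset by blast+
    ultimately show "y \<in> gen (insert x A)"
      using pol_mono[of A "gen (insert x A)"] by (auto intro!: poly_in_subring is_subring_gen)
  qed
qed

section \<open>Pseudo-division and relations of least degree\<close>

lemma pseudo_division:
  fixes f :: "'a::idom poly"
  assumes A: "is_subring A" and f: "f \<in> pol A" "f \<noteq> 0" and p: "p \<in> pol A"
  shows "\<exists>k. \<exists>q\<in>pol A. \<exists>r\<in>pol A. smult (lead_coeff f ^ k) p = f * q + r
     \<and> (r = 0 \<or> Polynomial.degree r < Polynomial.degree f)"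
  using p
\<comment> \<open>The zero polynomial gets a smaller measure than a nonzero constant, so the measure
  drops even when a constant is cancelled to 0.\<close>
proof (induction "if p = 0 then 0 else Suc (Polynomial.degree p)" arbitrary: p rule: less_induct)
  case (less p)
  note P = is_subring_pol[OF A]
  show ?case
  proof (cases "p = 0 \<or> Polynomial.degree p < Polynomial.degree f")
    case True
    thus ?thesis using less.prems
      by (intro exI[of _ 0] bexI[of _ 0] bexI[of _ p]) (auto intro: subring_zero[OF P])
  next
    case False
    \<comment> \<open>Each cancellation of a leading term multiplies \<open>p\<close> by
      \<open>lead_coeff f\<close> instead of dividing by it; the exponent \<open>k\<close> counts
      these factors.\<close>
    define m where "m = monom (lead_coeff p) (Polynomial.degree p - Polynomial.degree f)"
    define p' where "p' = smult (lead_coeff f) p - f * m"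
    have m: "m \<in> pol A" unfolding m_def by (intro pol_monom A polD less.prems)
    have p': "p' \<in> pol A" unfolding p'_def
      by (intro subring_diff[OF P] pol_smult A less.prems polD subring_mult[OF P] m f)
    have "p' = 0 \<or> Polynomial.degree p' < Polynomial.degree p"
    proof (rule disjCI)
      assume nz: "\<not> Polynomial.degree p' < Polynomial.degree p"
      have deg: "Polynomial.degree (f * m) = Polynomial.degree p"
        using False f by (simp add: m_def degree_mult_eq degree_monom_eq monom_eq_0_iff)
      have "Polynomial.degree p' \<le> Polynomial.degree p"
        unfolding p'_def using deg by (intro degree_diff_le) auto
      with nz have d: "Polynomial.degree p' = Polynomial.degree p" by simp
      have "poly.coeff (f * m) (Polynomial.degree p) = lead_coeff f * lead_coeff p"
        using deg lead_coeff_mult[of f m] False by (simp add: m_def degree_monom_eq)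
      hence "lead_coeff p' = 0" unfolding d by (simp add: p'_def)
      thus "p' = 0" by simp
    qed
    hence "(if p' = 0 then 0 else Suc (Polynomial.degree p')) < (if p = 0 then 0 else Suc (Polynomial.degree p))"
      using False by auto
    from less.hyps[OF this p'] obtain k q r where
      *: "q \<in> pol A" "r \<in> pol A" "smult (lead_coeff f ^ k) p' = f * q + r"
         "r = 0 \<or> Polynomial.degree r < Polynomial.degree f" by blast
    have "smult (lead_coeff f ^ Suc k) p = f * (q + smult (lead_coeff f ^ k) m) + r"
    proof -
      have "smult (lead_coeff f ^ k) p' = smult (lead_coeff f ^ Suc k) p - f * smult (lead_coeff f ^ k) m"
        by (simp add: p'_def smult_diff_right mult.commute)
      thus ?thesis using *(3) by (simp add: algebra_simps)
    qed
    moreover have "q + smult (lead_coeff f ^ k) m \<in> pol A"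
      by (intro subring_add[OF P] * pol_smult A m subring_power polD f)
    ultimately show ?thesis using * by blast
  qed
qed

text \<open>For algebraic \<open>x\<close>, a polynomial \<open>f\<close> over \<open>A\<close> of least degree vanishing at \<open>x\<close> plays the
  role of a minimal polynomial, without passing to the fraction field of \<open>A\<close>.\<close>

definition least_vanishing :: "'a::idom set \<Rightarrow> 'a \<Rightarrow> 'a poly \<Rightarrow> bool" where
  "least_vanishing A x f \<longleftrightarrow> f \<in> pol A \<and> f \<noteq> 0 \<and> poly f x = 0 \<and>
     (\<forall>g\<in>pol A. g \<noteq> 0 \<and> poly g x = 0 \<longrightarrow> Polynomial.degree f \<le> Polynomial.degree g)"

lemma least_vanishing_exists:
  assumes "g \<in> pol A" "g \<noteq> 0" "poly g x = 0"
  shows "\<exists>f. least_vanishing A x f"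
proof -
  let ?P = "\<lambda>g. g \<in> pol A \<and> g \<noteq> 0 \<and> poly g x = 0"
  have "is_arg_min Polynomial.degree ?P (arg_min Polynomial.degree ?P)"
    using arg_min_natI[of ?P g Polynomial.degree] arg_min_nat_le[of ?P _ Polynomial.degree] assms
    by (force simp: is_arg_min_linorder)
  thus ?thesis by (auto simp: least_vanishing_def is_arg_min_linorder)
qed

text \<open>The pseudo-remainder vanishes at \<open>x\<close> and has degree below that of
  \<open>f\<close>, so minimality makes it zero.\<close>

lemma least_vanishing_divides:
  assumes A: "is_subring A" and f: "least_vanishing A x f" and p: "p \<in> pol A" "poly p x = 0"
  shows "\<exists>k. \<exists>q\<in>pol A. smult (lead_coeff f ^ k) p = f * q"
proof -
  from f have f': "f \<in> pol A" "f \<noteq> 0" "poly f x = 0" by (auto simp: least_vanishing_def)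
  from pseudo_division[OF A f'(1,2) p(1)] obtain k q r where
    *: "q \<in> pol A" "r \<in> pol A" "smult (lead_coeff f ^ k) p = f * q + r"
       "r = 0 \<or> Polynomial.degree r < Polynomial.degree f" by blast
  have "poly r x = 0" using arg_cong[OF *(3), of "\<lambda>p. poly p x"] p f' by simp
  hence "r = 0" using * f by (force simp: least_vanishing_def)
  thus ?thesis using * by auto
qed

lemma least_vanishing_degree:
  assumes "least_vanishing A x f"
  shows "Polynomial.degree f \<noteq> 0"
proof
  assume "Polynomial.degree f = 0"
  then obtain c where "f = [:c:]" by (rule degree_eq_zeroE)
  thus False using assms by (auto simp: least_vanishing_def)
qed

text \<open>A nonzero combination \<open>g\<close> of \<open>p\<close> and \<open>f\<close> of least
  degree pseudo-divides both. It does not vanish at \<open>x\<close>, since \<open>p\<close> does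
  not; hence the cofactor of \<open>f\<close> vanishes at \<open>x\<close>, has full degree by
  minimality of \<open>f\<close>, and leaves degree 0 for \<open>g\<close>. Evaluated at
  \<open>x\<close>, the identity says that \<open>p(x)\<close> divides a nonzero element of
  \<open>A\<close> inside \<open>A[x]\<close>, which replaces invertibility in a field.\<close>

lemma least_vanishing_bezout:
  assumes A: "is_subring A" and f: "least_vanishing A x f" and p: "p \<in> pol A" "poly p x \<noteq> 0"
  shows "\<exists>a\<in>pol A. \<exists>b\<in>pol A. \<exists>c\<in>A. c \<noteq> 0 \<and> a * p + b * f = [:c:]"
proof -
  note P = is_subring_pol[OF A]
  from f have f': "f \<in> pol A" "f \<noteq> 0" "poly f x = 0" by (auto simp: least_vanishing_def)
  let ?J = "\<lambda>g. g \<noteq> 0 \<and> (\<exists>a\<in>pol A. \<exists>b\<in>pol A. g = a * p + b * f)"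
  have Jf: "?J f"
    using f' subring_one[OF P] subring_zero[OF P]
    by (intro conjI bexI[of _ 0] bexI[of _ 1]) auto
  obtain g where g: "?J g" and gmin: "\<And>g'. ?J g' \<Longrightarrow> Polynomial.degree g \<le> Polynomial.degree g'"
    using arg_min_natI[of ?J f Polynomial.degree, OF Jf] arg_min_nat_le[of ?J _ Polynomial.degree]
    by blast
  then obtain a b where ab: "a \<in> pol A" "b \<in> pol A" "g = a * p + b * f" by blast
  have gA: "g \<in> pol A" using ab f' p by (auto intro!: subring_closed[OF P])
  have dvd: "\<exists>k. \<exists>q\<in>pol A. smult (lead_coeff g ^ k) e = g * q"
    if e: "\<exists>a\<in>pol A. \<exists>b\<in>pol A. e = a * p + b * f" for e
  proof -
    obtain a' b' where e': "a' \<in> pol A" "b' \<in> pol A" "e = a' * p + b' * f" using e by blast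
    hence eA: "e \<in> pol A" using f' p by (auto intro!: subring_closed[OF P])
    from pseudo_division[OF A gA _ eA] g obtain k q r where
    *: "q \<in> pol A" "r \<in> pol A" "smult (lead_coeff g ^ k) e = g * q + r"
       "r = 0 \<or> Polynomial.degree r < Polynomial.degree g" by blast
    have "r = (smult (lead_coeff g ^ k) a' - q * a) * p + (smult (lead_coeff g ^ k) b' - q * b) * f"
      using *(3) unfolding e' ab(3) by (simp add: algebra_simps smult_add_right)
    moreover have "smult (lead_coeff g ^ k) a' - q * a \<in> pol A" "smult (lead_coeff g ^ k) b' - q * b \<in> pol A"
      by (intro subring_diff[OF P] pol_smult[OF A] subring_mult[OF P] subring_power[OF A]
          polD[OF gA] e' ab *)+
    ultimately have "r = 0" using *(4) gmin[of r] by force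
    thus ?thesis using * by auto
  qed
  from dvd[of p] obtain k q where q: "q \<in> pol A" "smult (lead_coeff g ^ k) p = g * q"
    using subring_one[OF P] subring_zero[OF P] by (metis add.right_neutral mult_1 mult_zero_left)
  from dvd[of f] obtain k' q' where q': "q' \<in> pol A" "smult (lead_coeff g ^ k') f = g * q'"
    using subring_one[OF P] subring_zero[OF P] by (metis add_0 mult_1 mult_zero_left)
  have lg: "lead_coeff g \<noteq> 0" using g by simp
  have "poly g x * poly q x = lead_coeff g ^ k * poly p x"
    using arg_cong[OF q(2), of "\<lambda>p. poly p x"] by simp
  hence "poly g x \<noteq> 0" using p lg by (metis mult_eq_0_iff power_not_zero)
  moreover have "poly g x * poly q' x = 0"
    using arg_cong[OF q'(2), of "\<lambda>p. poly p x"] f' by simp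
  ultimately have "poly q' x = 0" by simp
  moreover have q'nz: "q' \<noteq> 0" using q' lg f' by auto
  ultimately have "Polynomial.degree f \<le> Polynomial.degree q'"
    using f q' by (auto simp: least_vanishing_def)
  moreover have "Polynomial.degree f = Polynomial.degree g + Polynomial.degree q'"
    using arg_cong[OF q'(2), of Polynomial.degree] lg g q'nz by (simp add: degree_mult_eq)
  ultimately have "Polynomial.degree g = 0" by simp
  then obtain c where c: "g = [:c:]" by (rule degree_eq_zeroE)
  moreover have "c \<in> A" using polD[OF gA, of 0] c by simp
  ultimately show ?thesis using ab g by (intro bexI[of _ a] bexI[of _ b] bexI[of _ c]) auto
qed

text \<open>The first isomorphism theorem, with a preimage chosen for each value of
  \<open>F\<close>. It turns substitutions into polynomials into homomorphisms on the generated
  rings.\<close>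

lemma hom_on_from_relation:
  fixes F :: "'p::comm_ring_1 \<Rightarrow> 'a::comm_ring_1" and G :: "'p \<Rightarrow> 'b::comm_ring_1"
  assumes P: "is_subring P" and F: "hom_on P F" and G: "hom_on P G"
    and wd: "\<And>p. p \<in> P \<Longrightarrow> F p = 0 \<Longrightarrow> G p = 0"
  shows "\<exists>h. hom_on (F ` P) h \<and> (\<forall>p\<in>P. h (F p) = G p)"
proof -
  define h where "h = (\<lambda>y. G (SOME p. p \<in> P \<and> F p = y))"
  have h: "h (F p) = G p" if p: "p \<in> P" for p
  proof -
    let ?q = "SOME q. q \<in> P \<and> F q = F p"
    have q: "?q \<in> P \<and> F ?q = F p" using p by (intro someI[of "\<lambda>q. q \<in> P \<and> F q = F p" p]) simp
    hence "F (?q - p) = 0" using p hom_on_diff[OF P F] by simp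
    hence "G (?q - p) = 0" using q p wd subring_diff[OF P] by blast
    thus ?thesis using q p hom_on_diff[OF P G] by (simp add: h_def)
  qed
  have "hom_on (F ` P) h"
  proof (rule hom_onI)
    show "h 1 = 1" using h[OF subring_one[OF P]] hom_on_one[OF P F] hom_on_one[OF P G] by simp
  next
    fix a b assume "a \<in> F ` P" "b \<in> F ` P"
    then obtain p q where pq: "p \<in> P" "q \<in> P" "a = F p" "b = F q" by blast
    show "h (a - b) = h a - h b"
      using pq h[OF subring_diff[OF P pq(1,2)]] by (simp add: hom_on_diff[OF P F] hom_on_diff[OF P G] h)
    show "h (a * b) = h a * h b"
      using pq h[OF subring_mult[OF P pq(1,2)]] by (simp add: hom_on_mult[OF P F] hom_on_mult[OF P G] h)
  qed
  thus ?thesis using h by blast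
qed

lemma poly_eval_hom_on: "hom_on S (\<lambda>p. poly p x)"
  by (rule hom_onI) auto

lemma hom_on_comp:
  "hom_on A g \<Longrightarrow> g ` A \<subseteq> B \<Longrightarrow> hom_on B h \<Longrightarrow> hom_on A (\<lambda>a. h (g a))"
  by (auto simp: hom_on_def image_subset_iff)

lemma extend_hom:
  fixes \<phi> :: "'a::idom \<Rightarrow> 'b::idom"
  assumes A: "is_subring A" and \<phi>: "hom_on A \<phi>"
    and wd: "\<And>p. p \<in> pol A \<Longrightarrow> poly p x = 0 \<Longrightarrow> poly (map_poly \<phi> p) \<omega> = 0"
  shows "\<exists>\<psi>. hom_on (gen (insert x A)) \<psi> \<and> (\<forall>p\<in>pol A. \<psi> (poly p x) = poly (map_poly \<phi> p) \<omega>) \<and>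
     (\<forall>a\<in>A. \<psi> a = \<phi> a) \<and> \<psi> x = \<omega>"
proof -
  have "hom_on (pol A) (\<lambda>p. poly (map_poly \<phi> p) \<omega>)"
    by (rule hom_on_comp[OF map_poly_hom_on[OF A \<phi>] subset_UNIV poly_eval_hom_on])
  from hom_on_from_relation[OF is_subring_pol[OF A] poly_eval_hom_on this wd]
  obtain \<psi> where \<psi>: "hom_on ((\<lambda>p. poly p x) ` pol A) \<psi>"
    "\<And>p. p \<in> pol A \<Longrightarrow> \<psi> (poly p x) = poly (map_poly \<phi> p) \<omega>" by blast
  have "\<psi> a = \<phi> a" if "a \<in> A" for a
    using \<psi>(2)[OF pol_const[OF A that]] that hom_on_zero[OF A \<phi>] by (simp add: map_poly_pCons)
  moreover have "\<psi> x = \<omega>"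
    using \<psi>(2)[OF pol_pCons[OF pol_const[OF A subring_one[OF A]] subring_zero[OF A]]]
      hom_on_zero[OF A \<phi>] hom_on_one[OF A \<phi>] by (simp add: map_poly_pCons)
  ultimately show ?thesis using \<psi> by (auto simp: gen_insert_eq[OF A])
qed

text \<open>A relation \<open>p\<close> of \<open>x\<close> satisfies \<open>l^k p = f q\<close>
  with \<open>l\<close> the leading coefficient of \<open>f\<close>. Applying \<open>\<phi>\<close>
  and evaluating at \<open>\<omega>\<close> leaves a power of the nonzero element
  \<open>\<phi> l\<close> times the value of \<open>p\<close>, so relations are respected.\<close>

lemma extend_hom_algebraic:
  fixes \<phi> :: "'a::idom \<Rightarrow> 'b::idom"
  assumes A: "is_subring A" and \<phi>: "hom_on A \<phi>" and f: "least_vanishing A x f"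
    and l: "\<phi> (lead_coeff f) \<noteq> 0" and \<omega>: "poly (map_poly \<phi> f) \<omega> = 0"
  shows "\<exists>\<psi>. hom_on (gen (insert x A)) \<psi> \<and> (\<forall>p\<in>pol A. \<psi> (poly p x) = poly (map_poly \<phi> p) \<omega>) \<and>
     (\<forall>a\<in>A. \<psi> a = \<phi> a) \<and> \<psi> x = \<omega>"
proof (rule extend_hom[OF A \<phi>])
  fix p assume p: "p \<in> pol A" "poly p x = 0"
  from f have fA: "f \<in> pol A" by (simp add: least_vanishing_def)
  from least_vanishing_divides[OF A f p] obtain k q
    where q: "q \<in> pol A" "smult (lead_coeff f ^ k) p = f * q" by blast
  note P = is_subring_pol[OF A] and m = map_poly_hom_on[OF A \<phi>]
  have c: "lead_coeff f ^ k \<in> A" using subring_power[OF A] polD[OF fA] by blast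
  have "map_poly \<phi> (smult (lead_coeff f ^ k) p) = smult (\<phi> (lead_coeff f ^ k)) (map_poly \<phi> p)"
    by (rule poly_eqI) (simp add: coeff_map_poly_hom[OF A \<phi>] hom_on_mult[OF A \<phi>] c polD[OF p(1)])
  moreover have "map_poly \<phi> (f * q) = map_poly \<phi> f * map_poly \<phi> q"
    using hom_on_mult[OF P m fA q(1)] .
  ultimately have "smult (\<phi> (lead_coeff f) ^ k) (map_poly \<phi> p) = map_poly \<phi> f * map_poly \<phi> q"
    using q(2) hom_on_power[OF A \<phi>] polD[OF fA] by simp
  from arg_cong[OF this, of "\<lambda>p. poly p \<omega>"] l \<omega> show "poly (map_poly \<phi> p) \<omega> = 0" by simp
qed

section \<open>Extension of homomorphisms and derivations\<close>

text \<open>Euclid's argument: in a finite field, one plus the product of all \<open>X - a\<close>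
  would have positive degree and no root.\<close>

lemma infinite_UNIV_alg_closed: "infinite (UNIV :: 'a::alg_closed_field set)"
proof
  assume fin: "finite (UNIV :: 'a set)"
  define p :: "'a poly" where "p = (\<Prod>a\<in>UNIV. [:- a, 1:]) + 1"
  have "Polynomial.degree (\<Prod>a\<in>(UNIV::'a set). [:- a, 1:]) = card (UNIV :: 'a set)"
    by (subst degree_prod_eq_sum_degree) auto
  moreover have "card (UNIV :: 'a set) > 0" using fin by (simp add: card_gt_0_iff)
  ultimately have "Polynomial.degree p > 0"
    unfolding p_def by (subst degree_add_eq_left) auto
  then obtain x where "poly p x = 0" using alg_closed_imp_poly_has_root by blast
  moreover have "poly (\<Prod>a\<in>(UNIV::'a set). [:- a, 1:]) x = 0"
    using fin by (auto simp: poly_prod intro: exI[of _ x])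
  ultimately show False by (simp add: p_def)
qed

lemma extension_step:
  fixes A :: "'a::idom set"
  assumes A: "is_subring A" and u: "u \<in> gen (insert x A)" "u \<noteq> 0"
  shows "\<exists>v\<in>A. v \<noteq> 0 \<and> (\<forall>\<phi> :: 'a \<Rightarrow> 'b::alg_closed_field. hom_on A \<phi> \<and> \<phi> v \<noteq> 0 \<longrightarrow>
    (\<exists>\<psi>. hom_on (gen (insert x A)) \<psi> \<and> (\<forall>a\<in>A. \<psi> a = \<phi> a) \<and> \<psi> u \<noteq> 0))"
proof -
  obtain p where p: "p \<in> pol A" "u = poly p x" using u gen_insert_eq[OF A] by blast
  show ?thesis
  proof (cases "\<exists>g\<in>pol A. g \<noteq> 0 \<and> poly g x = 0")
    case False
    \<comment> \<open>Here \<open>x\<close> satisfies no relation, so any value \<omega> may be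
      assigned to it. The leading coefficient of \<open>p\<close> is kept nonzero so that the image
      of \<open>p\<close> is a nonzero polynomial, which has a nonroot in the infinite target
      field.\<close>
    show ?thesis
    proof (intro bexI[of _ "lead_coeff p"] conjI allI impI)
      show "lead_coeff p \<in> A" "lead_coeff p \<noteq> 0" using p u by (auto intro: polD)
      fix \<phi> :: "'a \<Rightarrow> 'b" assume \<phi>: "hom_on A \<phi> \<and> \<phi> (lead_coeff p) \<noteq> 0"
      hence h: "hom_on A \<phi>" by blast
      have "poly.coeff (map_poly \<phi> p) (Polynomial.degree p) \<noteq> 0"
        using \<phi> by (simp add: coeff_map_poly_hom[OF A h])
      hence nz: "map_poly \<phi> p \<noteq> 0" by auto
      have "\<exists>\<omega>. poly (map_poly \<phi> p) \<omega> \<noteq> 0"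
        using poly_roots_finite[OF nz] infinite_UNIV_alg_closed[where ?'a = 'b]
        by (metis (mono_tags, lifting) UNIV_eq_I mem_Collect_eq)
      then obtain \<omega> where \<omega>: "poly (map_poly \<phi> p) \<omega> \<noteq> 0" ..
      obtain \<psi> where "hom_on (gen (insert x A)) \<psi>" "\<forall>p\<in>pol A. \<psi> (poly p x) = poly (map_poly \<phi> p) \<omega>"
        "\<forall>a\<in>A. \<psi> a = \<phi> a"
        using extend_hom[OF A h, of x \<omega>] False hom_on_zero[OF A h] by (metis map_poly_0 poly_0)
      thus "\<exists>\<psi>. hom_on (gen (insert x A)) \<psi> \<and> (\<forall>a\<in>A. \<psi> a = \<phi> a) \<and> \<psi> u \<noteq> 0"
        using \<omega> p by (intro exI[of _ \<psi>]) auto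
    qed
  next
    case True
    then obtain f where f: "least_vanishing A x f" using least_vanishing_exists by blast
    hence f': "f \<in> pol A" "f \<noteq> 0" by (auto simp: least_vanishing_def)
    from least_vanishing_bezout[OF A f p(1)] u p obtain a b c where
      abc: "a \<in> pol A" "b \<in> pol A" "c \<in> A" "c \<noteq> 0" "a * p + b * f = [:c:]" by blast
    \<comment> \<open>\<open>lead_coeff f\<close> must survive so that a root of the image of
      \<open>f\<close> extends \<open>\<phi>\<close>; the Bezout constant \<open>c\<close> must
      survive because \<open>u\<close> divides it in \<open>A[x]\<close>.\<close>
    show ?thesis
    proof (intro bexI[of _ "lead_coeff f * c"] conjI allI impI)
      show "lead_coeff f * c \<in> A" using f' abc by (intro subring_mult[OF A] polD)
      show "lead_coeff f * c \<noteq> 0" using f' abc by simp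
      fix \<phi> :: "'a \<Rightarrow> 'b" assume \<phi>: "hom_on A \<phi> \<and> \<phi> (lead_coeff f * c) \<noteq> 0"
      hence h: "hom_on A \<phi>" by blast
      have nz: "\<phi> (lead_coeff f) \<noteq> 0" "\<phi> c \<noteq> 0"
        using \<phi> hom_on_mult[OF A h polD[OF f'(1)] abc(3)] by auto
      have "Polynomial.degree f \<le> Polynomial.degree (map_poly \<phi> f)"
        using nz by (intro le_degree) (simp add: coeff_map_poly_hom[OF A h])
      hence "0 < Polynomial.degree (map_poly \<phi> f)" using least_vanishing_degree[OF f] by simp
      then obtain \<omega> where \<omega>: "poly (map_poly \<phi> f) \<omega> = 0"
        using alg_closed_imp_poly_has_root by blast
      from extend_hom_algebraic[OF A h f nz(1) \<omega>] obtain \<psi> where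
        \<psi>: "hom_on (gen (insert x A)) \<psi>" "\<forall>p\<in>pol A. \<psi> (poly p x) = poly (map_poly \<phi> p) \<omega>"
        "\<forall>a\<in>A. \<psi> a = \<phi> a" by blast
      note G = is_subring_gen[of "insert x A"]
      have e: "poly e x \<in> gen (insert x A)" if "e \<in> pol A" for e
        using that gen_insert_eq[OF A] by blast
      have "poly a x * poly p x = c"
        using arg_cong[OF abc(5), of "\<lambda>p. poly p x"] f by (simp add: least_vanishing_def)
      hence "\<psi> (poly a x) * \<psi> u = \<phi> c"
        using hom_on_mult[OF G \<psi>(1) e[OF abc(1)] u(1)] \<psi>(3) abc(3) p(2) by force
      thus "\<exists>\<psi>. hom_on (gen (insert x A)) \<psi> \<and> (\<forall>a\<in>A. \<psi> a = \<phi> a) \<and> \<psi> u \<noteq> 0"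
        using \<psi> nz by (intro exI[of _ \<psi>]) auto
    qed
  qed
qed

text \<open>For an algebraically closed field \<open>A\<close> this contains the Nullstellensatz for prime ideals.\<close>

theorem hom_extension:
  fixes A :: "'a::idom set"
  assumes A: "is_subring A" and Y: "finite Y" and u: "u \<in> gen (Y \<union> A)" "u \<noteq> 0"
  shows "\<exists>v\<in>A. v \<noteq> 0 \<and> (\<forall>\<phi> :: 'a \<Rightarrow> 'b::alg_closed_field. hom_on A \<phi> \<and> \<phi> v \<noteq> 0 \<longrightarrow>
    (\<exists>\<psi>. hom_on (gen (Y \<union> A)) \<psi> \<and> (\<forall>a\<in>A. \<psi> a = \<phi> a) \<and> \<psi> u \<noteq> 0))"
  using Y u
proof (induction Y arbitrary: u rule: finite_induct)
  case empty
  thus ?case using gen_subring[OF A] by (intro bexI[of _ u]) auto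
next
  case (insert x Y)
  have eq: "gen (insert x Y \<union> A) = gen (insert x (gen (Y \<union> A)))"
    by (simp add: gen_insert_gen)
  from extension_step[OF is_subring_gen, of u x "Y \<union> A", where ?'b = 'b] insert.prems eq
  obtain w where w: "w \<in> gen (Y \<union> A)" "w \<noteq> 0"
    "\<And>\<phi> :: 'a \<Rightarrow> 'b. hom_on (gen (Y \<union> A)) \<phi> \<Longrightarrow> \<phi> w \<noteq> 0 \<Longrightarrow>
       \<exists>\<psi>. hom_on (gen (insert x Y \<union> A)) \<psi> \<and> (\<forall>a\<in>gen (Y \<union> A). \<psi> a = \<phi> a) \<and> \<psi> u \<noteq> 0"
    by (auto simp: eq)
  from insert.IH[OF w(1,2)] obtain v where v: "v \<in> A" "v \<noteq> 0"
    "\<And>\<phi> :: 'a \<Rightarrow> 'b. hom_on A \<phi> \<Longrightarrow> \<phi> v \<noteq> 0 \<Longrightarrow>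
       \<exists>\<psi>. hom_on (gen (Y \<union> A)) \<psi> \<and> (\<forall>a\<in>A. \<psi> a = \<phi> a) \<and> \<psi> w \<noteq> 0" by blast
  show ?case
  proof (intro bexI[of _ v] conjI allI impI)
    show "v \<in> A" "v \<noteq> 0" by (fact v)+
    fix \<phi> :: "'a \<Rightarrow> 'b" assume "hom_on A \<phi> \<and> \<phi> v \<noteq> 0"
    then obtain \<psi> where \<psi>: "hom_on (gen (Y \<union> A)) \<psi>" "\<forall>a\<in>A. \<psi> a = \<phi> a" "\<psi> w \<noteq> 0"
      using v(3) by blast
    then obtain \<psi>' where \<psi>': "hom_on (gen (insert x Y \<union> A)) \<psi>'"
      "\<forall>a\<in>gen (Y \<union> A). \<psi>' a = \<psi> a" "\<psi>' u \<noteq> 0"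
      using w(3) by blast
    moreover have "A \<subseteq> gen (Y \<union> A)" using gen_superset[of "Y \<union> A"] by blast
    ultimately show "\<exists>\<psi>. hom_on (gen (insert x Y \<union> A)) \<psi> \<and> (\<forall>a\<in>A. \<psi> a = \<phi> a) \<and> \<psi> u \<noteq> 0"
      using \<psi> by (intro exI[of _ \<psi>']) auto
  qed
qed

definition algebraic_on :: "'a::idom set \<Rightarrow> 'a \<Rightarrow> bool" where
  "algebraic_on A x \<longleftrightarrow> (\<exists>g\<in>pol A. g \<noteq> 0 \<and> poly g x = 0)"

text \<open>Elements are adjoined one at a time, each sent to a root of the image of its least
  relation. By Bezout every nonzero element of the larger ring divides a nonzero element of the
  smaller one, so nothing new enters the kernel. This is how rings of algebraic power series are
  realized inside an algebraically closed field.\<close>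

theorem injective_hom_extension:
  fixes A :: "'a::idom set" and \<phi> :: "'a \<Rightarrow> 'b::alg_closed_field"
  assumes A: "is_subring A" and Y: "finite Y" and alg: "\<And>x. x \<in> Y \<Longrightarrow> algebraic_on A x"
    and \<phi>: "hom_on A \<phi>" "\<And>a. a \<in> A \<Longrightarrow> \<phi> a = 0 \<Longrightarrow> a = 0"
  shows "\<exists>\<psi>. hom_on (gen (Y \<union> A)) \<psi> \<and> (\<forall>a\<in>A. \<psi> a = \<phi> a) \<and> (\<forall>a\<in>gen (Y \<union> A). \<psi> a = 0 \<longrightarrow> a = 0)"
  using Y alg
proof (induction Y rule: finite_induct)
  case empty
  thus ?case using gen_subring[OF A] \<phi> by auto
next
  case (insert x Y)
  define B where "B = gen (Y \<union> A)"
  have eq: "gen (insert x Y \<union> A) = gen (insert x B)"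
    by (simp add: B_def gen_insert_gen)
  have B: "is_subring B" "A \<subseteq> B" unfolding B_def using is_subring_gen gen_superset by blast+
  from insert obtain \<phi>' where \<phi>': "hom_on B \<phi>'" "\<And>a. a \<in> A \<Longrightarrow> \<phi>' a = \<phi> a"
    "\<And>a. a \<in> B \<Longrightarrow> \<phi>' a = 0 \<Longrightarrow> a = 0" unfolding B_def by blast
  from insert.prems[of x] obtain g where "g \<in> pol A" "g \<noteq> 0" "poly g x = 0"
    by (auto simp: algebraic_on_def)
  then obtain f where f: "least_vanishing B x f"
    using least_vanishing_exists[of g B x] pol_mono[OF B(2)] by blast
  hence f': "f \<in> pol B" "f \<noteq> 0" by (auto simp: least_vanishing_def)
  have nz: "\<phi>' (lead_coeff f) \<noteq> 0" using \<phi>'(3)[OF polD[OF f'(1)]] f' by force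
  have "Polynomial.degree f \<le> Polynomial.degree (map_poly \<phi>' f)"
    using nz by (intro le_degree) (simp add: coeff_map_poly_hom[OF B(1) \<phi>'(1)])
  hence "0 < Polynomial.degree (map_poly \<phi>' f)" using least_vanishing_degree[OF f] by simp
  then obtain \<omega> where \<omega>: "poly (map_poly \<phi>' f) \<omega> = 0"
    using alg_closed_imp_poly_has_root by blast
  from extend_hom_algebraic[OF B(1) \<phi>'(1) f nz \<omega>] obtain \<psi> where
    \<psi>: "hom_on (gen (insert x B)) \<psi>" "\<forall>a\<in>B. \<psi> a = \<phi>' a" by blast
  have "a = 0" if a: "a \<in> gen (insert x B)" "\<psi> a = 0" for a
  proof (rule ccontr)
    assume nz: "a \<noteq> 0"
    obtain p where p: "p \<in> pol B" "a = poly p x" using a gen_insert_eq[OF B(1)] by blast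
    from least_vanishing_bezout[OF B(1) f p(1)] nz p obtain e b c where
      e: "e \<in> pol B" "b \<in> pol B" "c \<in> B" "c \<noteq> 0" "e * p + b * f = [:c:]" by blast
    have "poly e x * a = c"
      using arg_cong[OF e(5), of "\<lambda>p. poly p x"] f p by (simp add: least_vanishing_def)
    moreover have "poly e x \<in> gen (insert x B)" using e gen_insert_eq[OF B(1)] by blast
    ultimately have "\<phi>' c = \<psi> (poly e x) * \<psi> a"
      using hom_on_mult[OF is_subring_gen \<psi>(1) _ a(1), of "poly e x"] \<psi>(2) e(3) by auto
    thus False using \<phi>'(3)[OF e(3)] e(4) a by simp
  qed
  thus ?case unfolding eq using \<psi> \<phi>' B by (intro exI[of _ \<psi>]) (auto simp: subset_iff)
qed


text \<open>Separability without fraction fields. The polynomial may be neither minimal nor monic,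
  so the property passes to larger rings and along injective homomorphisms; over a subfield it
  agrees with \<open>separable_over\<close>.\<close>

definition simple_root :: "'a::idom set \<Rightarrow> 'a \<Rightarrow> bool" where
  "simple_root A x \<longleftrightarrow> (\<exists>g\<in>pol A. poly g x = 0 \<and> poly (pderiv g) x \<noteq> 0)"

lemma simple_root_mono: "simple_root A x \<Longrightarrow> A \<subseteq> B \<Longrightarrow> simple_root B x"
  unfolding simple_root_def using pol_mono[of A B] by blast

lemma simple_root_algebraic: "simple_root A x \<Longrightarrow> algebraic_on A x"
  unfolding simple_root_def algebraic_on_def by (metis pderiv_0 poly_0)

text \<open>If \<open>f'\<close> vanished at \<open>x\<close>, differentiating
  \<open>l^k g = f q\<close> and evaluating at \<open>x\<close> would make \<open>g'\<close> vanish
  there for every relation \<open>g\<close>.\<close>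

lemma least_vanishing_simple:
  assumes A: "is_subring A" and x: "simple_root A x" and f: "least_vanishing A x f"
  shows "poly (pderiv f) x \<noteq> 0"
proof
  assume 0: "poly (pderiv f) x = 0"
  obtain g where g: "g \<in> pol A" "poly g x = 0" "poly (pderiv g) x \<noteq> 0"
    using x by (auto simp: simple_root_def)
  from least_vanishing_divides[OF A f g(1,2)] obtain k q where
    "smult (lead_coeff f ^ k) g = f * q" by blast
  from arg_cong[OF this, of "\<lambda>p. poly (pderiv p) x"] 0 f g show False
    by (auto simp: pderiv_smult pderiv_mult least_vanishing_def)
qed

definition derivation_on :: "'a::comm_ring_1 set \<Rightarrow> ('a \<Rightarrow> 'a) \<Rightarrow> bool" where
  "derivation_on A d \<longleftrightarrow> (\<forall>a\<in>A. \<forall>b\<in>A. d (a - b) = d a - d b \<and> d (a * b) = a * d b + b * d a)"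

context
  fixes A :: "'a::idom set" and d :: "'a \<Rightarrow> 'a"
  assumes A: "is_subring A" and d: "derivation_on A d"
begin

lemma derivation_diff: "a \<in> A \<Longrightarrow> b \<in> A \<Longrightarrow> d (a - b) = d a - d b"
  and derivation_mult: "a \<in> A \<Longrightarrow> b \<in> A \<Longrightarrow> d (a * b) = a * d b + b * d a"
  using d by (auto simp: derivation_on_def)

lemma derivation_zero: "d 0 = 0"
  using derivation_diff[OF subring_one[OF A] subring_one[OF A]] by simp

lemma derivation_uminus: "a \<in> A \<Longrightarrow> d (- a) = - d a"
  using derivation_diff[OF subring_zero[OF A], of a] derivation_zero by simp

lemma derivation_add: "a \<in> A \<Longrightarrow> b \<in> A \<Longrightarrow> d (a + b) = d a + d b"
  using derivation_diff[of a "- b"] derivation_uminus[of b] subring_uminus[OF A, of b] by simp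

lemma derivation_sum: "(\<And>i. i \<in> I \<Longrightarrow> f i \<in> A) \<Longrightarrow> d (sum f I) = (\<Sum>i\<in>I. d (f i))"
  by (induction I rule: infinite_finite_induct)
     (auto simp: derivation_zero derivation_add subring_sum[OF A])

lemma is_subring_constants: "is_subring {a \<in> A. d a = 0}"
proof (rule is_subringI)
  have "d 1 = d 1 + d 1" using derivation_mult[OF subring_one[OF A] subring_one[OF A]] by simp
  hence "d 1 = 0" by (metis add_cancel_right_right)
  thus "1 \<in> {a \<in> A. d a = 0}" using subring_one[OF A] by simp
qed (auto simp: derivation_diff derivation_mult subring_closed[OF A])

lemma coeff_map_derivation: "poly.coeff (map_poly d p) i = d (poly.coeff p i)"
  by (rule coeff_map_poly) (rule derivation_zero)

lemma map_derivation_diff: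
  "p \<in> pol A \<Longrightarrow> q \<in> pol A \<Longrightarrow> map_poly d (p - q) = map_poly d p - map_poly d q"
  by (rule poly_eqI) (simp add: coeff_map_derivation derivation_diff polD)

lemma map_derivation_mult:
  "p \<in> pol A \<Longrightarrow> q \<in> pol A \<Longrightarrow> map_poly d (p * q) = p * map_poly d q + map_poly d p * q"
  by (rule poly_eqI)
     (simp add: coeff_map_derivation coeff_mult derivation_sum derivation_mult polD
       subring_mult[OF A] sum.distrib, simp add: mult.commute)

lemma derivation_poly:
  "p \<in> pol A \<Longrightarrow> x \<in> A \<Longrightarrow> d (poly p x) = poly (map_poly d p) x + poly (pderiv p) x * d x"
proof (induction p)
  case 0
  show ?case by (simp add: derivation_zero)
next
  case (pCons a p)
  hence "a \<in> A" "p \<in> pol A" by (auto simp: pol_pCons_iff)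
  moreover from this have "map_poly d (pCons a p) = pCons (d a) (map_poly d p)"
    by (intro poly_eqI) (simp add: coeff_map_derivation coeff_pCons split: nat.splits)
  ultimately show ?case
    using pCons poly_in_subring[OF A \<open>p \<in> pol A\<close> pCons.prems(2)]
    by (simp add: derivation_add derivation_mult subring_mult[OF A] pderiv_pCons algebra_simps)
qed

text \<open>On \<open>A\<close> the extension is only a multiple of \<open>d\<close>, which avoids division by \<open>f'(x)\<close>.\<close>

lemma extend_derivation:
  assumes f: "least_vanishing A x f"
  shows "\<exists>\<delta>. derivation_on (gen (insert x A)) \<delta> \<and> (\<forall>a\<in>A. \<delta> a = poly (pderiv f) x * d a)"
proof -
  \<comment> \<open>Differentiating \<open>f(x) = 0\<close> forces the value of an extension at
    \<open>x\<close> to be the quotient of \<open>- poly (map_poly d f) x\<close> by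
    \<open>poly (pderiv f) x\<close>; \<open>D\<close> is the resulting formula for
    \<open>p(x)\<close> multiplied by that denominator.\<close>
  define D where "D = (\<lambda>p. poly (pderiv f) x * poly (map_poly d p) x - poly (map_poly d f) x * poly (pderiv p) x)"
  note P = is_subring_pol[OF A]
  from f have f': "f \<in> pol A" "f \<noteq> 0" "poly f x = 0" by (auto simp: least_vanishing_def)
  have D_diff: "D (p - q) = D p - D q" if "p \<in> pol A" "q \<in> pol A" for p q
    using that by (simp add: D_def map_derivation_diff pderiv_diff algebra_simps)
  have D_mult: "D (p * q) = poly p x * D q + poly q x * D p" if "p \<in> pol A" "q \<in> pol A" for p q
    using that by (simp add: D_def map_derivation_mult pderiv_mult algebra_simps)
  have D_f: "D f = 0" by (simp add: D_def)
  have wd: "D p = 0" if p: "p \<in> pol A" "poly p x = 0" for p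
  proof -
    from least_vanishing_divides[OF A f p] obtain k q
      where q: "q \<in> pol A" "smult (lead_coeff f ^ k) p = f * q" by blast
    have c: "[:lead_coeff f ^ k:] \<in> pol A"
      by (intro pol_const A subring_power polD f')
    have "D ([:lead_coeff f ^ k:] * p) = D (f * q)" using q by simp
    thus ?thesis using D_mult[OF c p(1)] D_mult[OF f'(1) q(1)] D_f f' p by simp
  qed
  define \<delta> where "\<delta> = (\<lambda>y. D (SOME p. p \<in> pol A \<and> poly p x = y))"
  have \<delta>: "\<delta> (poly p x) = D p" if p: "p \<in> pol A" for p
  proof -
    let ?q = "SOME q. q \<in> pol A \<and> poly q x = poly p x"
    have q: "?q \<in> pol A \<and> poly ?q x = poly p x"
      using p by (intro someI[of "\<lambda>q. q \<in> pol A \<and> poly q x = poly p x" p]) simp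
    hence "D (?q - p) = 0" using p by (intro wd subring_diff[OF P]) auto
    thus ?thesis using D_diff q p by (simp add: \<delta>_def)
  qed
  have "derivation_on (gen (insert x A)) \<delta>"
    unfolding derivation_on_def gen_insert_eq[OF A]
  proof (intro ballI, elim imageE)
    fix a b p q assume pq: "a = poly p x" "p \<in> pol A" "b = poly q x" "q \<in> pol A"
    show "\<delta> (a - b) = \<delta> a - \<delta> b \<and> \<delta> (a * b) = a * \<delta> b + b * \<delta> a"
      using pq \<delta>[OF subring_diff[OF P pq(2,4)]] \<delta>[OF subring_mult[OF P pq(2,4)]]
      by (simp add: \<delta> D_diff D_mult)
  qed
  moreover have "\<delta> a = poly (pderiv f) x * d a" if "a \<in> A" for a
    using \<delta>[OF pol_const[OF A that]] by (simp add: D_def map_poly_pCons derivation_zero pderiv_pCons)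
  ultimately show ?thesis by blast
qed

end

text \<open>The factor \<open>c\<close> is the product of the derivatives \<open>f'(x)\<close> met
  in the single steps, each nonzero because \<open>x\<close> is a simple root.\<close>

lemma extend_derivation_finite:
  fixes A :: "'a::idom set"
  assumes A: "is_subring A" and Y: "finite Y" and sep: "\<And>x. x \<in> Y \<Longrightarrow> simple_root A x"
    and d: "derivation_on A d"
  shows "\<exists>\<delta> c. c \<noteq> 0 \<and> derivation_on (gen (Y \<union> A)) \<delta> \<and> (\<forall>a\<in>A. \<delta> a = c * d a)"
  using Y sep
proof (induction Y rule: finite_induct)
  case empty
  thus ?case using d gen_subring[OF A] by (intro exI[of _ d] exI[of _ 1]) auto
next
  case (insert x Y)
  define B where "B = gen (Y \<union> A)"
  have eq: "gen (insert x Y \<union> A) = gen (insert x B)"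
    by (simp add: B_def gen_insert_gen)
  have B: "is_subring B" "A \<subseteq> B" unfolding B_def using is_subring_gen gen_superset by blast+
  from insert obtain \<delta> c where \<delta>: "c \<noteq> 0" "derivation_on B \<delta>" "\<And>a. a \<in> A \<Longrightarrow> \<delta> a = c * d a"
    unfolding B_def by blast
  have x: "simple_root B x" using insert.prems simple_root_mono B(2) by blast
  then obtain f where f: "least_vanishing B x f"
    using simple_root_algebraic least_vanishing_exists unfolding algebraic_on_def by metis
  from extend_derivation[OF B(1) \<delta>(2) f] obtain \<delta>' where
    "derivation_on (gen (insert x B)) \<delta>'" "\<And>a. a \<in> B \<Longrightarrow> \<delta>' a = poly (pderiv f) x * \<delta> a" by blast
  thus ?case unfolding eq using \<delta> B least_vanishing_simple[OF B(1) x f]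
    by (intro exI[of _ \<delta>'] exI[of _ "poly (pderiv f) x * c"]) auto
qed

text \<open>If \<open>y\<close> is not a simple root over \<open>A\<close> then \<open>g(y) \<mapsto> g'(y)\<close> is a derivation of \<open>A[y]\<close>;
  it extends to \<open>A[y, Y]\<close>, but it must vanish on \<open>A[Y]\<close>.\<close>

theorem simple_root_generated:
  fixes A :: "'a::idom set"
  assumes A: "is_subring A" and Y: "finite Y" and sep: "\<And>x. x \<in> Y \<Longrightarrow> simple_root A x"
    and pq: "p \<in> gen (Y \<union> A)" "q \<in> gen (Y \<union> A)" "q \<noteq> 0" "y * q = p"
  shows "simple_root A y"
proof (rule ccontr)
  assume no: "\<not> simple_root A y"
  note P = is_subring_pol[OF A]
  \<comment> \<open>Well defined because, by assumption, every polynomial over \<open>A\<close> that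
    vanishes at \<open>y\<close> has a derivative vanishing at \<open>y\<close>.\<close>
  define \<delta> where "\<delta> = (\<lambda>z. poly (pderiv (SOME p. p \<in> pol A \<and> poly p y = z)) y)"
  have \<delta>: "\<delta> (poly p y) = poly (pderiv p) y" if p: "p \<in> pol A" for p
  proof -
    let ?q = "SOME q. q \<in> pol A \<and> poly q y = poly p y"
    have q: "?q \<in> pol A \<and> poly ?q y = poly p y"
      using p by (intro someI[of "\<lambda>q. q \<in> pol A \<and> poly q y = poly p y" p]) simp
    hence "?q - p \<in> pol A \<and> poly (?q - p) y = 0" using p by (auto intro: subring_diff[OF P])
    hence "poly (pderiv (?q - p)) y = 0" using no by (auto simp: simple_root_def)
    thus ?thesis by (simp add: \<delta>_def pderiv_diff)
  qed
  define B where "B = gen (insert y A)"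
  have B: "is_subring B" "A \<subseteq> B" "y \<in> B" unfolding B_def using is_subring_gen gen_superset by blast+
  have der: "derivation_on B \<delta>"
    unfolding derivation_on_def B_def gen_insert_eq[OF A]
  proof (intro ballI, elim imageE)
    fix a b p q assume pq: "a = poly p y" "p \<in> pol A" "b = poly q y" "q \<in> pol A"
    show "\<delta> (a - b) = \<delta> a - \<delta> b \<and> \<delta> (a * b) = a * \<delta> b + b * \<delta> a"
      using pq \<delta>[OF subring_diff[OF P pq(2,4)]] \<delta>[OF subring_mult[OF P pq(2,4)]]
      by (simp add: \<delta> pderiv_diff pderiv_mult)
  qed
  have \<delta>A: "\<delta> a = 0" if "a \<in> A" for a using \<delta>[OF pol_const[OF A that]] by (simp add: pderiv_pCons)
  have \<delta>y: "\<delta> y = 1"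
    using \<delta>[OF pol_pCons[OF pol_const[OF A subring_one[OF A]] subring_zero[OF A]]]
    by (simp add: pderiv_pCons)
  have "simple_root B x" if "x \<in> Y" for x using sep[OF that] simple_root_mono B by blast
  from extend_derivation_finite[OF B(1) Y this der] obtain d c where
    d: "c \<noteq> 0" "derivation_on (gen (Y \<union> B)) d" "\<And>a. a \<in> B \<Longrightarrow> d a = c * \<delta> a" by blast
  define E where "E = gen (Y \<union> B)"
  have E: "is_subring E" "B \<subseteq> E" "Y \<subseteq> E" unfolding E_def using is_subring_gen gen_superset by blast+
  have dE: "derivation_on E d" using d(2) by (simp add: E_def)
  \<comment> \<open>A derivation that vanishes on \<open>A\<close> vanishes on \<open>Y\<close> too:
    applied to a simple relation \<open>g(x) = 0\<close> it gives
    \<open>poly (pderiv g) x * d x = 0\<close>.\<close>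
  have "Y \<union> A \<subseteq> {a \<in> E. d a = 0}"
  proof
    fix x assume x: "x \<in> Y \<union> A"
    have dA: "d a = 0" if "a \<in> A" for a using that \<delta>A d(3)[of a] B by auto
    show "x \<in> {a \<in> E. d a = 0}"
    proof (cases "x \<in> A")
      case True
      thus ?thesis using dA B E by auto
    next
      case False
      with x have x: "x \<in> Y" by blast
      then obtain g where g: "g \<in> pol A" "poly g x = 0" "poly (pderiv g) x \<noteq> 0"
        using sep by (auto simp: simple_root_def)
      have "map_poly d g = 0"
        by (rule poly_eqI) (simp add: coeff_map_derivation[OF E(1) dE] dA polD[OF g(1)])
      moreover have "g \<in> pol E" using g(1) pol_mono[of A E] B E by blast
      ultimately have "poly (pderiv g) x * d x = 0"
        using derivation_poly[OF E(1) dE, of g x] x E g derivation_zero[OF E(1) dE] by auto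
      thus ?thesis using g x E by auto
    qed
  qed
  hence "gen (Y \<union> A) \<subseteq> {a \<in> E. d a = 0}"
    by (rule gen_least[OF is_subring_constants[OF E(1) dE]])
  hence pq': "p \<in> E" "q \<in> E" "d p = 0" "d q = 0" using pq by auto
  \<comment> \<open>With \<open>p\<close> and \<open>q\<close> constant for \<open>d\<close>, the
    relation \<open>y * q = p\<close> yields \<open>q * d y = 0\<close>, although
    \<open>d y = c\<close> is nonzero.\<close>
  have "d p = y * d q + q * d y"
    using pq(4) derivation_mult[OF E(1) dE, of y q] B E pq' by auto
  hence "q * c = 0" using pq' d(3)[OF B(3)] \<delta>y by simp
  thus False using pq d by simp
qed

section \<open>Subfields and separable elements\<close>

lemma algebraic_on_least_vanishing: "algebraic_on A x \<Longrightarrow> \<exists>f. least_vanishing A x f"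
  using least_vanishing_exists unfolding algebraic_on_def by blast

definition is_subfield :: "'a::field set \<Rightarrow> bool" where
  "is_subfield K \<longleftrightarrow> is_subring K \<and> (\<forall>a\<in>K. inverse a \<in> K)"

lemma subfield_is_subring: "is_subfield K \<Longrightarrow> is_subring K"
  and subfield_inverse: "is_subfield K \<Longrightarrow> a \<in> K \<Longrightarrow> inverse a \<in> K"
  by (auto simp: is_subfield_def)

lemma subfield_divide: "is_subfield K \<Longrightarrow> a \<in> K \<Longrightarrow> b \<in> K \<Longrightarrow> a / b \<in> K"
  by (simp add: divide_inverse subfield_inverse subfield_is_subring subring_mult)

lemma ring_of_type_algebra_simps [simp]:
  "carrier ring_of_type_algebra = UNIV" "monoid.mult ring_of_type_algebra = (*)"
  "one ring_of_type_algebra = 1" "ring.zero ring_of_type_algebra = 0" "add ring_of_type_algebra = (+)"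
  by (auto simp: ring_of_type_algebra_def fun_eq_iff)

lemma a_inv_type_algebra: "a_inv ring_of_type_algebra (x :: 'a::field) = - x"
proof -
  interpret field "ring_of_type_algebra :: 'a ring" by (rule field_from_type_algebra)
  show ?thesis using minus_equality[of "- x" x] by simp
qed

lemma m_inv_type_algebra:
  assumes "x \<noteq> 0"
  shows "m_inv ring_of_type_algebra (x :: 'a::field) = inverse x"
proof -
  interpret field "ring_of_type_algebra :: 'a ring" by (rule field_from_type_algebra)
  show ?thesis using assms comm_inv_char[of x "inverse x"] by simp
qed

lemma subfield_type_algebra:
  "subfield K (ring_of_type_algebra :: 'a::field ring) \<longleftrightarrow> is_subfield K"
proof
  interpret field "ring_of_type_algebra :: 'a ring" by (rule field_from_type_algebra)
  assume K: "subfield K (ring_of_type_algebra :: 'a ring)"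
  note E = subringE[OF subfieldE(1)[OF K]]
  have um: "- a \<in> K" if "a \<in> K" for a using E(5)[OF that] by (simp add: a_inv_type_algebra)
  have "is_subring K"
  proof (rule is_subringI)
    show "1 \<in> K" using E(3) by simp
    show "a - b \<in> K" if "a \<in> K" "b \<in> K" for a b using E(7)[OF that(1) um[OF that(2)]] by simp
    show "a * b \<in> K" if "a \<in> K" "b \<in> K" for a b using E(6)[OF that] by simp
  qed
  moreover have "inverse a \<in> K" if "a \<in> K" for a
  proof (cases "a = 0")
    case False
    thus ?thesis using subfield_m_inv(1)[OF K, of a] that by (simp add: m_inv_type_algebra)
  qed (use that in auto)
  ultimately show "is_subfield K" by (auto simp: is_subfield_def)
next
  interpret field "ring_of_type_algebra :: 'a ring" by (rule field_from_type_algebra)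
  assume K: "is_subfield K"
  note R = subfield_is_subring[OF K]
  show "subfield K (ring_of_type_algebra :: 'a ring)"
  proof (rule subfieldI')
    show "subring K (ring_of_type_algebra :: 'a ring)"
      by (rule subringI) (auto simp: a_inv_type_algebra intro: subring_closed[OF R])
    show "m_inv ring_of_type_algebra k \<in> K" if "k \<in> K - {ring.zero ring_of_type_algebra}" for k :: 'a
      using that subfield_inverse[OF K] by (auto simp: m_inv_type_algebra)
  qed
qed

lemma is_subfield_adjoin: "is_subfield (adjoin F S)"
proof -
  interpret field "ring_of_type_algebra :: 'a ring" by (rule field_from_type_algebra)
  show ?thesis unfolding adjoin_def subfield_type_algebra[symmetric]
    by (rule generate_field_is_subfield) simp
qed

lemma adjoin_base: "F \<subseteq> adjoin F S"
  and adjoin_generators: "S \<subseteq> adjoin F S"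
  by (auto simp: adjoin_def intro: generate_field.incl)

lemma adjoin_least:
  assumes "is_subfield K" "F \<subseteq> K" "S \<subseteq> K"
  shows "adjoin F S \<subseteq> K"
proof -
  interpret field "ring_of_type_algebra :: 'a ring" by (rule field_from_type_algebra)
  show ?thesis unfolding adjoin_def
    using assms by (intro generate_field_min_subfield1) (auto simp: subfield_type_algebra)
qed

lemma adjoin_mono: "F \<subseteq> F' \<Longrightarrow> S \<subseteq> S' \<Longrightarrow> adjoin F S \<subseteq> adjoin F' S'"
  by (rule adjoin_least[OF is_subfield_adjoin]) (use adjoin_base[of F' S'] adjoin_generators[of S' F'] in auto)

lemma gen_subset_adjoin: "gen (F \<union> S) \<subseteq> adjoin F S"
  by (rule gen_least[OF subfield_is_subring[OF is_subfield_adjoin]]) (use adjoin_base adjoin_generators in blast)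

lemma adjoin_fraction:
  assumes "y \<in> adjoin F S"
  shows "\<exists>p\<in>gen (F \<union> S). \<exists>q\<in>gen (F \<union> S). q \<noteq> 0 \<and> y = p / q"
proof -
  note G = is_subring_gen[of "F \<union> S"]
  let ?Q = "{p / q | p q. p \<in> gen (F \<union> S) \<and> q \<in> gen (F \<union> S) \<and> q \<noteq> 0}"
  have sub: "gen (F \<union> S) \<subseteq> ?Q"
    using subring_one[OF G] by (metis (mono_tags, lifting) CollectI div_by_1 one_neq_zero subsetI)
  have "is_subring ?Q"
  proof (rule is_subringI)
    show "1 \<in> ?Q" using sub subring_one[OF G] by blast
  next
    fix a b assume "a \<in> ?Q" "b \<in> ?Q"
    then obtain p q p' q' where *: "a = p / q" "b = p' / q'" "q \<noteq> 0" "q' \<noteq> 0"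
      "p \<in> gen (F \<union> S)" "q \<in> gen (F \<union> S)" "p' \<in> gen (F \<union> S)" "q' \<in> gen (F \<union> S)" by blast
    have "a - b = (p * q' - p' * q) / (q * q')" "a * b = (p * p') / (q * q')"
      using * by (auto simp: field_simps)
    moreover have "p * q' - p' * q \<in> gen (F \<union> S)" "q * q' \<in> gen (F \<union> S)" "p * p' \<in> gen (F \<union> S)"
      using * by (auto intro!: subring_closed[OF G])
    moreover have "q * q' \<noteq> 0" using * by simp
    ultimately show "a - b \<in> ?Q" "a * b \<in> ?Q" by blast+
  qed
  moreover have "inverse a \<in> ?Q" if "a \<in> ?Q" for a
  proof -
    from that obtain p q where *: "a = p / q" "q \<noteq> 0" "p \<in> gen (F \<union> S)" "q \<in> gen (F \<union> S)" by blast
    show ?thesis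
    proof (cases "p = 0")
      case True
      thus ?thesis using * sub subring_zero[OF G] by force
    next
      case False
      thus ?thesis using * by (intro CollectI exI[of _ q] exI[of _ p]) auto
    qed
  qed
  ultimately have "is_subfield ?Q" by (auto simp: is_subfield_def)
  hence "adjoin F S \<subseteq> ?Q"
    by (rule adjoin_least) (use sub gen_superset[of "F \<union> S"] in blast)+
  thus ?thesis using assms by blast
qed

text \<open>By Bezout a nonzero \<open>a = p(z)\<close> divides a nonzero constant of
  \<open>F\<close> in \<open>F[z]\<close>, and that constant is invertible in
  \<open>F\<close>.\<close>

lemma is_subfield_simple_extension:
  assumes F: "is_subfield F" and z: "algebraic_on F z"
  shows "is_subfield (gen (insert z F))"
  unfolding is_subfield_def
proof (intro conjI ballI)
  show "is_subring (gen (insert z F))" by (rule is_subring_gen)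
  note R = subfield_is_subring[OF F]
  fix a assume a: "a \<in> gen (insert z F)"
  show "inverse a \<in> gen (insert z F)"
  proof (cases "a = 0")
    case False
    obtain p where p: "p \<in> pol F" "a = poly p z" using a gen_insert_eq[OF R] by blast
    obtain f where f: "least_vanishing F z f"
      using algebraic_on_least_vanishing[OF z] ..
    from least_vanishing_bezout[OF R f p(1)] False p obtain e b c where
      e: "e \<in> pol F" "b \<in> pol F" "c \<in> F" "c \<noteq> 0" "e * p + b * f = [:c:]" by blast
    have "poly e z * a = c"
      using arg_cong[OF e(5), of "\<lambda>p. poly p z"] f p by (simp add: least_vanishing_def)
    hence "inverse a = poly e z * inverse c" using False e(4) by (auto simp: field_simps)
    moreover have "poly e z \<in> gen (insert z F)" using e gen_insert_eq[OF R] by blast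
    moreover have "inverse c \<in> gen (insert z F)"
      using e gen_superset[of "insert z F"] subfield_inverse[OF F] by blast
    ultimately show ?thesis by (simp add: subring_mult[OF is_subring_gen])
  qed (use a in auto)
qed

lemma polys_over_eq_pol: "polys_over F = pol F"
  by (simp add: polys_over_def pol_def)

lemma separable_over_imp_simple_root:
  assumes "separable_over F a"
  shows "simple_root F a"
proof -
  obtain p where p: "p \<in> pol F" "poly p a = 0" "coprime p (pderiv p)"
    using assms by (auto simp: separable_over_def is_minimal_poly_def polys_over_eq_pol)
  have "poly (pderiv p) a \<noteq> 0"
  proof
    assume "poly (pderiv p) a = 0"
    hence "[:- a, 1:] dvd p" "[:- a, 1:] dvd pderiv p" using p by (auto simp: dvd_iff_poly_eq_0)
    hence "[:- a, 1:] dvd 1" using p(3) by (rule coprime_common_divisor[rotated])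
    thus False by (simp add: is_unit_pCons_iff)
  qed
  thus ?thesis using p by (auto simp: simple_root_def)
qed

text \<open>The least relation, made monic, is the minimal polynomial. Its derivative does not
  vanish at \<open>a\<close>, so Bezout writes a nonzero constant as a combination of the two, and
  they are coprime.\<close>

lemma simple_root_imp_separable_over:
  assumes F: "is_subfield F" and a: "simple_root F a"
  shows "separable_over F a"
proof -
  note R = subfield_is_subring[OF F]
  from a obtain f where f: "least_vanishing F a f"
    using simple_root_algebraic algebraic_on_least_vanishing by blast
  hence f': "f \<in> pol F" "f \<noteq> 0" "poly f a = 0" by (auto simp: least_vanishing_def)
  define p where "p = smult (inverse (lead_coeff f)) f"
  have p: "p \<in> pol F" "lead_coeff p = 1" "poly p a = 0" "Polynomial.degree p = Polynomial.degree f"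
    "p \<noteq> 0"
    unfolding p_def using f' by (auto intro!: pol_smult[OF R] subfield_inverse[OF F] polD)
  have lv: "least_vanishing F a p" using f p by (auto simp: least_vanishing_def)
  from least_vanishing_bezout[OF R lv pol_pderiv[OF R p(1)] least_vanishing_simple[OF R a lv]]
  obtain e b c where e: "c \<noteq> 0" "e * pderiv p + b * p = [:c:]" by blast
  have "coprime p (pderiv p)"
  proof (rule coprimeI)
    fix d assume "d dvd p" "d dvd pderiv p"
    hence "d dvd e * pderiv p + b * p" by simp
    also have "\<dots> = [:c:]" by (fact e)
    also have "[:c:] dvd 1" using e by (simp add: is_unit_pCons_iff)
    finally show "d dvd 1" .
  qed
  moreover have "is_minimal_poly F a p"
    using lv p by (auto simp: is_minimal_poly_def least_vanishing_def polys_over_eq_pol)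
  ultimately show ?thesis by (auto simp: separable_over_def)
qed

lemma algebraic_over_iff: "algebraic_over F a \<longleftrightarrow> algebraic_on F a"
  by (auto simp: algebraic_over_def algebraic_on_def polys_over_eq_pol)

section \<open>The primitive element theorem\<close>

lemma pol_pcompose:
  assumes R: "is_subring R" and "f \<in> pol R" "q \<in> pol R"
  shows "pcompose f q \<in> pol R"
  using assms(2)
proof (induction f)
  case 0
  show ?case by (simp add: subring_zero[OF is_subring_pol[OF R]])
next
  case (pCons a p)
  thus ?case unfolding pcompose_pCons pol_pCons_iff
    by (intro subring_add[OF is_subring_pol[OF R]] subring_mult[OF is_subring_pol[OF R]]
        pol_const[OF R] assms) auto
qed

text \<open>The classical choice \<open>y + c * z\<close>: for \<open>c\<close> outside a finite
  set, \<open>z\<close> is the only common root of \<open>g\<close> and of the polynomial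
  \<open>f(\<theta> - c X)\<close>. The least relation \<open>m\<close> of \<open>z\<close> over
  \<open>F(\<theta>)\<close> divides both up to a constant, so \<open>z\<close> is its only root,
  and simplicity of that root makes \<open>m\<close> linear.\<close>

lemma primitive_element_two:
  fixes F :: "'a::alg_closed_field set"
  assumes F: "is_subfield F" "infinite F" and y: "simple_root F y" and z: "simple_root F z"
  shows "\<exists>\<theta>\<in>gen ({y, z} \<union> F). {y, z} \<subseteq> gen (insert \<theta> F)"
proof -
  note R = subfield_is_subring[OF F(1)]
  obtain f g where f: "f \<in> pol F" "poly f y = 0" "f \<noteq> 0" and g: "g \<in> pol F" "poly g z = 0" "g \<noteq> 0"
    using simple_root_algebraic[OF y] simple_root_algebraic[OF z] unfolding algebraic_on_def by blast
  \<comment> \<open>Pairs with \<open>z' = z\<close> contribute only the quotient 0, by the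
    convention for division by zero; excluding \<open>c = 0\<close> as well is harmless.\<close>
  define bad where "bad = (\<lambda>(y', z'). (y' - y) / (z - z')) ` ({x. poly f x = 0} \<times> {x. poly g x = 0})"
  have "finite bad" unfolding bad_def
    using poly_roots_finite[OF f(3)] poly_roots_finite[OF g(3)] by simp
  hence "\<not> F \<subseteq> bad" using F(2) finite_subset by blast
  then obtain c where c: "c \<in> F" "c \<notin> bad" by blast
  define \<theta> where "\<theta> = y + c * z"
  have FG: "F \<subseteq> gen ({y, z} \<union> F)" "y \<in> gen ({y, z} \<union> F)" "z \<in> gen ({y, z} \<union> F)"
    using gen_superset[of "{y, z} \<union> F"] by auto
  have \<theta>G: "\<theta> \<in> gen ({y, z} \<union> F)" unfolding \<theta>_def
    by (rule subring_add[OF is_subring_gen] subring_mult[OF is_subring_gen] FG subsetD[OF FG(1) c(1)])+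
  have \<theta>: "simple_root F \<theta>"
    by (rule simple_root_generated[OF R _ _ \<theta>G subring_one[OF is_subring_gen]]) (use y z in auto)
  define E where "E = gen (insert \<theta> F)"
  have E: "is_subfield E" "F \<subseteq> E" "\<theta> \<in> E" unfolding E_def
    using is_subfield_simple_extension[OF F(1) simple_root_algebraic[OF \<theta>]] gen_superset by blast+
  note ER = subfield_is_subring[OF E(1)]
  have zE: "simple_root E z" by (rule simple_root_mono[OF z E(2)])
  then obtain m where m: "least_vanishing E z m"
    using simple_root_algebraic algebraic_on_least_vanishing by blast
  hence m': "m \<in> pol E" "m \<noteq> 0" "poly m z = 0" by (auto simp: least_vanishing_def)
  define h where "h = pcompose f [:\<theta>, - c:]"
  have hE: "h \<in> pol E" unfolding h_def using f c E
    by (intro pol_pcompose[OF ER] subsetD[OF pol_mono[OF E(2)]] pol_pCons pol_const[OF ER]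
        subring_uminus[OF ER]) auto
  have hz: "poly h z = 0" using f by (simp add: h_def poly_pcompose \<theta>_def)
  have only: "z' = z" if z': "poly m z' = 0" for z'
  proof (rule ccontr)
    assume ne: "z' \<noteq> z"
    from least_vanishing_divides[OF ER m hE hz] obtain k q where
      "smult (lead_coeff m ^ k) h = m * q" by blast
    from arg_cong[OF this, of "\<lambda>p. poly p z'"] z' m' have "poly h z' = 0" by simp
    hence 1: "poly f (\<theta> - c * z') = 0" by (simp add: h_def poly_pcompose mult.commute)
    from least_vanishing_divides[OF ER m _ g(2)] g(1) pol_mono[OF E(2)] obtain k q where
      "smult (lead_coeff m ^ k) g = m * q" by blast
    from arg_cong[OF this, of "\<lambda>p. poly p z'"] z' m' have 2: "poly g z' = 0" by simp
    have "c = ((\<theta> - c * z') - y) / (z - z')" using ne by (simp add: \<theta>_def field_simps)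
    hence "c \<in> bad" unfolding bad_def using 1 2
      by (intro image_eqI[of _ _ "(\<theta> - c * z', z')"]) auto
    thus False using c by blast
  qed
  have "z \<in> E"
  proof -
    from m'(3) obtain q where q: "m = [:- z, 1:] * q" by (meson dvdE poly_eq_0_iff_dvd)
    have "Polynomial.degree q = 0"
    proof (rule ccontr)
      assume "Polynomial.degree q \<noteq> 0"
      then obtain z' where z': "poly q z' = 0" using alg_closed_imp_poly_has_root by blast
      hence "poly m z' = 0" by (simp add: q)
      hence "z' = z" by (rule only)
      hence "poly (pderiv m) z = 0" using z' by (simp add: q pderiv_diff pderiv_smult pderiv_pCons)
      thus False using least_vanishing_simple[OF ER zE m] by blast
    qed
    then obtain e where e: "q = [:e:]" by (rule degree_eq_zeroE)
    hence "m = [:- (z * e), e:]" by (simp add: q)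
    hence "z * e \<in> E" "e \<in> E" "e \<noteq> 0"
      using polD[OF m'(1), of 0] polD[OF m'(1), of 1] m'(2) subring_uminus[OF ER, of "- (z * e)"] by auto
    thus ?thesis using subfield_divide[OF E(1), of "z * e" e] by simp
  qed
  moreover have "y \<in> E"
  proof -
    have "y = \<theta> - c * z" by (simp add: \<theta>_def)
    thus ?thesis using E c \<open>z \<in> E\<close> by (auto intro!: subring_closed[OF ER])
  qed
  ultimately show ?thesis using \<theta>G by (auto simp: E_def)
qed

text \<open>The generator \<open>z\<close> found for the smaller set lies in the ring generated by
  separable elements, so it is separable by \<open>simple_root_generated\<close> and the two-element
  case applies to \<open>y\<close> and \<open>z\<close>.\<close>

theorem primitive_element:
  fixes F :: "'a::alg_closed_field set"
  assumes F: "is_subfield F" "infinite F" and Y: "finite Y" "\<And>y. y \<in> Y \<Longrightarrow> simple_root F y"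
  shows "\<exists>\<theta>\<in>gen (Y \<union> F). Y \<subseteq> gen (insert \<theta> F)"
  using Y
proof (induction Y rule: finite_induct)
  case empty
  show ?case by (intro bexI[of _ 1] subring_one[OF is_subring_gen]) simp
next
  case (insert y Y)
  from insert.IH insert.prems obtain z where z: "z \<in> gen (Y \<union> F)" "Y \<subseteq> gen (insert z F)" by auto
  have "simple_root F z"
    by (rule simple_root_generated[OF subfield_is_subring[OF F(1)] insert.hyps(1) _ z(1) subring_one[OF is_subring_gen]])
       (use insert.prems in auto)
  from primitive_element_two[OF F insert.prems[of y] this] obtain \<theta> where
    \<theta>: "\<theta> \<in> gen ({y, z} \<union> F)" "{y, z} \<subseteq> gen (insert \<theta> F)" by auto
  have Fs: "F \<subseteq> gen (insert \<theta> F)" "F \<subseteq> gen (insert y Y \<union> F)"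
    using gen_superset[of "insert \<theta> F"] gen_superset[of "insert y Y \<union> F"] by auto
  have "gen (insert z F) \<subseteq> gen (insert \<theta> F)"
    by (rule gen_least[OF is_subring_gen]) (use \<theta> Fs in auto)
  hence "insert y Y \<subseteq> gen (insert \<theta> F)" using z \<theta> by auto
  moreover have "gen ({y, z} \<union> F) \<subseteq> gen (insert y Y \<union> F)"
    by (rule gen_least[OF is_subring_gen])
       (use z Fs gen_superset[of "insert y Y \<union> F"] gen_mono[of "Y \<union> F" "insert y Y \<union> F"] in auto)
  ultimately show ?case using \<theta> by blast
qed

section \<open>Evaluation of polynomials\<close>

abbreviation coef :: "'a::zero mpoly \<Rightarrow> (nat \<Rightarrow>\<^sub>0 nat) \<Rightarrow> 'a" where
  "coef \<equiv> Poly_Mapping.lookup"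

definition monom_eval :: "(nat \<Rightarrow>\<^sub>0 nat) \<Rightarrow> (nat \<Rightarrow> 'r::comm_ring_1) \<Rightarrow> 'r" where
  "monom_eval m x = (\<Prod>i\<in>Poly_Mapping.keys m. x i ^ Poly_Mapping.lookup m i)"

text \<open>Evaluation with the coefficients transported along \<open>h\<close>. The choices
  \<open>h = id\<close>, \<open>mconst\<close> and \<open>kap\<close> give evaluation at points,
  substitution of polynomials, and substitution of power series.\<close>

definition ev :: "('c::zero \<Rightarrow> 'r::comm_ring_1) \<Rightarrow> 'c mpoly \<Rightarrow> (nat \<Rightarrow> 'r) \<Rightarrow> 'r" where
  "ev h p x = (\<Sum>m\<in>Poly_Mapping.keys p. h (coef p m) * monom_eval m x)"

abbreviation mconst :: "'a::zero \<Rightarrow> 'a mpoly" where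
  "mconst c \<equiv> Poly_Mapping.single 0 c"

definition mvar :: "nat \<Rightarrow> 'a::comm_ring_1 mpoly" where
  "mvar i = Poly_Mapping.single (Poly_Mapping.single i 1) 1"

lemma meval_eq_ev: "meval p x = ev (\<lambda>c. c) p x"
  by (simp add: meval_def ev_def monom_eval_def)

lemma monom_eval_superset:
  assumes "finite I" "Poly_Mapping.keys m \<subseteq> I"
  shows "monom_eval m x = (\<Prod>i\<in>I. x i ^ Poly_Mapping.lookup m i)"
  unfolding monom_eval_def using assms
  by (intro prod.mono_neutral_left) (auto simp: in_keys_iff)

lemma monom_eval_add: "monom_eval (m + m') x = monom_eval m x * monom_eval m' x"
proof -
  let ?I = "Poly_Mapping.keys m \<union> Poly_Mapping.keys m'"
  have "Poly_Mapping.keys (m + m') \<subseteq> ?I" by (rule keys_add)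
  hence "monom_eval (m + m') x = (\<Prod>i\<in>?I. x i ^ Poly_Mapping.lookup (m + m') i)"
    by (intro monom_eval_superset) auto
  also have "\<dots> = (\<Prod>i\<in>?I. x i ^ Poly_Mapping.lookup m i) * (\<Prod>i\<in>?I. x i ^ Poly_Mapping.lookup m' i)"
    by (simp add: lookup_add power_add prod.distrib)
  also have "(\<Prod>i\<in>?I. x i ^ Poly_Mapping.lookup m i) = monom_eval m x"
    by (rule monom_eval_superset[symmetric]) auto
  also have "(\<Prod>i\<in>?I. x i ^ Poly_Mapping.lookup m' i) = monom_eval m' x"
    by (rule monom_eval_superset[symmetric]) auto
  finally show ?thesis .
qed

lemma monom_eval_zero [simp]: "monom_eval 0 x = 1"
  by (simp add: monom_eval_def)

lemma monom_eval_single [simp]: "monom_eval (Poly_Mapping.single i k) x = x i ^ k"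
  by (simp add: monom_eval_def)

lemma monom_expansion: "(p :: 'c::comm_ring_1 mpoly) = (\<Sum>m\<in>Poly_Mapping.keys p. Poly_Mapping.single m (coef p m))"
proof (rule poly_mapping_eqI)
  fix k
  have "coef (\<Sum>m\<in>Poly_Mapping.keys p. Poly_Mapping.single m (coef p m)) k =
    (\<Sum>m\<in>Poly_Mapping.keys p. if m = k then coef p m else 0)"
    by (simp add: lookup_sum lookup_single when_def)
  also have "\<dots> = coef p k" by (auto simp: in_keys_iff)
  finally show "coef p k = coef (\<Sum>m\<in>Poly_Mapping.keys p. Poly_Mapping.single m (coef p m)) k" by simp
qed

context
  fixes h :: "'c::comm_ring_1 \<Rightarrow> 'r::comm_ring_1"
  assumes h: "hom_on UNIV h"
begin

lemma hom_UNIV_simps: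
  "h 1 = 1" "h 0 = 0" "h (a - b) = h a - h b" "h (a + b) = h a + h b" "h (a * b) = h a * h b"
  "h (- a) = - h a" "h (a ^ n) = h a ^ n"
  using h hom_on_simps[of UNIV h] by (auto simp: is_subring_def)

lemma ev_superset:
  assumes "finite S" "Poly_Mapping.keys p \<subseteq> S"
  shows "ev h p x = (\<Sum>m\<in>S. h (coef p m) * monom_eval m x)"
  unfolding ev_def using assms
  by (intro sum.mono_neutral_left) (auto simp: in_keys_iff hom_UNIV_simps)

lemma ev_single [simp]: "ev h (Poly_Mapping.single m c) x = h c * monom_eval m x"
  by (subst ev_superset[of "{m}"]) (auto split: if_splits)

lemma ev_diff: "ev h (p - q) x = ev h p x - ev h q x"
proof -
  let ?S = "Poly_Mapping.keys p \<union> Poly_Mapping.keys q"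
  have "Poly_Mapping.keys (p - q) \<subseteq> ?S" by (auto simp: in_keys_iff lookup_minus)
  thus ?thesis
    by (subst (1 2 3) ev_superset[of ?S])
       (auto simp: lookup_minus hom_UNIV_simps sum_subtractf left_diff_distrib)
qed

lemma ev_zero [simp]: "ev h 0 x = 0"
  by (simp add: ev_def)

lemma ev_uminus: "ev h (- p) x = - ev h p x"
  using ev_diff[of 0 p] by simp

lemma ev_add: "ev h (p + q) x = ev h p x + ev h q x"
  using ev_diff[of p "- q"] by (simp add: ev_uminus)

lemma ev_sum: "ev h (sum f I) x = (\<Sum>i\<in>I. ev h (f i) x)"
  by (induction I rule: infinite_finite_induct) (auto simp: ev_add)

lemma ev_mult: "ev h (p * q) x = ev h p x * ev h q x"
proof -
  have "p * q = (\<Sum>m\<in>Poly_Mapping.keys p. \<Sum>m'\<in>Poly_Mapping.keys q.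
      Poly_Mapping.single (m + m') (coef p m * coef q m'))"
    by (subst monom_expansion[of p], subst monom_expansion[of q])
       (simp add: sum_product mult_single)
  hence "ev h (p * q) x = (\<Sum>m\<in>Poly_Mapping.keys p. \<Sum>m'\<in>Poly_Mapping.keys q.
      (h (coef p m) * monom_eval m x) * (h (coef q m') * monom_eval m' x))"
    by (simp add: ev_sum hom_UNIV_simps monom_eval_add mult_ac)
  also have "\<dots> = ev h p x * ev h q x"
    by (simp add: ev_def sum_product)
  finally show ?thesis .
qed

lemma ev_one [simp]: "ev h 1 x = 1"
  using ev_single[of 0 1 x] by (simp add: hom_UNIV_simps)

lemma ev_mvar [simp]: "ev h (mvar i) x = x i"
  by (simp add: mvar_def hom_UNIV_simps)

lemma ev_power: "ev h (p ^ n) x = ev h p x ^ n"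
  by (induction n) (auto simp: ev_mult)

lemma ev_prod: "ev h (prod f I) x = (\<Prod>i\<in>I. ev h (f i) x)"
  by (induction I rule: infinite_finite_induct) (auto simp: ev_mult)

lemma ev_hom_on: "hom_on S (\<lambda>p. ev h p x)"
  by (rule hom_onI) (auto simp: ev_diff ev_mult)

end

lemma id_hom: "hom_on S (\<lambda>c. c)"
  by (simp add: hom_on_def)

lemma mconst_hom: "hom_on S (mconst :: 'a::comm_ring_1 \<Rightarrow> 'a mpoly)"
  by (simp add: hom_on_def single_diff mult_single)

lemmas meval_simps = meval_eq_ev ev_single[OF id_hom] ev_diff[OF id_hom] ev_zero[OF id_hom]
  ev_uminus[OF id_hom] ev_add[OF id_hom] ev_sum[OF id_hom] ev_mult[OF id_hom] ev_one[OF id_hom]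
  ev_mvar[OF id_hom] ev_power[OF id_hom] ev_prod[OF id_hom]

lemma ev_cong:
  assumes "p \<in> mpolys K n" "\<And>i. i < n \<Longrightarrow> x i = y i" "\<And>c. c \<in> K \<Longrightarrow> h c = h' c"
  shows "ev h p x = ev h' p y"
  unfolding ev_def monom_eval_def using assms
  by (intro sum.cong prod.cong refl arg_cong2[where f = "(*)"] arg_cong2[where f = "(^)"])
     (auto simp: mpolys_def)

lemma meval_cong:
  "(p :: 'a::comm_ring_1 mpoly) \<in> mpolys K n \<Longrightarrow> (\<And>i. i < n \<Longrightarrow> x i = y i) \<Longrightarrow> meval p x = meval p y"
  unfolding meval_eq_ev by (rule ev_cong) auto

lemma ev_in_subring:
  assumes B: "is_subring B" and p: "p \<in> mpolys K n"
    and "\<And>c. c \<in> K \<Longrightarrow> h c \<in> B" "\<And>i. i < n \<Longrightarrow> x i \<in> B"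
  shows "ev h p x \<in> B"
  unfolding ev_def monom_eval_def using assms
  by (intro subring_sum[OF B] subring_mult[OF B] subring_prod[OF B] subring_power[OF B])
     (auto simp: mpolys_def)

lemma hom_on_ev:
  assumes B: "is_subring B" and g: "hom_on B g" and p: "p \<in> mpolys K n"
    and h: "\<And>c. c \<in> K \<Longrightarrow> h c \<in> B" and x: "\<And>i. i < n \<Longrightarrow> x i \<in> B"
  shows "g (ev h p x) = ev (\<lambda>c. g (h c)) p (\<lambda>i. g (x i))"
proof -
  have hp: "h (coef p m) \<in> B" if "m \<in> Poly_Mapping.keys p" for m
    using that p h by (auto simp: mpolys_def)
  have xp: "x i \<in> B" if "m \<in> Poly_Mapping.keys p" "i \<in> Poly_Mapping.keys m" for m i
    using that p x by (auto simp: mpolys_def)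
  have mB: "monom_eval m x \<in> B" "g (monom_eval m x) = monom_eval m (\<lambda>i. g (x i))"
    if "m \<in> Poly_Mapping.keys p" for m
    using xp[OF that] unfolding monom_eval_def
    by (auto simp: hom_on_prod[OF B g] hom_on_power[OF B g] subring_power[OF B] intro!: subring_prod[OF B])
  show ?thesis unfolding ev_def
    using hp mB by (simp add: hom_on_sum[OF B g] hom_on_mult[OF B g] subring_mult[OF B])
qed

lemma mpolys_mono: "K \<subseteq> K' \<Longrightarrow> n \<le> n' \<Longrightarrow> mpolys K n \<subseteq> mpolys K' n'"
  by (fastforce simp: mpolys_def)

lemma mpolys_single:
  "c \<in> K \<Longrightarrow> Poly_Mapping.keys m \<subseteq> {..<n} \<Longrightarrow> Poly_Mapping.single m c \<in> mpolys K n"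
  by (auto simp: mpolys_def)

lemma mpolys_coef: "0 \<in> K \<Longrightarrow> p \<in> mpolys K n \<Longrightarrow> coef p m \<in> K"
  by (cases "m \<in> Poly_Mapping.keys p") (auto simp: mpolys_def in_keys_iff)

lemma mpolys_keys: "p \<in> mpolys K n \<Longrightarrow> m \<in> Poly_Mapping.keys p \<Longrightarrow> Poly_Mapping.keys m \<subseteq> {..<n}"
  by (auto simp: mpolys_def)

lemma is_subring_mpolys:
  assumes K: "is_subring (K :: 'c::comm_ring_1 set)"
  shows "is_subring (mpolys K n)"
proof (rule is_subringI)
  have diff: "p - q \<in> mpolys K n" if pq: "p \<in> mpolys K n" "q \<in> mpolys K n" for p q
    unfolding mpolys_def
  proof (intro CollectI ballI conjI)
    fix m assume "m \<in> Poly_Mapping.keys (p - q)"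
    hence "m \<in> Poly_Mapping.keys p \<or> m \<in> Poly_Mapping.keys q" by (auto simp: in_keys_iff lookup_minus)
    thus "Poly_Mapping.keys m \<subseteq> {..<n}" using mpolys_keys pq by blast
    show "coef (p - q) m \<in> K"
      using pq mpolys_coef[OF subring_zero[OF K]] by (auto simp: lookup_minus intro: subring_diff[OF K])
  qed
  show "1 \<in> mpolys K n"
    using mpolys_single[of 1 K 0 n] subring_one[OF K] by simp
  show "p - q \<in> mpolys K n" if "p \<in> mpolys K n" "q \<in> mpolys K n" for p q using diff that .
  have zero: "0 \<in> mpolys K n" by (simp add: mpolys_def)
  have add: "p + q \<in> mpolys K n" if "p \<in> mpolys K n" "q \<in> mpolys K n" for p q
    using diff[OF that(1) diff[OF zero that(2)]] by simp
  have sum: "sum f I \<in> mpolys K n" if "\<And>i. i \<in> I \<Longrightarrow> f i \<in> mpolys K n" for f and I :: "(nat \<Rightarrow>\<^sub>0 nat) set"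
    using that by (induction I rule: infinite_finite_induct) (auto simp: zero add)
  fix p q assume pq: "p \<in> mpolys K n" "q \<in> mpolys K n"
  have "p * q = (\<Sum>m\<in>Poly_Mapping.keys p. \<Sum>m'\<in>Poly_Mapping.keys q.
      Poly_Mapping.single (m + m') (coef p m * coef q m'))"
    by (subst monom_expansion[of p], subst monom_expansion[of q])
       (simp add: sum_product mult_single)
  also have "\<dots> \<in> mpolys K n"
  proof (intro sum mpolys_single subring_mult[OF K] mpolys_coef[OF subring_zero[OF K] pq(1)]
      mpolys_coef[OF subring_zero[OF K] pq(2)])
    fix m m' assume "m \<in> Poly_Mapping.keys p" "m' \<in> Poly_Mapping.keys q"
    thus "Poly_Mapping.keys (m + m') \<subseteq> {..<n}"
      using keys_add[of m m'] mpolys_keys pq by blast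
  qed
  finally show "p * q \<in> mpolys K n" .
qed

lemma is_subring_UNIV: "is_subring UNIV"
  by (simp add: is_subring_def)

lemmas mpolys_UNIV_closed = subring_closed[OF is_subring_mpolys[OF is_subring_UNIV]]

lemma mpolys_UNIV: "p \<in> mpolys K n \<Longrightarrow> p \<in> mpolys UNIV n"
  by (auto simp: mpolys_def)

lemma mpolys_mconst: "c \<in> K \<Longrightarrow> mconst c \<in> mpolys K n"
  by (rule mpolys_single) auto

lemma mpolys_mvar: "1 \<in> K \<Longrightarrow> i < n \<Longrightarrow> mvar i \<in> mpolys K n"
  unfolding mvar_def by (rule mpolys_single) auto

lemma ev_image_eq_gen:
  assumes K: "is_subring K" and h: "hom_on UNIV h"
  shows "(\<lambda>p. ev h p x) ` mpolys K n = gen (h ` K \<union> x ` {..<n})"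
proof
  show "(\<lambda>p. ev h p x) ` mpolys K n \<subseteq> gen (h ` K \<union> x ` {..<n})"
    using gen_superset[of "h ` K \<union> x ` {..<n}"]
    by (auto intro!: ev_in_subring[OF is_subring_gen])
  show "gen (h ` K \<union> x ` {..<n}) \<subseteq> (\<lambda>p. ev h p x) ` mpolys K n"
  proof (rule gen_least)
    note P = is_subring_mpolys[OF K, of n]
    show "is_subring ((\<lambda>p. ev h p x) ` mpolys K n)"
    proof (rule is_subringI)
      show "1 \<in> (\<lambda>p. ev h p x) ` mpolys K n"
        using subring_one[OF P] ev_one[OF h] by (metis image_eqI)
    next
      fix a b assume "a \<in> (\<lambda>p. ev h p x) ` mpolys K n" "b \<in> (\<lambda>p. ev h p x) ` mpolys K n"
      then obtain p q where pq: "p \<in> mpolys K n" "q \<in> mpolys K n" "a = ev h p x" "b = ev h q x" by blast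
      show "a - b \<in> (\<lambda>p. ev h p x) ` mpolys K n"
        using pq subring_diff[OF P] ev_diff[OF h] by (intro image_eqI[of _ _ "p - q"]) auto
      show "a * b \<in> (\<lambda>p. ev h p x) ` mpolys K n"
        using pq subring_mult[OF P] ev_mult[OF h] by (intro image_eqI[of _ _ "p * q"]) auto
    qed
    show "h ` K \<union> x ` {..<n} \<subseteq> (\<lambda>p. ev h p x) ` mpolys K n"
    proof
      fix y assume "y \<in> h ` K \<union> x ` {..<n}"
      thus "y \<in> (\<lambda>p. ev h p x) ` mpolys K n"
      proof
        assume "y \<in> h ` K"
        then obtain c where "c \<in> K" "y = h c" by blast
        thus ?thesis using ev_single[OF h, of 0 c x]
          by (intro image_eqI[of _ _ "mconst c"]) (auto intro: mpolys_mconst)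
      next
        assume "y \<in> x ` {..<n}"
        then obtain i where "i < n" "y = x i" by blast
        thus ?thesis using ev_mvar[OF h, of i x] mpolys_mvar[OF subring_one[OF K]]
          by (intro image_eqI[of _ _ "mvar i"]) auto
      qed
    qed
  qed
qed

lemma meval_image_eq_gen:
  "is_subring K \<Longrightarrow> (\<lambda>p. meval p x) ` mpolys K n = gen (K \<union> x ` {..<n})"
  using ev_image_eq_gen[OF _ id_hom] by (simp add: meval_eq_ev)

text \<open>Exhibits a polynomial as a value of \<open>ev\<close>, so that a homomorphism on a
  polynomial ring can be recognized as evaluation at the images of the variables.\<close>

lemma ev_mconst_mvar: "ev mconst p mvar = (p :: 'c::comm_ring_1 mpoly)"
proof -
  have 1: "mvar i ^ k = Poly_Mapping.single (Poly_Mapping.single i k) (1 :: 'c)" for i k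
    by (induction k) (auto simp: mvar_def mult_single single_add[symmetric])
  have 2: "monom_eval m mvar = Poly_Mapping.single m (1 :: 'c)" for m
  proof -
    have "(\<Prod>i\<in>I. mvar i ^ Poly_Mapping.lookup m i) =
        Poly_Mapping.single (\<Sum>i\<in>I. Poly_Mapping.single i (Poly_Mapping.lookup m i)) (1 :: 'c)"
      if "finite I" for I using that by induction (auto simp: 1 mult_single)
    moreover have "(\<Sum>i\<in>Poly_Mapping.keys m. Poly_Mapping.single i (Poly_Mapping.lookup m i)) = m"
    proof (rule poly_mapping_eqI)
      fix k
      have "Poly_Mapping.lookup (\<Sum>i\<in>Poly_Mapping.keys m. Poly_Mapping.single i (Poly_Mapping.lookup m i)) k =
        (\<Sum>i\<in>Poly_Mapping.keys m. if i = k then Poly_Mapping.lookup m i else 0)"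
        by (simp add: lookup_sum lookup_single when_def)
      also have "\<dots> = Poly_Mapping.lookup m k" by (auto simp: in_keys_iff)
      finally show "Poly_Mapping.lookup (\<Sum>i\<in>Poly_Mapping.keys m.
        Poly_Mapping.single i (Poly_Mapping.lookup m i)) k = Poly_Mapping.lookup m k" .
    qed
    ultimately show ?thesis by (simp add: monom_eval_def)
  qed
  show ?thesis
    unfolding ev_def by (subst (3) monom_expansion) (simp add: 2 mult_single)
qed

lemma ev_substitute:
  assumes h: "hom_on UNIV h"
  shows "ev h (ev mconst p u) y = ev h p (\<lambda>i. ev h (u i) y)"
proof -
  have "p \<in> mpolys UNIV (Suc (Max (\<Union>m\<in>Poly_Mapping.keys p. Poly_Mapping.keys m)))"
    by (auto simp: mpolys_def intro!: le_imp_less_Suc Max_ge)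
  from hom_on_ev[OF is_subring_UNIV ev_hom_on[OF h] this, of mconst u y] show ?thesis
    using h by (simp add: ev_single)
qed

text \<open>An application of \<open>hom_extension\<close> over the field of constants: a
  homomorphism that does not kill \<open>p\<close> is evaluation at the images of the
  variables.\<close>

lemma mpoly_nonzero_point:
  fixes p :: "'a::alg_closed_field mpoly"
  assumes p: "p \<in> mpolys UNIV r" "p \<noteq> 0"
  shows "\<exists>c\<in>affine_space r. meval p c \<noteq> 0"
proof -
  define A :: "'a mpoly set" where "A = range mconst"
  have A: "is_subring A" unfolding A_def
    by (rule is_subringI) (auto simp: single_diff[symmetric] mult_single simp flip: single_one)
  define \<phi> :: "'a mpoly \<Rightarrow> 'a" where "\<phi> = (\<lambda>q. coef q 0)"
  have \<phi>: "hom_on A \<phi>" unfolding A_def \<phi>_def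
    by (rule hom_onI) (auto simp: lookup_minus mult_single)
  have G: "gen (mvar ` {..<r} \<union> A) = (\<lambda>p. ev mconst p mvar) ` mpolys UNIV r"
    unfolding A_def Un_commute[of "mvar ` {..<r}"]
    by (rule ev_image_eq_gen[OF is_subring_UNIV mconst_hom, symmetric])
  have pG: "p \<in> gen (mvar ` {..<r} \<union> A)" unfolding G ev_mconst_mvar using p by simp
  from hom_extension[OF A _ pG p(2), where ?'b = 'a] obtain v where
    v: "v \<in> A" "v \<noteq> 0" "\<And>\<phi> :: _ \<Rightarrow> 'a. hom_on A \<phi> \<and> \<phi> v \<noteq> 0 \<Longrightarrow>
     (\<exists>\<psi>. hom_on (gen (mvar ` {..<r} \<union> A)) \<psi> \<and> (\<forall>a\<in>A. \<psi> a = \<phi> a) \<and> \<psi> p \<noteq> 0)" by blast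
  have "\<phi> v \<noteq> 0" using v by (auto simp: A_def \<phi>_def)
  then obtain \<psi> where \<psi>: "hom_on (gen (mvar ` {..<r} \<union> A)) \<psi>" "\<And>a. a \<in> A \<Longrightarrow> \<psi> a = \<phi> a" "\<psi> p \<noteq> 0"
    using v \<phi> by blast
  define c where "c = (\<lambda>i. if i < r then \<psi> (mvar i) else 0)"
  have "\<psi> p = \<psi> (ev mconst p mvar)" by (simp add: ev_mconst_mvar)
  also have "\<dots> = ev (\<lambda>c. \<psi> (mconst c)) p (\<lambda>i. \<psi> (mvar i))"
    using gen_superset[of "mvar ` {..<r} \<union> A"]
    by (intro hom_on_ev[OF is_subring_gen \<psi>(1) p(1)]) (auto simp: A_def)
  also have "\<dots> = meval p c" unfolding meval_eq_ev
    by (rule ev_cong[OF p(1)]) (auto simp: c_def \<psi>(2) A_def \<phi>_def)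
  finally have "meval p c \<noteq> 0" using \<psi> by simp
  moreover have "c \<in> affine_space r" by (simp add: c_def affine_space_def)
  ultimately show ?thesis by blast
qed

section \<open>Linear disjointness\<close>

definition lin_indep :: "'a::field set \<Rightarrow> 'a set \<Rightarrow> bool" where
  "lin_indep K B \<longleftrightarrow> finite B \<and>
     (\<forall>k. (\<forall>d\<in>B. k d \<in> K) \<and> (\<Sum>d\<in>B. k d * d) = 0 \<longrightarrow> (\<forall>d\<in>B. k d = 0))"

definition lspan :: "'a::field set \<Rightarrow> 'a set \<Rightarrow> 'a set" where
  "lspan K B = {\<Sum>d\<in>B. k d * d | k. \<forall>d\<in>B. k d \<in> K}"

lemma lin_indepD:
  "lin_indep K B \<Longrightarrow> (\<And>d. d \<in> B \<Longrightarrow> k d \<in> K) \<Longrightarrow> (\<Sum>d\<in>B. k d * d) = 0 \<Longrightarrow> d \<in> B \<Longrightarrow> k d = 0"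
  unfolding lin_indep_def by blast

lemma lin_indep_finite: "lin_indep K B \<Longrightarrow> finite B"
  by (simp add: lin_indep_def)

lemma lspanI: "(\<And>d. d \<in> B \<Longrightarrow> k d \<in> K) \<Longrightarrow> (\<Sum>d\<in>B. k d * d) \<in> lspan K B"
  unfolding lspan_def by blast

lemma lspan_insert:
  assumes K: "is_subring K" and B: "finite B" "c \<notin> B"
  shows "lspan K B \<subseteq> lspan K (insert c B)" "c \<in> lspan K (insert c B)"
proof
  fix y assume "y \<in> lspan K B"
  then obtain k where k: "\<forall>d\<in>B. k d \<in> K" "y = (\<Sum>d\<in>B. k d * d)" by (auto simp: lspan_def)
  have "(\<Sum>d\<in>insert c B. (if d = c then 0 else k d) * d) \<in> lspan K (insert c B)"
    by (rule lspanI) (use k subring_zero[OF K] in auto)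
  also have "(\<Sum>d\<in>insert c B. (if d = c then 0 else k d) * d) = y"
  proof -
    have "(\<Sum>d\<in>B. (if d = c then 0 else k d) * d) = y" unfolding k(2) using B(2) by (intro sum.cong) auto
    thus ?thesis unfolding sum.insert[OF B] by simp
  qed
  finally show "y \<in> lspan K (insert c B)" .
next
  have "(\<Sum>d\<in>insert c B. (if d = c then 1 else 0) * d) \<in> lspan K (insert c B)"
    by (rule lspanI) (use subring_zero[OF K] subring_one[OF K] in auto)
  also have "(\<Sum>d\<in>insert c B. (if d = c then 1 else 0) * d) = c + (\<Sum>d\<in>B. 0)"
    unfolding sum.insert[OF B] using B(2) by (intro arg_cong2[where f = "(+)"] sum.cong) auto
  finally show "c \<in> lspan K (insert c B)" by simp
qed

lemma lin_indep_insert: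
  assumes K: "is_subfield K" and B: "lin_indep K B" and c: "c \<notin> lspan K B" "c \<notin> B"
  shows "lin_indep K (insert c B)"
  unfolding lin_indep_def
proof (intro conjI allI impI)
  note R = subfield_is_subring[OF K] and fin = lin_indep_finite[OF B]
  show "finite (insert c B)" using fin by simp
  fix k assume k: "(\<forall>d\<in>insert c B. k d \<in> K) \<and> (\<Sum>d\<in>insert c B. k d * d) = 0"
  hence eq: "k c * c + (\<Sum>d\<in>B. k d * d) = 0" using fin c by simp
  have "k c = 0"
  proof (rule ccontr)
    assume nz: "k c \<noteq> 0"
    have "(\<Sum>d\<in>B. (- k d / k c) * d) \<in> lspan K B"
      by (rule lspanI) (use k in \<open>auto intro!: subfield_divide[OF K] subring_uminus[OF R]\<close>)
    also have "(\<Sum>d\<in>B. (- k d / k c) * d) = - (\<Sum>d\<in>B. k d * d) / k c"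
      by (simp add: sum_divide_distrib sum_negf)
    also have "\<dots> = c" using eq nz by (simp add: field_simps add_eq_0_iff2)
    finally have "c \<in> lspan K B" .
    thus False using c by blast
  qed
  moreover from this have "(\<Sum>d\<in>B. k d * d) = 0" using eq by simp
  hence "k d = 0" if "d \<in> B" for d using lin_indepD[OF B, of k d] k that by blast
  ultimately show "\<forall>d\<in>insert c B. k d = 0" by blast
qed

lemma lin_indep_extend:
  assumes K: "is_subfield K" and B: "lin_indep K B" and C: "finite C"
  shows "\<exists>B'. B \<subseteq> B' \<and> lin_indep K B' \<and> C \<subseteq> lspan K B'"
  using C
proof (induction C rule: finite_induct)
  case empty
  thus ?case using B by blast
next
  case (insert c C)
  then obtain B' where B': "B \<subseteq> B'" "lin_indep K B'" "C \<subseteq> lspan K B'" by blast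
  show ?case
  proof (cases "c \<in> lspan K B'")
    case True
    thus ?thesis using B' by blast
  next
    case False
    have "c \<notin> B'"
    proof
      assume "c \<in> B'"
      hence "c \<in> lspan K (insert c (B' - {c}))"
        by (intro lspan_insert(2)[OF subfield_is_subring[OF K]]) (use lin_indep_finite[OF B'(2)] in auto)
      moreover have "insert c (B' - {c}) = B'" using \<open>c \<in> B'\<close> by blast
      ultimately show False using False by simp
    qed
    thus ?thesis
      using B' False lin_indep_insert[OF K B'(2) False]
        lspan_insert[OF subfield_is_subring[OF K] lin_indep_finite[OF B'(2)], of c]
      by (intro exI[of _ "insert c B'"]) auto
  qed
qed

lemma lin_indep_empty: "lin_indep K {}"
  by (simp add: lin_indep_def)

lemma coef_mconst_mult: "coef (mconst c * p) m = c * coef (p :: 'a::idom mpoly) m"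
  unfolding mult_map_scale_conv_mult[symmetric]
  by (simp add: Poly_Mapping.map.rep_eq when_def)

lemma mpoly_lspan_decompose:
  assumes K: "is_subring K" and B: "finite B" and p: "p \<in> mpolys UNIV n"
    and c: "\<And>m. m \<in> Poly_Mapping.keys p \<Longrightarrow> coef p m \<in> lspan K B"
  shows "\<exists>P. (\<forall>d\<in>B. P d \<in> mpolys K n) \<and> p = (\<Sum>d\<in>B. mconst d * P d)"
proof -
  have "\<forall>m\<in>Poly_Mapping.keys p. \<exists>k. (\<forall>d\<in>B. k d \<in> K) \<and> coef p m = (\<Sum>d\<in>B. k d * d)"
    using c unfolding lspan_def by blast
  then obtain k where k: "\<And>m d. m \<in> Poly_Mapping.keys p \<Longrightarrow> d \<in> B \<Longrightarrow> k m d \<in> K"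
    "\<And>m. m \<in> Poly_Mapping.keys p \<Longrightarrow> coef p m = (\<Sum>d\<in>B. k m d * d)" by metis
  define P where "P = (\<lambda>d. \<Sum>m\<in>Poly_Mapping.keys p. Poly_Mapping.single m (k m d))"
  have "P d \<in> mpolys K n" if "d \<in> B" for d unfolding P_def
    using k(1) that mpolys_keys[OF p]
    by (intro subring_sum[OF is_subring_mpolys[OF K]] mpolys_single) auto
  moreover have "p = (\<Sum>d\<in>B. mconst d * P d)"
  proof -
    have "(\<Sum>d\<in>B. mconst d * P d) = (\<Sum>d\<in>B. \<Sum>m\<in>Poly_Mapping.keys p. Poly_Mapping.single m (k m d * d))"
      by (simp add: P_def sum_distrib_left mult_single mult.commute)
    also have "\<dots> = (\<Sum>m\<in>Poly_Mapping.keys p. \<Sum>d\<in>B. Poly_Mapping.single m (k m d * d))"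
      by (rule sum.swap)
    also have "\<dots> = (\<Sum>m\<in>Poly_Mapping.keys p. Poly_Mapping.single m (\<Sum>d\<in>B. k m d * d))"
    proof (rule sum.cong[OF refl])
      fix m
      show "(\<Sum>d\<in>B. Poly_Mapping.single m (k m d * d)) = Poly_Mapping.single m (\<Sum>d\<in>B. k m d * d)"
        using B by (induction B rule: finite_induct) (auto simp: single_add)
    qed
    also have "\<dots> = p" by (subst (3) monom_expansion) (simp add: k(2))
    finally show ?thesis by simp
  qed
  ultimately show ?thesis by blast
qed

text \<open>All coefficients are expanded in one \<open>K\<close>-independent set, which reduces
  statements over the ambient field to statements over \<open>K\<close>. Starting from a given
  \<open>B\<close> keeps an expression already written in terms of \<open>B\<close> comparable with
  the new expansions.\<close>

lemma mpoly_decompose: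
  assumes K: "is_subfield K" and B: "lin_indep K B" and S: "finite S" "S \<subseteq> mpolys UNIV n"
  shows "\<exists>B'. B \<subseteq> B' \<and> lin_indep K B' \<and>
    (\<forall>p\<in>S. \<exists>P. (\<forall>d\<in>B'. P d \<in> mpolys K n) \<and> p = (\<Sum>d\<in>B'. mconst d * P d))"
proof -
  have "finite (\<Union>p\<in>S. coef p ` Poly_Mapping.keys p)" using S by simp
  from lin_indep_extend[OF K B this] obtain B' where
    B': "B \<subseteq> B'" "lin_indep K B'" "(\<Union>p\<in>S. coef p ` Poly_Mapping.keys p) \<subseteq> lspan K B'" by blast
  have "\<exists>P. (\<forall>d\<in>B'. P d \<in> mpolys K n) \<and> p = (\<Sum>d\<in>B'. mconst d * P d)" if "p \<in> S" for p
    by (rule mpoly_lspan_decompose[OF subfield_is_subring[OF K] lin_indep_finite[OF B'(2)]])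
       (use S B' that in blast)+
  thus ?thesis using B' by blast
qed

lemma mpoly_lin_indep:
  assumes K: "is_subring K" and B: "lin_indep K B" and P: "\<And>d. d \<in> B \<Longrightarrow> P d \<in> mpolys K n"
    and 0: "(\<Sum>d\<in>B. mconst d * P d) = 0" and d: "d \<in> B"
  shows "P d = 0"
proof (rule poly_mapping_eqI)
  fix m
  have "(\<Sum>d\<in>B. coef (P d) m * d) = coef (\<Sum>d\<in>B. mconst d * P d) m"
    unfolding lookup_sum coef_mconst_mult by (simp add: mult.commute)
  hence "(\<Sum>d\<in>B. coef (P d) m * d) = 0" using 0 by simp
  from lin_indepD[OF B _ this d] show "coef (P d) m = coef 0 m"
    using P mpolys_coef[OF subring_zero[OF K]] by auto
qed

text \<open>Linear disjointness of the coordinate field from the coordinate ring of \<open>V\<close> over \<open>K\<close>.\<close>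

definition descends :: "'a::field set \<Rightarrow> nat \<Rightarrow> (nat \<Rightarrow> 'a) set \<Rightarrow> bool" where
  "descends K n V \<longleftrightarrow> (\<forall>B P. lin_indep K B \<and> (\<forall>d\<in>B. P d \<in> mpolys K n) \<and>
     (\<forall>y\<in>V. (\<Sum>d\<in>B. d * meval (P d) y) = 0) \<longrightarrow> (\<forall>d\<in>B. \<forall>y\<in>V. meval (P d) y = 0))"

lemma descendsD:
  "descends K n V \<Longrightarrow> lin_indep K B \<Longrightarrow> (\<And>d. d \<in> B \<Longrightarrow> P d \<in> mpolys K n) \<Longrightarrow>
     (\<And>y. y \<in> V \<Longrightarrow> (\<Sum>d\<in>B. d * meval (P d) y) = 0) \<Longrightarrow> d \<in> B \<Longrightarrow> y \<in> V \<Longrightarrow> meval (P d) y = 0"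
  unfolding descends_def by blast

text \<open>The combination of the \<open>P d\<close> is written as an ideal element with generators
  over \<open>K\<close>; its multipliers are expanded in an independent set containing
  \<open>B\<close>. Comparing components puts each \<open>P d\<close> into the ideal generated over
  \<open>K\<close>.\<close>

lemma defined_over_imp_descends:
  assumes K: "is_subfield K" and V: "defined_over K n V"
  shows "descends K n V"
  unfolding descends_def
proof (intro allI impI, elim conjE)
  note R = subfield_is_subring[OF K]
  fix B P assume B: "lin_indep K B" and P: "\<forall>d\<in>B. P d \<in> mpolys K n"
    and 0: "\<forall>y\<in>V. (\<Sum>d\<in>B. d * meval (P d) y) = 0"
  define p where "p = (\<Sum>d\<in>B. mconst d * P d)"
  have "p \<in> vanishing_ideal UNIV n V" unfolding vanishing_ideal_def p_def using 0 P
    by (auto simp: meval_simps intro!: mpolys_UNIV_closed mpolys_mconst dest: mpolys_UNIV)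
  hence "p \<in> generated_ideal n (vanishing_ideal K n V)" using V by (simp add: defined_over_def)
  then obtain T c where T: "finite T" "T \<subseteq> vanishing_ideal K n V" "c ` T \<subseteq> mpolys UNIV n"
    "p = (\<Sum>g\<in>T. c g * g)" unfolding generated_ideal_def by blast
  from mpoly_decompose[OF K B _ T(3)] T(1) obtain B' where B': "B \<subseteq> B'" "lin_indep K B'"
    "\<forall>q\<in>c ` T. \<exists>P. (\<forall>d\<in>B'. P d \<in> mpolys K n) \<and> q = (\<Sum>d\<in>B'. mconst d * P d)" by auto
  hence "\<forall>g\<in>T. \<exists>P. (\<forall>d\<in>B'. P d \<in> mpolys K n) \<and> c g = (\<Sum>d\<in>B'. mconst d * P d)" by blast
  from bchoice[OF this] obtain C where C: "\<And>g d. g \<in> T \<Longrightarrow> d \<in> B' \<Longrightarrow> C g d \<in> mpolys K n"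
    "\<And>g. g \<in> T \<Longrightarrow> c g = (\<Sum>d\<in>B'. mconst d * C g d)" by blast
  \<comment> \<open>The difference of the two expansions, component by component; the left one is
    extended by 0 to indices outside \<open>B\<close>.\<close>
  define Q where "Q = (\<lambda>d. (if d \<in> B then P d else 0) - (\<Sum>g\<in>T. C g d * g))"
  have TK: "g \<in> mpolys K n" if "g \<in> T" for g using T that by (auto simp: vanishing_ideal_def)
  have Q: "Q d \<in> mpolys K n" if "d \<in> B'" for d unfolding Q_def
    using P C TK that by (auto intro!: subring_closed[OF is_subring_mpolys[OF R]])
  have "(\<Sum>d\<in>B'. mconst d * (if d \<in> B then P d else 0)) = p"
    unfolding p_def using B' lin_indep_finite[OF B'(2)] by (intro sum.mono_neutral_cong_right) auto
  moreover have "(\<Sum>d\<in>B'. mconst d * (\<Sum>g\<in>T. C g d * g)) = p"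
    unfolding T(4) by (simp add: sum_distrib_left sum_distrib_right C(2) mult.assoc, rule sum.swap)
  ultimately have "(\<Sum>d\<in>B'. mconst d * Q d) = 0"
    by (simp add: Q_def right_diff_distrib sum_subtractf)
  hence Q0: "Q d = 0" if "d \<in> B'" for d using mpoly_lin_indep[OF R B'(2), of Q n d] Q that by blast
  show "\<forall>d\<in>B. \<forall>y\<in>V. meval (P d) y = 0"
  proof (intro ballI)
    fix d y assume dy: "d \<in> B" "y \<in> V"
    hence "P d = (\<Sum>g\<in>T. C g d * g)" using Q0[of d] B' by (auto simp: Q_def)
    moreover have "meval g y = 0" if "g \<in> T" for g using that T dy by (auto simp: vanishing_ideal_def)
    ultimately show "meval (P d) y = 0" by (simp add: meval_simps)
  qed
qed

text \<open>The components over \<open>K\<close> of a polynomial vanishing on \<open>V\<close>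
  vanish on \<open>V\<close> themselves, so they are generators from the ideal over \<open>K\<close>
  and the basis elements are the multipliers.\<close>

lemma descends_imp_defined_over:
  assumes K: "is_subfield K" and V: "descends K n V"
  shows "defined_over K n V"
  unfolding defined_over_def
proof
  show "vanishing_ideal UNIV n V \<subseteq> generated_ideal n (vanishing_ideal K n V)"
  proof
    fix p assume p: "p \<in> vanishing_ideal UNIV n V"
    hence "{p} \<subseteq> mpolys UNIV n" by (auto simp: vanishing_ideal_def)
    from mpoly_decompose[OF K lin_indep_empty _ this] obtain B P where
      B: "lin_indep K B" and P: "\<And>d. d \<in> B \<Longrightarrow> P d \<in> mpolys K n" "p = (\<Sum>d\<in>B. mconst d * P d)" by auto
    have "P d \<in> vanishing_ideal K n V" if "d \<in> B" for d
    proof -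
      have "(\<Sum>d\<in>B. d * meval (P d) y) = 0" if "y \<in> V" for y
        using p that unfolding P(2) vanishing_ideal_def by (simp add: meval_simps)
      from descendsD[OF V B P(1) this \<open>d \<in> B\<close>] show ?thesis
        using P(1)[OF \<open>d \<in> B\<close>] by (auto simp: vanishing_ideal_def)
    qed
    \<comment> \<open>Several indices may carry the same polynomial, while
      \<open>generated_ideal\<close> sums over a set of polynomials; equal ones are therefore
      collected.\<close>
    moreover have "p = (\<Sum>g\<in>P ` B. (\<Sum>d\<in>{d \<in> B. P d = g}. mconst d) * g)"
      unfolding P(2) sum_distrib_right
      by (subst sum.image_gen[OF lin_indep_finite[OF B], of _ P]) (auto intro!: sum.cong)
    moreover have "(\<lambda>g. \<Sum>d\<in>{d \<in> B. P d = g}. mconst d) ` (P ` B) \<subseteq> mpolys UNIV n"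
      by (auto intro!: mpolys_UNIV_closed mpolys_mconst)
    ultimately show "p \<in> generated_ideal n (vanishing_ideal K n V)"
      unfolding generated_ideal_def using lin_indep_finite[OF B]
      by (intro CollectI exI[of _ "P ` B"] exI[of _ "\<lambda>g. \<Sum>d\<in>{d \<in> B. P d = g}. mconst d"]) auto
  qed
  show "generated_ideal n (vanishing_ideal K n V) \<subseteq> vanishing_ideal UNIV n V"
  proof
    fix p assume "p \<in> generated_ideal n (vanishing_ideal K n V)"
    then obtain T c where T: "finite T" "T \<subseteq> vanishing_ideal K n V" "c ` T \<subseteq> mpolys UNIV n"
      "p = (\<Sum>g\<in>T. c g * g)" unfolding generated_ideal_def by blast
    have "g \<in> mpolys UNIV n \<and> (\<forall>y\<in>V. meval g y = 0)" if "g \<in> T" for g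
      using that T(2) by (auto simp: vanishing_ideal_def intro: mpolys_UNIV)
    thus "p \<in> vanishing_ideal UNIV n V" unfolding vanishing_ideal_def T(4) using T(3)
      by (auto simp: meval_simps image_subset_iff intro!: mpolys_UNIV_closed)
  qed
qed

text \<open>Multiplication by a power of the product of all denominators. The claim covers every
  large exponent, so that finitely many polynomials can later be cleared with the same
  power.\<close>

lemma clear_denominators:
  fixes K :: "'a::field set"
  assumes K: "is_subring K" and p: "p \<in> mpolys K k"
    and uv: "\<And>i. i < k \<Longrightarrow> u i \<in> mpolys K n" "\<And>i. i < k \<Longrightarrow> v i \<in> mpolys K n"
  shows "\<exists>N0. \<forall>N\<ge>N0. \<exists>P\<in>mpolys K n. \<forall>y. (\<forall>i<k. meval (v i) y \<noteq> 0) \<longrightarrow>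
    meval P y = (\<Prod>i<k. meval (v i) y) ^ N * meval p (\<lambda>i. meval (u i) y / meval (v i) y)"
proof -
  \<comment> \<open>The sum of all exponents in \<open>p\<close>, a crude bound for each of
    them.\<close>
  define N0 where "N0 = (\<Sum>m\<in>Poly_Mapping.keys p. \<Sum>i\<in>Poly_Mapping.keys m. Poly_Mapping.lookup m i)"
  have N0: "Poly_Mapping.lookup m i \<le> N0" if "m \<in> Poly_Mapping.keys p" for m i
  proof (cases "i \<in> Poly_Mapping.keys m")
    case True
    hence "Poly_Mapping.lookup m i \<le> (\<Sum>i\<in>Poly_Mapping.keys m. Poly_Mapping.lookup m i)"
      by (intro member_le_sum) auto
    also have "\<dots> \<le> N0" unfolding N0_def
      using that by (intro member_le_sum[of m _ "\<lambda>m. \<Sum>i\<in>Poly_Mapping.keys m. Poly_Mapping.lookup m i"]) auto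
    finally show ?thesis .
  qed (auto simp: in_keys_iff)
  show ?thesis
  proof (intro exI[of _ N0] allI impI)
    fix N assume N: "N0 \<le> N"
    define P where "P = (\<Sum>m\<in>Poly_Mapping.keys p. mconst (coef p m) *
      (\<Prod>i<k. u i ^ Poly_Mapping.lookup m i * v i ^ (N - Poly_Mapping.lookup m i)))"
    have "P \<in> mpolys K n" unfolding P_def
      using uv mpolys_coef[OF subring_zero[OF K] p]
      by (auto intro!: subring_closed[OF is_subring_mpolys[OF K]] mpolys_mconst)
    moreover have "meval P y = (\<Prod>i<k. meval (v i) y) ^ N * meval p (\<lambda>i. meval (u i) y / meval (v i) y)"
      if y: "\<forall>i<k. meval (v i) y \<noteq> 0" for y
    proof -
      have *: "(\<Prod>i<k. meval (v i) y) ^ N * monom_eval m (\<lambda>i. meval (u i) y / meval (v i) y) =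
        (\<Prod>i<k. meval (u i) y ^ Poly_Mapping.lookup m i * meval (v i) y ^ (N - Poly_Mapping.lookup m i))"
        if m: "m \<in> Poly_Mapping.keys p" for m
      proof -
        have "monom_eval m (\<lambda>i. meval (u i) y / meval (v i) y) =
          (\<Prod>i<k. (meval (u i) y / meval (v i) y) ^ Poly_Mapping.lookup m i)"
          by (rule monom_eval_superset) (use mpolys_keys[OF p m] in auto)
        hence "(\<Prod>i<k. meval (v i) y) ^ N * monom_eval m (\<lambda>i. meval (u i) y / meval (v i) y) =
          (\<Prod>i<k. meval (v i) y ^ N * (meval (u i) y / meval (v i) y) ^ Poly_Mapping.lookup m i)"
          by (simp add: prod_power_distrib prod.distrib)
        also have "\<dots> = (\<Prod>i<k. meval (u i) y ^ Poly_Mapping.lookup m i * meval (v i) y ^ (N - Poly_Mapping.lookup m i))"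
        proof (rule prod.cong[OF refl])
          fix i assume "i \<in> {..<k}"
          moreover have "Poly_Mapping.lookup m i \<le> N" using N0[OF m, of i] N by simp
          ultimately show "meval (v i) y ^ N * (meval (u i) y / meval (v i) y) ^ Poly_Mapping.lookup m i =
            meval (u i) y ^ Poly_Mapping.lookup m i * meval (v i) y ^ (N - Poly_Mapping.lookup m i)"
            using y by (simp add: power_divide power_diff)
        qed
        finally show ?thesis .
      qed
      have "meval P y = (\<Sum>m\<in>Poly_Mapping.keys p. coef p m *
        ((\<Prod>i<k. meval (v i) y) ^ N * monom_eval m (\<lambda>i. meval (u i) y / meval (v i) y)))"
        by (simp add: *, simp add: P_def meval_simps)
      also have "\<dots> = (\<Prod>i<k. meval (v i) y) ^ N * meval p (\<lambda>i. meval (u i) y / meval (v i) y)"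
        by (simp add: meval_eq_ev[of p] ev_def sum_distrib_left mult_ac)
      finally show ?thesis .
    qed
    ultimately show "\<exists>P\<in>mpolys K n. \<forall>y. (\<forall>i<k. meval (v i) y \<noteq> 0) \<longrightarrow>
      meval P y = (\<Prod>i<k. meval (v i) y) ^ N * meval p (\<lambda>i. meval (u i) y / meval (v i) y)" by blast
  qed
qed

section \<open>Rational maps and specializations\<close>

lemma meval_mult: "meval (p * q) (x :: _ \<Rightarrow> 'a::comm_ring_1) = meval p x * meval q x"
  by (simp add: meval_simps)

lemma zero_set_subset_affine: "zero_set n S \<subseteq> affine_space n"
  by (auto simp: zero_set_def)

lemma irreducible_prime:
  assumes V: "abs_irreducible n V" and pq: "p \<in> mpolys UNIV n" "q \<in> mpolys UNIV n"
    and 0: "\<And>y. y \<in> V \<Longrightarrow> meval p y * meval q y = 0"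
  shows "(\<forall>y\<in>V. meval p y = 0) \<or> (\<forall>y\<in>V. meval q y = 0)"
proof -
  obtain S where S: "S \<subseteq> mpolys UNIV n" "V = zero_set n S"
    using V by (auto simp: abs_irreducible_def zariski_closed_def)
  have closed: "zariski_closed n {y \<in> V. meval g y = 0}" if "g \<in> mpolys UNIV n" for g
    unfolding zariski_closed_def
    by (rule exI[of _ "insert g S"]) (use S that in \<open>auto simp: zero_set_def\<close>)
  have "V = {y \<in> V. meval p y = 0} \<union> {y \<in> V. meval q y = 0}" using 0 by auto
  hence "V = {y \<in> V. meval p y = 0} \<or> V = {y \<in> V. meval q y = 0}"
    using V closed[OF pq(1)] closed[OF pq(2)] unfolding abs_irreducible_def by blast
  thus ?thesis by blast
qed

lemma abs_irreducibleI:
  assumes cl: "zariski_closed n V" and ne: "V \<noteq> {}"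
    and prime: "\<And>p q. p \<in> mpolys UNIV n \<Longrightarrow> q \<in> mpolys UNIV n \<Longrightarrow>
      (\<And>y. y \<in> V \<Longrightarrow> meval p y * meval q y = 0) \<Longrightarrow>
      (\<forall>y\<in>V. meval p y = 0) \<or> (\<forall>y\<in>V. meval q y = 0)"
  shows "abs_irreducible n V"
  unfolding abs_irreducible_def
proof (intro conjI allI impI cl ne)
  fix A B assume AB: "zariski_closed n A \<and> zariski_closed n B \<and> V = A \<union> B"
  then obtain S T where ST: "S \<subseteq> mpolys UNIV n" "A = zero_set n S" "T \<subseteq> mpolys UNIV n" "B = zero_set n T"
    by (auto simp: zariski_closed_def)
  have Va: "V \<subseteq> affine_space n" using AB ST zero_set_subset_affine by blast
  show "V = A \<or> V = B"
  proof (rule ccontr)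
    assume "\<not> (V = A \<or> V = B)"
    then obtain a b where ab: "a \<in> V" "a \<notin> A" "b \<in> V" "b \<notin> B" using AB by blast
    then obtain p q where p: "p \<in> S" "meval p a \<noteq> 0" and q: "q \<in> T" "meval q b \<noteq> 0"
      using ST Va by (auto simp: zero_set_def)
    have "meval p y * meval q y = 0" if "y \<in> V" for y
      using that AB ST p q by (auto simp: zero_set_def)
    with prime[of p q] p q ST ab show False by blast
  qed
qed

lemma generic_point_nonzero:
  "generic_point K n V x \<Longrightarrow> q \<in> mpolys K n - vanishing_ideal K n V \<Longrightarrow> meval q x \<noteq> 0"
  by (auto simp: generic_point_def vanishing_ideal_def)

lemma rational_fun_at_value:
  assumes "rational_fun_at n V f a c" "a \<in> V" "meval (snd f) a \<noteq> 0"
  shows "c = meval (fst f) a / meval (snd f) a"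
  using assms unfolding rational_fun_at_def by (auto simp: field_simps)

lemma rational_fun_at_denominator:
  assumes "fst f \<in> mpolys UNIV n" "snd f \<in> mpolys UNIV n" "meval (snd f) a \<noteq> 0"
  shows "rational_fun_at n V f a (meval (fst f) a / meval (snd f) a)"
  using assms unfolding rational_fun_at_def by (intro bexI[of _ "fst f"] bexI[of _ "snd f"]) auto

lemma affine_space_closed: "zariski_closed n (affine_space n)"
  unfolding zariski_closed_def by (rule exI[of _ "{}"]) (auto simp: zero_set_def)

text \<open>Independence is given only over \<open>K\<close>, whereas density concerns polynomials
  over the ambient field. A polynomial vanishing on the image is therefore decomposed over
  \<open>K\<close>; after clearing denominators, \<open>descends\<close> makes each component vanish
  at the generic value, so each component is 0.\<close>

lemma dominatingI:
  fixes K :: "'a::alg_closed_field set"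
  assumes K: "is_subfield K" and V: "descends K n V" and x: "generic_point K n V x"
    and \<nu>: "rational_map K n V r \<nu>"
    and ind: "alg_independent K r (\<lambda>i. meval (fst (\<nu> i)) x / meval (snd (\<nu> i)) x)"
  shows "dominating n V r \<nu>"
  unfolding dominating_def zariski_closure_def
proof
  note R = subfield_is_subring[OF K]
  let ?I = "{c. \<exists>a. rational_map_at n V r \<nu> a c}"
  show "\<Inter>{V. zariski_closed r V \<and> ?I \<subseteq> V} \<subseteq> affine_space r"
    using affine_space_closed[of r] by (intro Inter_lower) (auto simp: rational_map_at_def)
  have \<nu>': "fst (\<nu> i) \<in> mpolys K n" "snd (\<nu> i) \<in> mpolys K n" "meval (snd (\<nu> i)) x \<noteq> 0" if "i < r" for i
    using \<nu> that generic_point_nonzero[OF x] by (auto simp: rational_map_def)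
  define den where "den = (\<Prod>i<r. snd (\<nu> i))"
  have den: "den \<in> mpolys K n" unfolding den_def using \<nu>' by (intro subring_prod[OF is_subring_mpolys[OF R]]) auto
  have den_ev: "meval den y = (\<Prod>i<r. meval (snd (\<nu> i)) y)" for y by (simp add: den_def meval_simps)
  have zero: "p = 0" if p: "p \<in> mpolys UNIV r" "\<And>c. c \<in> ?I \<Longrightarrow> meval p c = 0" for p
  proof -
    have "{p} \<subseteq> mpolys UNIV r" using p by simp
    from mpoly_decompose[OF K lin_indep_empty _ this] obtain B P where
      B: "lin_indep K B" and P: "\<And>d. d \<in> B \<Longrightarrow> P d \<in> mpolys K r" "p = (\<Sum>d\<in>B. mconst d * P d)" by auto
    have "\<forall>d\<in>B. \<exists>N0. \<forall>N\<ge>N0. \<exists>Q\<in>mpolys K n. \<forall>y. (\<forall>i<r. meval (snd (\<nu> i)) y \<noteq> 0) \<longrightarrow>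
      meval Q y = (\<Prod>i<r. meval (snd (\<nu> i)) y) ^ N * meval (P d) (\<lambda>i. meval (fst (\<nu> i)) y / meval (snd (\<nu> i)) y)"
    proof
      fix d assume d: "d \<in> B"
      show "\<exists>N0. \<forall>N\<ge>N0. \<exists>Q\<in>mpolys K n. \<forall>y. (\<forall>i<r. meval (snd (\<nu> i)) y \<noteq> 0) \<longrightarrow>
        meval Q y = (\<Prod>i<r. meval (snd (\<nu> i)) y) ^ N * meval (P d) (\<lambda>i. meval (fst (\<nu> i)) y / meval (snd (\<nu> i)) y)"
        by (rule clear_denominators[OF R P(1)[OF d], of "\<lambda>i. fst (\<nu> i)" n "\<lambda>i. snd (\<nu> i)"]) (use \<nu>' in auto)
    qed
    from bchoice[OF this] obtain N0 where N0: "\<And>d N. d \<in> B \<Longrightarrow> N \<ge> N0 d \<Longrightarrow>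
      \<exists>Q\<in>mpolys K n. \<forall>y. (\<forall>i<r. meval (snd (\<nu> i)) y \<noteq> 0) \<longrightarrow>
      meval Q y = (\<Prod>i<r. meval (snd (\<nu> i)) y) ^ N * meval (P d) (\<lambda>i. meval (fst (\<nu> i)) y / meval (snd (\<nu> i)) y)"
      by blast
    define N where "N = (\<Sum>d\<in>B. N0 d)"
    have "N0 d \<le> N" if "d \<in> B" for d unfolding N_def
      using that lin_indep_finite[OF B] by (intro member_le_sum) auto
    with N0 have "\<forall>d\<in>B. \<exists>Q. Q \<in> mpolys K n \<and> (\<forall>y. (\<forall>i<r. meval (snd (\<nu> i)) y \<noteq> 0) \<longrightarrow>
      meval Q y = (\<Prod>i<r. meval (snd (\<nu> i)) y) ^ N * meval (P d) (\<lambda>i. meval (fst (\<nu> i)) y / meval (snd (\<nu> i)) y))"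
      by blast
    from bchoice[OF this] obtain Q where Q: "\<And>d. d \<in> B \<Longrightarrow> Q d \<in> mpolys K n"
      "\<And>d y. d \<in> B \<Longrightarrow> (\<forall>i<r. meval (snd (\<nu> i)) y \<noteq> 0) \<Longrightarrow>
      meval (Q d) y = (\<Prod>i<r. meval (snd (\<nu> i)) y) ^ N * meval (P d) (\<lambda>i. meval (fst (\<nu> i)) y / meval (snd (\<nu> i)) y)"
      by blast
    \<comment> \<open>The extra factor \<open>den\<close> makes the identity hold also at points
      where a given denominator vanishes and nothing is known about the map.\<close>
    have 0: "(\<Sum>d\<in>B. d * meval (den * Q d) y) = 0" if y: "y \<in> V" for y
    proof (cases "\<forall>i<r. meval (snd (\<nu> i)) y \<noteq> 0")
      case False
      hence "meval den y = 0" by (auto simp: den_ev)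
      thus ?thesis by (simp add: meval_simps)
    next
      case True
      define c where "c = (\<lambda>i. if i < r then meval (fst (\<nu> i)) y / meval (snd (\<nu> i)) y else 0)"
      have "rational_map_at n V r \<nu> y c" unfolding rational_map_at_def
        using y True \<nu>' by (auto simp: c_def affine_space_def intro!: rational_fun_at_denominator mpolys_UNIV)
      hence "meval p c = 0" using p by blast
      hence 1: "(\<Sum>d\<in>B. d * meval (P d) c) = 0" unfolding P(2) by (simp add: meval_simps)
      have "meval (P d) (\<lambda>i. meval (fst (\<nu> i)) y / meval (snd (\<nu> i)) y) = meval (P d) c" if "d \<in> B" for d
        by (rule meval_cong[OF P(1)[OF that]]) (simp add: c_def)
      hence "(\<Sum>d\<in>B. d * meval (den * Q d) y) = (\<Sum>d\<in>B. meval den y * meval den y ^ N * (d * meval (P d) c))"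
        using True by (intro sum.cong) (auto simp: meval_mult Q(2) den_ev)
      also have "\<dots> = meval den y * meval den y ^ N * (\<Sum>d\<in>B. d * meval (P d) c)"
        by (simp only: sum_distrib_left)
      finally show ?thesis using 1 by simp
    qed
    have "P d = 0" if d: "d \<in> B" for d
    proof -
      have xV: "x \<in> V" using x by (simp add: generic_point_def)
      have "den * Q d \<in> mpolys K n" if "d \<in> B" for d
        using that by (intro subring_mult[OF is_subring_mpolys[OF R]] den Q)
      hence "meval (den * Q d) x = 0"
        using descendsD[OF V B, of "\<lambda>d. den * Q d" d x] 0 d xV by blast
      moreover have "meval den x \<noteq> 0" using \<nu>' by (simp add: den_ev)
      ultimately have "meval (Q d) x = 0" by (simp add: meval_simps)
      hence "meval (P d) (\<lambda>i. meval (fst (\<nu> i)) x / meval (snd (\<nu> i)) x) = 0"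
        using Q(2)[OF d, of x] \<nu>' by (auto simp: prod_zero_iff)
      thus ?thesis using ind P(1)[OF d] by (simp add: alg_independent_def)
    qed
    thus "p = 0" by (simp add: P(2))
  qed
  show "affine_space r \<subseteq> \<Inter>{V. zariski_closed r V \<and> ?I \<subseteq> V}"
  proof (rule Inter_greatest)
    fix Z assume "Z \<in> {V. zariski_closed r V \<and> ?I \<subseteq> V}"
    then obtain S where S: "S \<subseteq> mpolys UNIV r" "Z = zero_set r S" "?I \<subseteq> Z" by (auto simp: zariski_closed_def)
    have "meval p c = 0" if "p \<in> S" for p c
    proof -
      have "p = 0" using that S by (intro zero) (auto simp: zero_set_def)
      thus ?thesis by (simp add: meval_def)
    qed
    thus "affine_space r \<subseteq> Z" unfolding S(2) zero_set_def by blast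
  qed
qed

text \<open>A relation over \<open>K\<close> at the generic value holds wherever the given fractions
  are defined. The image also contains values defined only through other fractions; irreducibility
  of \<open>V\<close> carries the relation to these points. Then \<open>p\<close> vanishes on a
  dense set, hence everywhere, and is 0 by \<open>mpoly_nonzero_point\<close>.\<close>

lemma dominatingD:
  fixes K :: "'a::alg_closed_field set"
  assumes K: "is_subfield K" and V: "abs_irreducible n V" and x: "generic_point K n V x"
    and \<nu>: "rational_map K n V r \<nu>" and dom: "dominating n V r \<nu>"
  shows "alg_independent K r (\<lambda>i. meval (fst (\<nu> i)) x / meval (snd (\<nu> i)) x)"
  unfolding alg_independent_def
proof (intro ballI impI)
  note R = subfield_is_subring[OF K]
  fix p assume p: "p \<in> mpolys K r" and 0: "meval p (\<lambda>i. meval (fst (\<nu> i)) x / meval (snd (\<nu> i)) x) = 0"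
  have \<nu>': "fst (\<nu> i) \<in> mpolys K n" "snd (\<nu> i) \<in> mpolys K n" "meval (snd (\<nu> i)) x \<noteq> 0" if "i < r" for i
    using \<nu> that generic_point_nonzero[OF x] by (auto simp: rational_map_def)
  have xV: "x \<in> V" using x by (simp add: generic_point_def)
  define den where "den = (\<Prod>i<r. snd (\<nu> i))"
  have den: "den \<in> mpolys K n" unfolding den_def using \<nu>' by (intro subring_prod[OF is_subring_mpolys[OF R]]) auto
  have den_ev: "meval den y = (\<Prod>i<r. meval (snd (\<nu> i)) y)" for y by (simp add: den_def meval_simps)
  from clear_denominators[OF R p, of "\<lambda>i. fst (\<nu> i)" n "\<lambda>i. snd (\<nu> i)"] \<nu>' obtain N where
    "\<exists>P\<in>mpolys K n. \<forall>y. (\<forall>i<r. meval (snd (\<nu> i)) y \<noteq> 0) \<longrightarrow>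
      meval P y = (\<Prod>i<r. meval (snd (\<nu> i)) y) ^ N * meval p (\<lambda>i. meval (fst (\<nu> i)) y / meval (snd (\<nu> i)) y)"
    by blast
  then obtain P where P: "P \<in> mpolys K n" "\<And>y. (\<forall>i<r. meval (snd (\<nu> i)) y \<noteq> 0) \<Longrightarrow>
      meval P y = (\<Prod>i<r. meval (snd (\<nu> i)) y) ^ N * meval p (\<lambda>i. meval (fst (\<nu> i)) y / meval (snd (\<nu> i)) y)"
    by blast
  have "meval P x = 0" using P(2)[of x] \<nu>' 0 by simp
  hence PV: "meval P y = 0" if "y \<in> V" for y using x P(1) that by (auto simp: generic_point_def)
  have image: "meval p c = 0" if "rational_map_at n V r \<nu> a c" for a c
  proof -
    from that have aV: "a \<in> V" and "\<forall>i\<in>{..<r}. \<exists>f. fst f \<in> mpolys UNIV n \<and> snd f \<in> mpolys UNIV n \<and>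
      (\<forall>y\<in>V. meval (fst f) y * meval (snd (\<nu> i)) y = meval (fst (\<nu> i)) y * meval (snd f) y) \<and>
      meval (snd f) a \<noteq> 0 \<and> c i = meval (fst f) a / meval (snd f) a"
      by (auto simp: rational_map_at_def rational_fun_at_def Bex_def)
    from bchoice[OF this(2)] obtain f where f0: "\<forall>i\<in>{..<r}. fst (f i) \<in> mpolys UNIV n \<and> snd (f i) \<in> mpolys UNIV n \<and>
      (\<forall>y\<in>V. meval (fst (f i)) y * meval (snd (\<nu> i)) y = meval (fst (\<nu> i)) y * meval (snd (f i)) y) \<and>
      meval (snd (f i)) a \<noteq> 0 \<and> c i = meval (fst (f i)) a / meval (snd (f i)) a" ..
    have f: "\<And>i. i < r \<Longrightarrow> fst (f i) \<in> mpolys UNIV n"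
      "\<And>i. i < r \<Longrightarrow> snd (f i) \<in> mpolys UNIV n"
      "\<And>i y. i < r \<Longrightarrow> y \<in> V \<Longrightarrow> meval (fst (f i)) y * meval (snd (\<nu> i)) y = meval (fst (\<nu> i)) y * meval (snd (f i)) y"
      "\<And>i. i < r \<Longrightarrow> meval (snd (f i)) a \<noteq> 0" "\<And>i. i < r \<Longrightarrow> c i = meval (fst (f i)) a / meval (snd (f i)) a"
      using f0 by blast+
    define q where "q = (\<Prod>i<r. snd (f i))"
    have q: "q \<in> mpolys UNIV n" unfolding q_def using f by (intro mpolys_UNIV_closed) auto
    have q_ev: "meval q y = (\<Prod>i<r. meval (snd (f i)) y)" for y by (simp add: q_def meval_simps)
    from clear_denominators[OF is_subring_UNIV mpolys_UNIV[OF p], of "\<lambda>i. fst (f i)" n "\<lambda>i. snd (f i)"] f(1,2)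
    obtain M where
      "\<exists>Q\<in>mpolys UNIV n. \<forall>y. (\<forall>i<r. meval (snd (f i)) y \<noteq> 0) \<longrightarrow>
        meval Q y = (\<Prod>i<r. meval (snd (f i)) y) ^ M * meval p (\<lambda>i. meval (fst (f i)) y / meval (snd (f i)) y)"
      by blast
    then obtain Q where Q: "Q \<in> mpolys UNIV n" "\<And>y. (\<forall>i<r. meval (snd (f i)) y \<noteq> 0) \<Longrightarrow>
        meval Q y = (\<Prod>i<r. meval (snd (f i)) y) ^ M * meval p (\<lambda>i. meval (fst (f i)) y / meval (snd (f i)) y)"
      by blast
    \<comment> \<open>Either some denominator vanishes at \<open>y\<close>, or both families of
      fractions have the same values there and the known relation applies.\<close>
    have "meval Q y * meval (den * q) y = 0" if y: "y \<in> V" for y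
    proof (cases "meval den y = 0 \<or> meval q y = 0")
      case True
      thus ?thesis by (auto simp: meval_simps)
    next
      case False
      hence nz: "\<forall>i<r. meval (snd (\<nu> i)) y \<noteq> 0" "\<forall>i<r. meval (snd (f i)) y \<noteq> 0"
        by (auto simp: den_ev q_ev)
      have "meval (fst (f i)) y / meval (snd (f i)) y = meval (fst (\<nu> i)) y / meval (snd (\<nu> i)) y" if "i < r" for i
        using nz f(3)[OF that y] that by (simp add: frac_eq_eq)
      hence "meval p (\<lambda>i. meval (fst (f i)) y / meval (snd (f i)) y) =
        meval p (\<lambda>i. meval (fst (\<nu> i)) y / meval (snd (\<nu> i)) y)"
        by (intro meval_cong[OF p])
      also have "\<dots> = 0" using P(2)[OF nz(1)] PV[OF y] nz by (auto simp: prod_zero_iff)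
      finally show ?thesis using Q(2)[OF nz(2)] by simp
    qed
    from irreducible_prime[OF V Q(1) _ this] have
      "(\<forall>y\<in>V. meval Q y = 0) \<or> (\<forall>y\<in>V. meval (den * q) y = 0)"
      using mpolys_UNIV[OF den] q by (auto intro: mpolys_UNIV_closed)
    \<comment> \<open>\<open>den\<close> is nonzero at \<open>x\<close> and \<open>q\<close> is
      nonzero at \<open>a\<close>, so by primeness their product does not vanish on all of
      \<open>V\<close>.\<close>
    moreover have "\<not> (\<forall>y\<in>V. meval (den * q) y = 0)"
    proof
      assume "\<forall>y\<in>V. meval (den * q) y = 0"
      hence "meval den y * meval q y = 0" if "y \<in> V" for y using that by (simp add: meval_simps)
      from irreducible_prime[OF V mpolys_UNIV[OF den] q this]
      have "meval den x = 0 \<or> meval q a = 0" using xV aV by blast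
      thus False using \<nu>'(3) f(4) by (auto simp: den_ev q_ev)
    qed
    ultimately have "meval Q a = 0" using aV by blast
    hence "meval p (\<lambda>i. meval (fst (f i)) a / meval (snd (f i)) a) = 0"
      using Q(2)[of a] f(4) by (auto simp: prod_zero_iff)
    also have "meval p (\<lambda>i. meval (fst (f i)) a / meval (snd (f i)) a) = meval p c"
      by (rule meval_cong[OF p]) (simp add: f(5))
    finally show ?thesis .
  qed
  have "{c. \<exists>a. rational_map_at n V r \<nu> a c} \<subseteq> zero_set r {p}"
    using image by (auto simp: zero_set_def rational_map_at_def)
  moreover have "zariski_closed r (zero_set r {p})"
    unfolding zariski_closed_def using mpolys_UNIV[OF p] by (intro exI[of _ "{p}"]) auto
  ultimately have "zariski_closure r {c. \<exists>a. rational_map_at n V r \<nu> a c} \<subseteq> zero_set r {p}"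
    unfolding zariski_closure_def by blast
  hence "meval p c = 0" if "c \<in> affine_space r" for c
    using dom that by (auto simp: dominating_def zero_set_def)
  thus "p = 0" using mpoly_nonzero_point[OF mpolys_UNIV[OF p]] by blast
qed


text \<open>The last coordinate is \<open>1 / h\<close>, so this affine variety is the open subset \<open>h \<noteq> 0\<close> of \<open>V\<close>.\<close>

definition open_part :: "nat \<Rightarrow> (nat \<Rightarrow> 'a::field) set \<Rightarrow> 'a mpoly \<Rightarrow> (nat \<Rightarrow> 'a) set" where
  "open_part n V h = {y \<in> affine_space (Suc n). y(n := 0) \<in> V \<and> y n * meval h y = 1}"

lemma meval_fun_upd: "(p :: 'a::comm_ring_1 mpoly) \<in> mpolys K n \<Longrightarrow> meval p (y(n := c)) = meval p y"
  by (erule meval_cong) auto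

lemma open_partI:
  assumes V: "V \<subseteq> affine_space n" and h: "h \<in> mpolys K n" and a: "a \<in> V" "meval h a \<noteq> 0"
  shows "a(n := 1 / meval h a) \<in> open_part n V h"
proof -
  have "a n = 0" using a V by (auto simp: affine_space_def)
  hence "a(n := 1 / meval h a, n := 0) = a" by auto
  thus ?thesis using a V by (auto simp: open_part_def meval_fun_upd[OF h] affine_space_def)
qed

lemma open_partD:
  assumes h: "h \<in> mpolys K n" and y: "y \<in> open_part n V h"
  shows "y(n := 0) \<in> V" "meval h (y(n := 0)) \<noteq> 0" "y = (y(n := 0))(n := 1 / meval h (y(n := 0)))"
proof -
  have y': "y(n := 0) \<in> V" "y n * meval h y = 1" using y by (auto simp: open_part_def)
  thus "y(n := 0) \<in> V" "meval h (y(n := 0)) \<noteq> 0" unfolding meval_fun_upd[OF h] by auto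
  show "y = (y(n := 0))(n := 1 / meval h (y(n := 0)))"
    unfolding meval_fun_upd[OF h] using y'(2) by (intro ext) (auto simp: eq_divide_eq)
qed

lemma open_part_clear:
  fixes K :: "'a::field set"
  assumes K: "is_subring K" and h: "h \<in> mpolys K n" and p: "p \<in> mpolys K (Suc n)"
  shows "\<exists>N0. \<forall>N\<ge>N0. \<exists>P\<in>mpolys K n. \<forall>a. meval h a \<noteq> 0 \<longrightarrow>
    meval P a = meval h a ^ N * meval p (a(n := 1 / meval h a))"
proof -
  \<comment> \<open>Numerators and denominators of the coordinates of the lifted point:
    \<open>y i / 1\<close> for \<open>i < n\<close>, and \<open>1 / h\<close> for the last
    one.\<close>
  define u where "u = (\<lambda>i. if i < n then mvar i else (1 :: 'a mpoly))"
  define v where "v = (\<lambda>i. if i < n then (1 :: 'a mpoly) else h)"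
  have uv: "u i \<in> mpolys K n" "v i \<in> mpolys K n" for i
    using h subring_one[OF K] by (auto simp: u_def v_def intro: mpolys_mvar subring_one[OF is_subring_mpolys[OF K]])
  have ev_v: "meval (v i) a = (if i < n then 1 else meval h a)" for i a
    by (simp add: v_def meval_simps)
  have 1: "(\<forall>i<Suc n. meval (v i) a \<noteq> 0) \<longleftrightarrow> meval h a \<noteq> 0" for a
    by (auto simp: ev_v less_Suc_eq)
  have 2: "(\<Prod>i<Suc n. meval (v i) a) = meval h a" for a
    by (simp add: ev_v)
  have 3: "meval p (\<lambda>i. meval (u i) a / meval (v i) a) = meval p (a(n := 1 / meval h a))" for a
    by (rule meval_cong[OF p]) (auto simp: u_def v_def meval_simps)
  show ?thesis using clear_denominators[OF K p, of u n v] uv unfolding 1 2 3 by blast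
qed

lemma open_part_irreducible:
  assumes V: "abs_irreducible n V" and h: "h \<in> mpolys UNIV n" and a: "a \<in> V" "meval h a \<noteq> 0"
  shows "abs_irreducible (Suc n) (open_part n V h)"
proof (rule abs_irreducibleI)
  obtain S where S: "S \<subseteq> mpolys UNIV n" "V = zero_set n S"
    using V by (auto simp: abs_irreducible_def zariski_closed_def)
  have Va: "V \<subseteq> affine_space n" using S zero_set_subset_affine by blast
  have hS: "h \<in> mpolys UNIV (Suc n)" "S \<subseteq> mpolys UNIV (Suc n)"
    using h S mpolys_mono[of UNIV UNIV n "Suc n"] by auto
  have "open_part n V h = zero_set (Suc n) (insert (mvar n * h - 1) S)"
  proof (intro Set.set_eqI iffI)
    fix y assume y: "y \<in> open_part n V h"
    have "meval p y = 0" if "p \<in> S" for p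
      using meval_fun_upd[of p UNIV n y 0] that S y by (auto simp: open_part_def zero_set_def)
    thus "y \<in> zero_set (Suc n) (insert (mvar n * h - 1) S)"
      using y by (auto simp: zero_set_def open_part_def meval_simps)
  next
    fix y assume y: "y \<in> zero_set (Suc n) (insert (mvar n * h - 1) S)"
    have "meval p (y(n := 0)) = 0" if "p \<in> S" for p
      using meval_fun_upd[of p UNIV n y 0] that S y by (auto simp: zero_set_def)
    moreover have "y(n := 0) \<in> affine_space n" using y by (auto simp: zero_set_def affine_space_def)
    ultimately show "y \<in> open_part n V h"
      using y by (auto simp: open_part_def S(2) zero_set_def meval_simps)
  qed
  moreover have "insert (mvar n * h - 1) S \<subseteq> mpolys UNIV (Suc n)"
    using hS by (auto intro!: mpolys_UNIV_closed mpolys_mvar)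
  ultimately show "zariski_closed (Suc n) (open_part n V h)" unfolding zariski_closed_def by blast
  show "open_part n V h \<noteq> {}" using open_partI[OF Va h a] by blast
  fix p q assume pq: "p \<in> mpolys UNIV (Suc n)" "q \<in> mpolys UNIV (Suc n)"
    and 0: "\<And>y. y \<in> open_part n V h \<Longrightarrow> meval p y * meval q y = 0"
  obtain N P where P: "P \<in> mpolys UNIV n" "\<And>a. meval h a \<noteq> 0 \<Longrightarrow>
    meval P a = meval h a ^ N * meval p (a(n := 1 / meval h a))"
    using open_part_clear[OF is_subring_UNIV h pq(1)] by blast
  obtain M Q where Q: "Q \<in> mpolys UNIV n" "\<And>a. meval h a \<noteq> 0 \<Longrightarrow>
    meval Q a = meval h a ^ M * meval q (a(n := 1 / meval h a))"
    using open_part_clear[OF is_subring_UNIV h pq(2)] by blast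
  \<comment> \<open>The factor \<open>h\<close> covers the points of \<open>V\<close> that have no
    counterpart on the open part.\<close>
  have "meval P y * meval (h * Q) y = 0" if "y \<in> V" for y
    using 0[OF open_partI[OF Va h that]] P(2)[of y] Q(2)[of y]
    by (cases "meval h y = 0") (auto simp: meval_mult)
  from irreducible_prime[OF V P(1) _ this] consider "\<forall>y\<in>V. meval P y = 0" | "\<forall>y\<in>V. meval (h * Q) y = 0"
    using h Q(1) by (auto intro: mpolys_UNIV_closed)
  thus "(\<forall>y\<in>open_part n V h. meval p y = 0) \<or> (\<forall>y\<in>open_part n V h. meval q y = 0)"
  proof cases
    case 1
    have "meval p y = 0" if "y \<in> open_part n V h" for y
      using open_partD[OF h that] 1 P(2)[of "y(n := 0)"] by auto
    thus ?thesis by blast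
  next
    case 2
    have "meval q y = 0" if "y \<in> open_part n V h" for y
      using open_partD[OF h that] 2 Q(2)[of "y(n := 0)"]
      by (auto simp: meval_mult)
    thus ?thesis by blast
  qed
qed

lemma open_part_descends:
  fixes K :: "'a::alg_closed_field set"
  assumes K: "is_subfield K" and Va: "V \<subseteq> affine_space n" and V: "descends K n V" and h: "h \<in> mpolys K n"
  shows "descends K (Suc n) (open_part n V h)"
  unfolding descends_def
proof (intro allI impI, elim conjE)
  note R = subfield_is_subring[OF K]
  fix B P assume B: "lin_indep K B" and P: "\<forall>d\<in>B. P d \<in> mpolys K (Suc n)"
    and 0: "\<forall>y\<in>open_part n V h. (\<Sum>d\<in>B. d * meval (P d) y) = 0"
  have "\<forall>d\<in>B. \<exists>N0. \<forall>N\<ge>N0. \<exists>Q\<in>mpolys K n. \<forall>a. meval h a \<noteq> 0 \<longrightarrow>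
    meval Q a = meval h a ^ N * meval (P d) (a(n := 1 / meval h a))"
    using P by (intro ballI open_part_clear[OF R h]) auto
  from bchoice[OF this] obtain N0 where N0: "\<And>d N. d \<in> B \<Longrightarrow> N \<ge> N0 d \<Longrightarrow>
    \<exists>Q\<in>mpolys K n. \<forall>a. meval h a \<noteq> 0 \<longrightarrow>
    meval Q a = meval h a ^ N * meval (P d) (a(n := 1 / meval h a))" by blast
  define N where "N = (\<Sum>d\<in>B. N0 d)"
  have "N0 d \<le> N" if "d \<in> B" for d unfolding N_def
    using that lin_indep_finite[OF B] by (intro member_le_sum) auto
  with N0 have "\<forall>d\<in>B. \<exists>Q. Q \<in> mpolys K n \<and> (\<forall>a. meval h a \<noteq> 0 \<longrightarrow>
    meval Q a = meval h a ^ N * meval (P d) (a(n := 1 / meval h a)))" by blast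
  from bchoice[OF this] obtain Q where Q: "\<And>d. d \<in> B \<Longrightarrow> Q d \<in> mpolys K n"
    "\<And>d a. d \<in> B \<Longrightarrow> meval h a \<noteq> 0 \<Longrightarrow>
      meval (Q d) a = meval h a ^ N * meval (P d) (a(n := 1 / meval h a))" by blast
  have hQ: "meval (h * Q d) a = meval h a * meval (Q d) a" for d a by (simp add: meval_simps)
  have "(\<Sum>d\<in>B. d * meval (h * Q d) y) = 0" if y: "y \<in> V" for y
  proof (cases "meval h y = 0")
    case True
    thus ?thesis by (simp add: hQ)
  next
    case False
    have "(\<Sum>d\<in>B. d * meval (h * Q d) y) =
      (\<Sum>d\<in>B. meval h y * meval h y ^ N * (d * meval (P d) (y(n := 1 / meval h y))))"
      using False by (intro sum.cong) (auto simp: hQ Q(2))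
    also have "\<dots> = meval h y * meval h y ^ N * (\<Sum>d\<in>B. d * meval (P d) (y(n := 1 / meval h y)))"
      by (simp only: sum_distrib_left)
    finally show ?thesis using 0 open_partI[OF Va h y False] by simp
  qed
  moreover have "h * Q d \<in> mpolys K n" if "d \<in> B" for d
    using that by (intro subring_mult[OF is_subring_mpolys[OF R]] h Q)
  ultimately have *: "meval (h * Q d) y = 0" if "d \<in> B" "y \<in> V" for d y
    using descendsD[OF V B, of "\<lambda>d. h * Q d"] that by blast
  show "\<forall>d\<in>B. \<forall>y\<in>open_part n V h. meval (P d) y = 0"
  proof (intro ballI)
    fix d y assume d: "d \<in> B" and y: "y \<in> open_part n V h"
    note y' = open_partD[OF h y]
    show "meval (P d) y = 0" using *[OF d y'(1)] y' Q(2)[OF d y'(2)] by (auto simp: hQ)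
  qed
qed

lemma open_part_generic:
  assumes K: "is_subring K" and Va: "V \<subseteq> affine_space n" and x: "generic_point K n V x"
    and h: "h \<in> mpolys K n" "meval h x \<noteq> 0"
  shows "generic_point K (Suc n) (open_part n V h) (x(n := 1 / meval h x))"
  unfolding generic_point_def
proof (intro conjI ballI impI)
  have xV: "x \<in> V" using x by (simp add: generic_point_def)
  show "x(n := 1 / meval h x) \<in> open_part n V h" by (rule open_partI[OF Va h(1) xV h(2)])
  fix p y assume p: "p \<in> mpolys K (Suc n)" "meval p (x(n := 1 / meval h x)) = 0"
    and y: "y \<in> open_part n V h"
  obtain N P where P: "P \<in> mpolys K n" "\<And>a. meval h a \<noteq> 0 \<Longrightarrow>
    meval P a = meval h a ^ N * meval p (a(n := 1 / meval h a))"
    using open_part_clear[OF K h(1) p(1)] by blast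
  have "meval P x = 0" using P(2)[OF h(2)] p by simp
  hence "meval P (y(n := 0)) = 0" using x P(1) open_partD[OF h(1) y] by (auto simp: generic_point_def)
  thus "meval p y = 0" using P(2)[of "y(n := 0)"] open_partD[OF h(1) y] by auto
qed

lemma open_part_function_field:
  assumes K: "is_subfield K" and h: "h \<in> mpolys K n"
  shows "function_field K (Suc n) (x(n := 1 / meval h x)) = function_field K n x"
proof
  note R = subfield_is_subring[OF K]
  have "meval h x \<in> gen (K \<union> x ` {..<n})" using meval_image_eq_gen[OF R, of x n] h by blast
  hence "1 / meval h x \<in> adjoin K (x ` {..<n})"
    using gen_subset_adjoin[of K "x ` {..<n}"] subfield_inverse[OF is_subfield_adjoin, of "meval h x"]
    by (auto simp: divide_inverse)
  thus "function_field K (Suc n) (x(n := 1 / meval h x)) \<subseteq> function_field K n x"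
    unfolding function_field_def using adjoin_generators[of "x ` {..<n}" K]
    by (intro adjoin_least[OF is_subfield_adjoin adjoin_base]) auto
  have "x ` {..<n} \<subseteq> x(n := 1 / meval h x) ` {..<Suc n}"
    by (force intro: image_eqI)
  thus "function_field K n x \<subseteq> function_field K (Suc n) (x(n := 1 / meval h x))"
    unfolding function_field_def by (intro adjoin_mono) auto
qed

lemma separable_has_trdeg:
  assumes t: "alg_independent K r t" and sep: "separable_algebraic_extension (adjoin K (t ` {..<r})) E"
  shows "has_trdeg K E r"
  unfolding has_trdeg_def
proof (intro exI[of _ t] conjI ballI t)
  show "t ` {..<r} \<subseteq> E"
    using sep adjoin_generators[of "t ` {..<r}" K]
    by (auto simp: separable_algebraic_extension_def field_extension_def)
  fix a assume "a \<in> E"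
  hence "separable_over (adjoin K (t ` {..<r})) a" using sep by (simp add: separable_algebraic_extension_def)
  thus "algebraic_over (adjoin K (t ` {..<r})) a"
    unfolding algebraic_over_iff by (intro simple_root_algebraic separable_over_imp_simple_root)
qed

text \<open>The PAC property is applied to the open part where \<open>g\<close> and all denominators
  of the map are nonzero. It is again irreducible, defined over the same field and has the same
  function field, and its rational points avoid the zeros of \<open>g\<close>. At such a point the
  value of the map is computed by the given fractions.\<close>

lemma pac_specialization:
  fixes K\<^sub>1 K\<^sub>2 :: "'a::alg_closed_field set"
  assumes pac: "pac_in_domain K\<^sub>1 K\<^sub>2" and K: "is_subfield K\<^sub>2" and r: "r \<ge> 1"
    and V: "abs_irreducible n V" "defined_over K\<^sub>2 n V" and \<nu>: "rational_map K\<^sub>2 n V r \<nu>" "dominating n V r \<nu>"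
    and x: "generic_point K\<^sub>2 n V x"
    and sep: "separable_algebraic_extension
       (adjoin K\<^sub>2 ((\<lambda>i. meval (fst (\<nu> i)) x / meval (snd (\<nu> i)) x) ` {..<r})) (function_field K\<^sub>2 n x)"
    and g: "g \<in> mpolys K\<^sub>2 n" "meval g x \<noteq> 0"
  shows "\<exists>a\<in>V. (\<forall>i. a i \<in> K\<^sub>2) \<and> meval g a \<noteq> 0 \<and>
    (\<forall>i<r. meval (snd (\<nu> i)) a \<noteq> 0 \<and> meval (fst (\<nu> i)) a / meval (snd (\<nu> i)) a \<in> K\<^sub>1)"
proof -
  note R = subfield_is_subring[OF K]
  have \<nu>': "fst (\<nu> i) \<in> mpolys K\<^sub>2 n" "snd (\<nu> i) \<in> mpolys K\<^sub>2 n" "meval (snd (\<nu> i)) x \<noteq> 0" if "i < r" for i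
    using \<nu> that generic_point_nonzero[OF x] by (auto simp: rational_map_def)
  have xV: "x \<in> V" using x by (simp add: generic_point_def)
  have Va: "V \<subseteq> affine_space n"
    using V(1) zero_set_subset_affine by (auto simp: abs_irreducible_def zariski_closed_def)
  define t where "t = (\<lambda>i. meval (fst (\<nu> i)) x / meval (snd (\<nu> i)) x)"
  have t: "alg_independent K\<^sub>2 r t" unfolding t_def by (rule dominatingD[OF K V(1) x \<nu>])
  define h where "h = g * (\<Prod>i<r. snd (\<nu> i))"
  have h_ev: "meval h y = meval g y * (\<Prod>i<r. meval (snd (\<nu> i)) y)" for y
    by (simp add: h_def meval_simps)
  have h: "h \<in> mpolys K\<^sub>2 n" unfolding h_def
    using g \<nu>' by (intro subring_mult[OF is_subring_mpolys[OF R]] subring_prod[OF is_subring_mpolys[OF R]]) auto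
  have hx: "meval h x \<noteq> 0" using g \<nu>' by (simp add: h_ev)
  define W where "W = open_part n V h"
  define w where "w = x(n := 1 / meval h x)"
  have w: "generic_point K\<^sub>2 (Suc n) W w" unfolding W_def w_def by (rule open_part_generic[OF R Va x h hx])
  have desc: "descends K\<^sub>2 (Suc n) W" unfolding W_def
    by (rule open_part_descends[OF K Va defined_over_imp_descends[OF K V(2)] h])
  have W: "abs_irreducible (Suc n) W" unfolding W_def
    by (rule open_part_irreducible[OF V(1) mpolys_UNIV[OF h] xV hx])
  have ff: "function_field K\<^sub>2 (Suc n) w = function_field K\<^sub>2 n x"
    unfolding w_def by (rule open_part_function_field[OF K h])
  have \<nu>Suc: "fst (\<nu> i) \<in> mpolys K\<^sub>2 (Suc n)" "snd (\<nu> i) \<in> mpolys K\<^sub>2 (Suc n)" if "i < r" for i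
    using \<nu>'[OF that] mpolys_mono[of K\<^sub>2 K\<^sub>2 n "Suc n"] by auto
  have \<nu>w: "meval (fst (\<nu> i)) w = meval (fst (\<nu> i)) x" "meval (snd (\<nu> i)) w = meval (snd (\<nu> i)) x" if "i < r" for i
    unfolding w_def using \<nu>'[OF that] by (auto simp: meval_fun_upd)
  have tw: "(\<lambda>i. meval (fst (\<nu> i)) w / meval (snd (\<nu> i)) w) ` {..<r} = t ` {..<r}"
    by (intro image_cong) (auto simp: \<nu>w t_def)
  have tw': "alg_independent K\<^sub>2 r (\<lambda>i. meval (fst (\<nu> i)) w / meval (snd (\<nu> i)) w)"
  proof -
    have "meval p (\<lambda>i. meval (fst (\<nu> i)) w / meval (snd (\<nu> i)) w) = meval p t" if "p \<in> mpolys K\<^sub>2 r" for p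
      by (rule meval_cong[OF that]) (auto simp: \<nu>w t_def)
    thus ?thesis using t by (simp add: alg_independent_def)
  qed
  have rat: "rational_map K\<^sub>2 (Suc n) W r \<nu>"
  proof -
    have "snd (\<nu> i) \<notin> vanishing_ideal K\<^sub>2 (Suc n) W" if "i < r" for i
    proof
      assume "snd (\<nu> i) \<in> vanishing_ideal K\<^sub>2 (Suc n) W"
      moreover have "w \<in> W" using w by (simp add: generic_point_def)
      ultimately have "meval (snd (\<nu> i)) w = 0" by (simp add: vanishing_ideal_def)
      thus False using \<nu>w(2)[OF that] \<nu>'(3)[OF that] by simp
    qed
    thus ?thesis unfolding rational_map_def using \<nu>Suc by blast
  qed
  have sepW: "separable_algebraic_extension (adjoin K\<^sub>2 (t ` {..<r})) (function_field K\<^sub>2 (Suc n) w)"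
    using sep by (simp add: ff t_def)
  have "has_dimension K\<^sub>2 (Suc n) W r"
    unfolding has_dimension_def using w separable_has_trdeg[OF t sepW] by blast
  moreover have "separable_map K\<^sub>2 (Suc n) W r \<nu>"
    unfolding separable_map_def using w sepW tw by auto
  moreover have "dominating (Suc n) W r \<nu>" by (rule dominatingI[OF K desc w rat tw'])
  ultimately obtain a c where a: "a \<in> rational_points K\<^sub>2 W" "rational_map_at (Suc n) W r \<nu> a c"
    "\<And>i. i < r \<Longrightarrow> c i \<in> K\<^sub>1"
    using pac r W descends_imp_defined_over[OF K desc] rat unfolding pac_in_domain_def by blast
  have aW: "a \<in> W" using a by (simp add: rational_points_def)
  note a' = open_partD[OF h, of a V, folded W_def, OF aW]
  have nz: "meval g (a(n := 0)) \<noteq> 0" "\<And>i. i < r \<Longrightarrow> meval (snd (\<nu> i)) (a(n := 0)) \<noteq> 0"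
    using a'(2) by (auto simp: h_ev)
  show ?thesis
  proof (intro bexI[of _ "a(n := 0)"] conjI allI impI)
    show "a(n := 0) \<in> V" by (fact a')
    show "(a(n := 0)) i \<in> K\<^sub>2" for i using a subring_zero[OF R] by (auto simp: rational_points_def)
    show "meval g (a(n := 0)) \<noteq> 0" by (fact nz)
    fix i assume i: "i < r"
    show "meval (snd (\<nu> i)) (a(n := 0)) \<noteq> 0" by (rule nz(2)[OF i])
    have e: "meval (fst (\<nu> i)) (a(n := 0)) = meval (fst (\<nu> i)) a" "meval (snd (\<nu> i)) (a(n := 0)) = meval (snd (\<nu> i)) a"
      using \<nu>'[OF i] by (auto simp: meval_fun_upd)
    have "rational_fun_at (Suc n) W (\<nu> i) a (c i)" using a(2) i by (simp add: rational_map_at_def)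
    from rational_fun_at_value[OF this aW] nz(2)[OF i] a(3)[OF i]
    show "meval (fst (\<nu> i)) (a(n := 0)) / meval (snd (\<nu> i)) (a(n := 0)) \<in> K\<^sub>1" by (simp add: e)
  qed
qed

section \<open>Power series\<close>

text \<open>Power series in \<open>r\<close> variables \<open>t - b\<close> are modelled by series in one variable \<open>s\<close> whose
  coefficients are polynomials in \<open>S\<^sub>0, S\<^sub>1, \<dots>\<close>, via \<open>t\<^sub>i = b\<^sub>i + S\<^sub>i s\<close>.\<close>

definition kap :: "'a::comm_ring_1 \<Rightarrow> 'a mpoly fps" where
  "kap c = fps_const (mconst c)"

definition series_over :: "'a::comm_ring_1 set \<Rightarrow> 'a mpoly fps set" where
  "series_over K = {g. \<forall>k m. coef (fps_nth g k) m \<in> K}"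

definition shifted_var :: "(nat \<Rightarrow> 'a::comm_ring_1) \<Rightarrow> nat \<Rightarrow> 'a mpoly fps" where
  "shifted_var b i = kap (b i) + fps_const (mvar i) * fps_X"

lemma kap_hom: "hom_on S kap"
  by (simp add: hom_on_def kap_def single_diff mult_single)

lemma kap_simps:
  "kap 0 = 0" "kap 1 = 1" "kap (a + b) = kap a + kap b" "kap (a - b) = kap a - kap b"
  "kap (a * b) = kap a * kap b" "kap (- a) = - kap a" "kap (a ^ n) = kap a ^ n"
  by (rule hom_UNIV_simps[OF kap_hom])+

lemma kap_eq_0_iff [simp]: "kap c = 0 \<longleftrightarrow> c = 0"
proof
  assume "kap c = 0"
  hence "coef (fps_nth (kap c) 0) 0 = 0" by simp
  thus "c = 0" by (simp add: kap_def)
qed (simp add: kap_simps)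

lemma coef_kap_mult: "coef (fps_nth (kap (c :: 'a::idom) * g) k) m = c * coef (fps_nth g k) m"
  by (simp add: kap_def coef_mconst_mult)

lemma mpoly_in_mpolys: "(\<And>m. coef p m \<in> K) \<Longrightarrow> \<exists>n. p \<in> mpolys K n"
  by (rule exI[of _ "Suc (Max (\<Union>m\<in>Poly_Mapping.keys p. Poly_Mapping.keys m))"])
     (auto simp: mpolys_def intro!: le_imp_less_Suc Max_ge)

lemma coef_mult_closed:
  assumes K: "is_subring K" and "\<And>m. coef p m \<in> K" "\<And>m. coef q m \<in> K"
  shows "coef (p * q) m \<in> K"
proof -
  obtain i j where "p \<in> mpolys K i" "q \<in> mpolys K j" using mpoly_in_mpolys assms by metis
  hence "p \<in> mpolys K (i + j)" "q \<in> mpolys K (i + j)"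
    using mpolys_mono[of K K i "i + j"] mpolys_mono[of K K j "i + j"] by auto
  hence "p * q \<in> mpolys K (i + j)" by (rule subring_mult[OF is_subring_mpolys[OF K]])
  thus ?thesis using mpolys_coef[OF subring_zero[OF K]] by blast
qed

lemma is_subring_series_over:
  assumes K: "is_subring K"
  shows "is_subring (series_over K)"
proof (rule is_subringI)
  show "1 \<in> series_over K"
    by (auto simp: series_over_def lookup_one when_def intro: subring_closed[OF K])
  fix a b assume ab: "a \<in> series_over K" "b \<in> series_over K"
  thus "a - b \<in> series_over K"
    by (auto simp: series_over_def lookup_minus intro: subring_closed[OF K])
  show "a * b \<in> series_over K" using ab
    by (auto simp: series_over_def fps_mult_nth lookup_sum intro!: subring_sum[OF K] coef_mult_closed[OF K])
qed

lemma kap_series_over: "is_subring K \<Longrightarrow> c \<in> K \<Longrightarrow> kap c \<in> series_over K"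
  by (auto simp: series_over_def kap_def lookup_single when_def intro: subring_zero)

lemma shifted_var_series_over:
  assumes K: "is_subring K" and b: "b i \<in> K"
  shows "shifted_var b i \<in> series_over K"
proof -
  have "fps_const (mvar i) \<in> series_over K" "fps_X \<in> series_over K"
    using subring_zero[OF K] subring_one[OF K]
    by (auto simp: series_over_def mvar_def lookup_single when_def fps_X_def lookup_one)
  thus ?thesis unfolding shifted_var_def
    by (intro subring_add[OF is_subring_series_over[OF K]] subring_mult[OF is_subring_series_over[OF K]]
        kap_series_over[OF K] b)
qed

text \<open>The coefficient of each monomial gives a \<open>K\<close>-linear relation among the
  elements of \<open>B\<close>. This linear disjointness is the source of the absolute
  irreducibility of the loci below.\<close>

lemma series_lin_indep:
  assumes B: "lin_indep K B" and g: "\<And>d. d \<in> B \<Longrightarrow> g d \<in> series_over K"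
    and 0: "(\<Sum>d\<in>B. kap d * g d) = 0" and d: "d \<in> B"
  shows "g d = 0"
proof -
  have "coef (fps_nth (g d) k) m = 0" for k m
  proof -
    have "(\<Sum>d\<in>B. coef (fps_nth (g d) k) m * d) = coef (fps_nth (\<Sum>d\<in>B. kap d * g d) k) m"
      unfolding fps_sum_nth lookup_sum coef_kap_mult by (simp add: mult.commute)
    hence "(\<Sum>d\<in>B. coef (fps_nth (g d) k) m * d) = 0" using 0 by simp
    from lin_indepD[OF B _ this d] show ?thesis using g by (auto simp: series_over_def)
  qed
  thus ?thesis by (intro fps_ext poly_mapping_eqI) simp
qed

lemma fps_const_prod: "fps_const (\<Prod>i\<in>I. f i :: 'a::comm_ring_1) = (\<Prod>i\<in>I. fps_const (f i))"
  by (induction I rule: infinite_finite_induct) (auto simp flip: fps_const_mult)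

text \<open>After translation of \<open>b\<close> to the origin, a monomial \<open>m\<close> becomes
  itself times \<open>s\<close> to the total degree of \<open>m\<close>. Distinct monomials are then
  separated by the power of \<open>s\<close> or by the coefficient, so the translated polynomial is
  0, and translating back gives \<open>p = 0\<close>.\<close>

lemma shifted_var_independent:
  fixes p :: "'a::idom mpoly"
  assumes 0: "ev kap p (shifted_var b) = 0"
  shows "p = 0"
proof -
  define p' where "p' = ev mconst p (\<lambda>i. mconst (b i) + mvar i)"
  define s :: "nat \<Rightarrow> 'a mpoly fps" where "s = (\<lambda>i. fps_const (mvar i) * fps_X)"
  define deg where "deg = (\<lambda>m :: nat \<Rightarrow>\<^sub>0 nat. \<Sum>i\<in>Poly_Mapping.keys m. Poly_Mapping.lookup m i)"
  have "ev kap p' s = ev kap p (shifted_var b)"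
    unfolding p'_def ev_substitute[OF kap_hom] s_def
    by (simp add: ev_add[OF kap_hom] ev_single[OF kap_hom] ev_mvar[OF kap_hom] shifted_var_def[abs_def])
  hence 0: "ev kap p' s = 0" using 0 by simp
  have mon: "monom_eval m mvar = Poly_Mapping.single m (1 :: 'a)" for m
    using ev_mconst_mvar[of "Poly_Mapping.single m (1 :: 'a)"] ev_single[OF mconst_hom, of m "1 :: 'a" mvar] by simp
  have "monom_eval m s = fps_const (Poly_Mapping.single m 1) * fps_X ^ deg m" for m
  proof -
    have "monom_eval m s = fps_const (monom_eval m mvar) * fps_X ^ deg m"
      by (simp add: monom_eval_def s_def power_mult_distrib prod.distrib deg_def fps_const_prod power_sum)
    thus ?thesis by (simp add: mon)
  qed
  hence "ev kap p' s = (\<Sum>m\<in>Poly_Mapping.keys p'. fps_const (Poly_Mapping.single m (coef p' m)) * fps_X ^ deg m)"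
    by (simp add: ev_def kap_def mult.assoc[symmetric] mult_single)
  hence nth: "fps_nth (ev kap p' s) k =
    (\<Sum>m\<in>Poly_Mapping.keys p'. if deg m = k then Poly_Mapping.single m (coef p' m) else 0)" for k
    by (simp only: fps_sum_nth fps_X_power_mult_right_nth) (auto intro!: sum.cong)
  have "coef p' m = 0" for m
  proof (rule ccontr)
    assume nz: "coef p' m \<noteq> 0"
    have "0 = coef (fps_nth (ev kap p' s) (deg m)) m" using 0 by simp
    also have "\<dots> = (\<Sum>m'\<in>Poly_Mapping.keys p'. if m' = m then coef p' m' else 0)"
      unfolding nth lookup_sum by (intro sum.cong) (auto simp: lookup_single when_def)
    also have "\<dots> = coef p' m" using nz by (simp add: in_keys_iff)
    finally show False using nz by simp
  qed
  hence p': "p' = 0" by (intro poly_mapping_eqI) simp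
  have "p = ev mconst p mvar" by (simp add: ev_mconst_mvar)
  also have "\<dots> = ev mconst p' (\<lambda>i. mvar i - mconst (b i))"
    unfolding p'_def ev_substitute[OF mconst_hom]
    by (simp add: ev_add[OF mconst_hom] ev_single[OF mconst_hom] ev_mvar[OF mconst_hom])
  finally show ?thesis by (simp add: p' ev_zero[OF mconst_hom])
qed

lemma nth_0_hom: "hom_on S (\<lambda>g :: 'a::comm_ring_1 fps. fps_nth g 0)"
  by (simp add: hom_on_def fps_mult_nth)

lemma X_power_dvd_iff: "fps_X ^ k dvd (g :: 'a::comm_ring_1 fps) \<longleftrightarrow> (\<forall>j<k. fps_nth g j = 0)"
proof
  assume "fps_X ^ k dvd g"
  thus "\<forall>j<k. fps_nth g j = 0" by (auto elim!: dvdE simp: fps_X_power_mult_nth)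
next
  assume *: "\<forall>j<k. fps_nth g j = 0"
  have "g = fps_X ^ k * fps_shift k g"
    by (rule fps_ext) (use * in \<open>auto simp: fps_X_power_mult_nth\<close>)
  thus "fps_X ^ k dvd g" by (metis dvd_triv_left)
qed

lemma poly_taylor:
  fixes f :: "'a::idom poly"
  shows "\<exists>w. poly f (x + e) = poly f x + e * poly (pderiv f) x + e\<^sup>2 * w"
proof (induction f)
  case 0
  show ?case by (intro exI[of _ 0]) simp
next
  case (pCons a f)
  from pCons.IH obtain w where w: "poly f (x + e) = poly f x + e * poly (pderiv f) x + e\<^sup>2 * w" ..
  show ?case
    by (intro exI[of _ "poly (pderiv f) x + (x + e) * w"])
       (simp add: w pderiv_pCons, simp add: algebra_simps power2_eq_square)
qed

text \<open>The derivative is required to have a scalar constant term \<open>u\<close>, because the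
  coefficients of the series are polynomials and a nonscalar one would not be invertible.\<close>

theorem series_hensel:
  fixes K :: "'a::field set"
  assumes K: "is_subfield K" and f: "f \<in> pol (series_over K)" and c: "c \<in> K"
    and root: "fps_nth (poly f (kap c)) 0 = 0"
    and simple: "fps_nth (poly (pderiv f) (kap c)) 0 = mconst u" "u \<in> K" "u \<noteq> 0"
  shows "\<exists>\<zeta>\<in>series_over K. poly f \<zeta> = 0 \<and> fps_nth \<zeta> 0 = mconst c"
proof -
  note R = subfield_is_subring[OF K]
  note S = is_subring_series_over[OF R]
  \<comment> \<open>Newton iteration with the slope frozen at \<open>u\<close>. It gains one order
    of \<open>s\<close> per step, which suffices, and needs no inverse of a series, so the
    coefficients stay in \<open>K\<close>.\<close>
  define \<xi> where "\<xi> = rec_nat (kap c) (\<lambda>_ g. g - kap (1 / u) * poly f g)"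
  have \<xi>: "\<xi> 0 = kap c" "\<And>k. \<xi> (Suc k) = \<xi> k - kap (1 / u) * poly f (\<xi> k)" by (auto simp: \<xi>_def)
  have u: "1 / u \<in> K" using subfield_divide[OF K subring_one[OF R] simple(2)] .
  have \<xi>_in: "\<xi> k \<in> series_over K" for k
    by (induction k)
       (auto simp: \<xi> intro!: kap_series_over[OF R] c u subring_diff[OF S] subring_mult[OF S] poly_in_subring[OF S f])
  have nth0: "fps_nth (poly g x) 0 = poly (map_poly (\<lambda>g. fps_nth g 0) g) (fps_nth x 0)" for g and x :: "'a mpoly fps"
    by (rule hom_on_poly[OF is_subring_UNIV nth_0_hom]) (auto simp: pol_def)
  have main: "fps_nth (\<xi> k) 0 = mconst c \<and> fps_X ^ Suc k dvd poly f (\<xi> k)" for k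
  proof (induction k)
    case 0
    have "fps_X ^ 1 dvd poly f (kap c)" unfolding X_power_dvd_iff using root by simp
    thus ?case by (simp add: \<xi> kap_def)
  next
    case (Suc k)
    let ?F = "poly f (\<xi> k)" and ?v = "kap (1 / u)"
    have F0: "fps_nth ?F 0 = 0" using Suc X_power_dvd_iff[of "Suc k" ?F] by blast
    obtain w where "poly f (\<xi> k + - (?v * ?F)) = ?F + - (?v * ?F) * poly (pderiv f) (\<xi> k) + (- (?v * ?F))\<^sup>2 * w"
      using poly_taylor by blast
    \<comment> \<open>The second factor has constant term \<open>1 - (1 / u) * u = 0\<close>, so the
      order of vanishing rises by at least one.\<close>
    hence step: "poly f (\<xi> (Suc k)) = ?F * (1 - ?v * poly (pderiv f) (\<xi> k) + ?F * (?v\<^sup>2 * w))"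
      by (simp add: \<xi> algebra_simps power2_eq_square)
    have "fps_nth (poly (pderiv f) (\<xi> k)) 0 = mconst u"
      using simple(1) Suc unfolding nth0 by (simp add: kap_def)
    hence "fps_nth (1 - ?v * poly (pderiv f) (\<xi> k) + ?F * (?v\<^sup>2 * w)) 0 = 0"
      using F0 simple(3) by (simp add: fps_mult_nth kap_def mult_single)
    hence "fps_X ^ 1 dvd (1 - ?v * poly (pderiv f) (\<xi> k) + ?F * (?v\<^sup>2 * w))"
      unfolding X_power_dvd_iff by simp
    hence "fps_X ^ Suc k * fps_X ^ 1 dvd poly f (\<xi> (Suc k))"
      unfolding step using Suc by (intro mult_dvd_mono) auto
    moreover have "fps_nth (\<xi> (Suc k)) 0 = mconst c" using Suc F0 by (simp add: \<xi> fps_mult_nth)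
    ultimately show ?case by (simp add: mult.commute)
  qed
  have stable: "fps_nth (\<xi> (i + j)) j = fps_nth (\<xi> j) j" for i j
  proof (induction i)
    case (Suc i)
    have "fps_X ^ Suc (i + j) dvd kap (1 / u) * poly f (\<xi> (i + j))" using main[of "i + j"] by simp
    hence "fps_nth (kap (1 / u) * poly f (\<xi> (i + j))) j = 0" unfolding X_power_dvd_iff by auto
    thus ?case using Suc by (simp add: \<xi>)
  qed simp
  \<comment> \<open>The limit, read off diagonally: the coefficient of \<open>s^j\<close> no longer
    changes from \<open>\<xi> j\<close> on.\<close>
  define \<zeta> where "\<zeta> = Abs_fps (\<lambda>j. fps_nth (\<xi> j) j)"
  have close: "fps_X ^ Suc k dvd \<zeta> - \<xi> k" for k
    unfolding X_power_dvd_iff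
  proof (intro allI impI)
    fix j assume "j < Suc k"
    thus "fps_nth (\<zeta> - \<xi> k) j = 0" using stable[of "k - j" j] by (simp add: \<zeta>_def)
  qed
  have "fps_X ^ Suc k dvd poly f \<zeta>" for k
  proof -
    obtain w where "poly f (\<xi> k + (\<zeta> - \<xi> k)) =
      poly f (\<xi> k) + (\<zeta> - \<xi> k) * poly (pderiv f) (\<xi> k) + (\<zeta> - \<xi> k)\<^sup>2 * w" using poly_taylor by blast
    hence "poly f \<zeta> = poly f (\<xi> k) + (\<zeta> - \<xi> k) * (poly (pderiv f) (\<xi> k) + (\<zeta> - \<xi> k) * w)"
      by (simp add: algebra_simps power2_eq_square)
    thus ?thesis using main[of k] close[of k] by (metis dvd_add dvd_mult2)
  qed
  hence "poly f \<zeta> = 0" unfolding X_power_dvd_iff by (intro fps_ext) auto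
  moreover have "\<zeta> \<in> series_over K" using \<xi>_in by (auto simp: series_over_def \<zeta>_def)
  moreover have "fps_nth \<zeta> 0 = mconst c" by (simp add: \<zeta>_def \<xi> kap_def)
  ultimately show ?thesis by blast
qed

text \<open>Taking the constant term is the specialization \<open>s = 0\<close>, which sends the
  \<open>i\<close>-th parameter to \<open>b i\<close>.\<close>

lemma nth_0_ev_shifted_var:
  "fps_nth (ev kap p (shifted_var b)) 0 = mconst (meval (p :: 'a::comm_ring_1 mpoly) b)"
proof -
  obtain n where p: "p \<in> mpolys UNIV n" using mpoly_in_mpolys[of p UNIV] by auto
  have "fps_nth (ev kap p (shifted_var b)) 0 = ev (\<lambda>c. fps_nth (kap c) 0) p (\<lambda>i. fps_nth (shifted_var b i) 0)"
    by (rule hom_on_ev[OF is_subring_UNIV nth_0_hom p]) auto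
  also have "\<dots> = ev mconst p (\<lambda>i. mconst (b i))"
    by (rule ev_cong[OF p]) (auto simp: kap_def shifted_var_def fps_mult_nth)
  also have "\<dots> = mconst (ev (\<lambda>c. c) p b)"
    by (rule hom_on_ev[OF is_subring_UNIV mconst_hom p, symmetric]) auto
  finally show ?thesis by (simp add: meval_eq_ev)
qed

section \<open>The locus of a tuple of power series\<close>

text \<open>The variety having the tuple \<open>w\<close> as a generic point in the sense of its
  relations. The equations are taken over \<open>K\<close> only; that relations over the ambient
  field hold as well is a consequence of linear disjointness.\<close>

definition series_locus :: "'a::alg_closed_field set \<Rightarrow> nat \<Rightarrow> (nat \<Rightarrow> 'a mpoly fps) \<Rightarrow> (nat \<Rightarrow> 'a) set" where
  "series_locus K m w = zero_set m {p \<in> mpolys K m. ev kap p w = 0}"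

text \<open>By \<open>hom_extension\<close> over the constants, some homomorphism on the ring
  generated by \<open>w\<close> does not kill the value of \<open>p\<close>; the images of the
  \<open>w i\<close> are the coordinates of the point.\<close>

lemma series_nullstellensatz:
  fixes p :: "'a::alg_closed_field mpoly"
  assumes p: "p \<in> mpolys UNIV m" "ev kap p w \<noteq> 0"
  shows "\<exists>a\<in>series_locus K m w. meval p a \<noteq> 0"
proof -
  define A :: "'a mpoly fps set" where "A = range kap"
  have A: "is_subring A" unfolding A_def
    by (rule is_subringI) (auto simp flip: kap_simps)
  \<comment> \<open>The constant coefficient of the constant term, which inverts \<open>kap\<close>
    on the constants.\<close>
  define \<phi> :: "'a mpoly fps \<Rightarrow> 'a" where "\<phi> = (\<lambda>g. coef (fps_nth g 0) 0)"
  have \<phi>_kap: "\<phi> (kap c) = c" for c by (simp add: \<phi>_def kap_def)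
  have \<phi>: "hom_on A \<phi>" unfolding A_def
    by (rule hom_onI) (auto simp: \<phi>_kap simp flip: kap_simps)
  have G: "gen (w ` {..<m} \<union> A) = (\<lambda>p. ev kap p w) ` mpolys UNIV m"
    unfolding A_def Un_commute[of "w ` {..<m}"]
    by (rule ev_image_eq_gen[OF is_subring_UNIV kap_hom, symmetric])
  have pG: "ev kap p w \<in> gen (w ` {..<m} \<union> A)" unfolding G using p by blast
  from hom_extension[OF A _ pG p(2), where ?'b = 'a] obtain v where
    v: "v \<in> A" "v \<noteq> 0" "\<And>\<phi> :: _ \<Rightarrow> 'a. hom_on A \<phi> \<and> \<phi> v \<noteq> 0 \<Longrightarrow>
     (\<exists>\<psi>. hom_on (gen (w ` {..<m} \<union> A)) \<psi> \<and> (\<forall>a\<in>A. \<psi> a = \<phi> a) \<and> \<psi> (ev kap p w) \<noteq> 0)" by blast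
  have "\<phi> v \<noteq> 0" using v by (auto simp: A_def \<phi>_kap)
  then obtain \<psi> where \<psi>: "hom_on (gen (w ` {..<m} \<union> A)) \<psi>" "\<And>a. a \<in> A \<Longrightarrow> \<psi> a = \<phi> a"
    "\<psi> (ev kap p w) \<noteq> 0" using v \<phi> by blast
  define c where "c = (\<lambda>i. if i < m then \<psi> (w i) else 0)"
  have ev_c: "meval q c = \<psi> (ev kap q w)" if q: "q \<in> mpolys UNIV m" for q
  proof -
    have "\<psi> (ev kap q w) = ev (\<lambda>c. \<psi> (kap c)) q (\<lambda>i. \<psi> (w i))"
      using gen_superset[of "w ` {..<m} \<union> A"]
      by (intro hom_on_ev[OF is_subring_gen \<psi>(1) q]) (auto simp: A_def)
    also have "\<dots> = meval q c" unfolding meval_eq_ev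
      by (rule ev_cong[OF q]) (auto simp: c_def \<psi>(2) A_def \<phi>_kap)
    finally show ?thesis by simp
  qed
  have "c \<in> affine_space m" by (simp add: c_def affine_space_def)
  hence "c \<in> series_locus K m w"
  proof -
    have "meval q c = 0" if "q \<in> mpolys K m" "ev kap q w = 0" for q
      using ev_c[OF mpolys_UNIV[OF that(1)]] that(2) hom_on_zero[OF is_subring_gen \<psi>(1)] by simp
    thus ?thesis using \<open>c \<in> affine_space m\<close> by (auto simp: series_locus_def zero_set_def)
  qed
  thus ?thesis using ev_c[OF p(1)] \<psi>(3) by (intro bexI[of _ c]) auto
qed

context
  fixes K :: "'a::alg_closed_field set" and m :: nat and w :: "nat \<Rightarrow> 'a mpoly fps"
  assumes K: "is_subfield K" and w: "\<And>i. i < m \<Longrightarrow> w i \<in> series_over K"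
begin

lemma series_locus_component:
  assumes B: "lin_indep K B" and P: "\<And>d. d \<in> B \<Longrightarrow> P d \<in> mpolys K m"
    and 0: "(\<Sum>d\<in>B. kap d * ev kap (P d) w) = 0" and d: "d \<in> B"
  shows "ev kap (P d) w = 0"
proof (rule series_lin_indep[OF B _ 0 d])
  fix d assume "d \<in> B"
  note R = subfield_is_subring[OF K]
  show "ev kap (P d) w \<in> series_over K"
    by (rule ev_in_subring[OF is_subring_series_over[OF R] P[OF \<open>d \<in> B\<close>]]) (use w kap_series_over[OF R] in auto)
qed

text \<open>A relation over the ambient field splits into components that are relations over
  \<open>K\<close>, hence equations of the locus; the converse is the Nullstellensatz. So the full
  vanishing ideal is the kernel of evaluation at \<open>w\<close>, which is prime because series
  form a domain.\<close>

lemma series_locus_vanishing_iff: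
  assumes p: "p \<in> mpolys UNIV m"
  shows "(\<forall>a\<in>series_locus K m w. meval p a = 0) \<longleftrightarrow> ev kap p w = 0"
proof
  assume "\<forall>a\<in>series_locus K m w. meval p a = 0"
  thus "ev kap p w = 0" using series_nullstellensatz[OF p, of w K] by blast
next
  assume 0: "ev kap p w = 0"
  have "{p} \<subseteq> mpolys UNIV m" using p by simp
  from mpoly_decompose[OF K lin_indep_empty _ this] obtain B P where
    B: "lin_indep K B" and P: "\<And>d. d \<in> B \<Longrightarrow> P d \<in> mpolys K m" "p = (\<Sum>d\<in>B. mconst d * P d)" by auto
  have "(\<Sum>d\<in>B. kap d * ev kap (P d) w) = 0"
    using 0 unfolding P(2) by (simp add: ev_sum[OF kap_hom] ev_mult[OF kap_hom] ev_single[OF kap_hom])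
  hence "ev kap (P d) w = 0" if "d \<in> B" for d using series_locus_component[OF B, of P d] P(1) that by blast
  hence "meval (P d) a = 0" if "d \<in> B" "a \<in> series_locus K m w" for d a
    using that P(1) by (auto simp: series_locus_def zero_set_def)
  thus "\<forall>a\<in>series_locus K m w. meval p a = 0" unfolding P(2) by (simp add: meval_simps)
qed

lemma series_locus_nonempty: "series_locus K m w \<noteq> {}"
  using series_nullstellensatz[of 1 m w K] by (auto simp: ev_one[OF kap_hom] intro: mpolys_UNIV_closed)

lemma series_locus_irreducible: "abs_irreducible m (series_locus K m w)"
proof (rule abs_irreducibleI)
  show "zariski_closed m (series_locus K m w)"
    unfolding zariski_closed_def series_locus_def
    by (rule exI[of _ "{p \<in> mpolys K m. ev kap p w = 0}"]) (auto intro: mpolys_UNIV)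
  show "series_locus K m w \<noteq> {}" by (rule series_locus_nonempty)
  fix p q assume pq: "p \<in> mpolys UNIV m" "q \<in> mpolys UNIV m"
    and 0: "\<And>y. y \<in> series_locus K m w \<Longrightarrow> meval p y * meval q y = 0"
  have "\<forall>y\<in>series_locus K m w. meval (p * q) y = 0" using 0 by (simp add: meval_mult)
  hence "ev kap (p * q) w = 0"
    using series_locus_vanishing_iff[of "p * q"] pq by (auto intro: mpolys_UNIV_closed)
  hence "ev kap p w = 0 \<or> ev kap q w = 0" by (simp add: ev_mult[OF kap_hom])
  thus "(\<forall>y\<in>series_locus K m w. meval p y = 0) \<or> (\<forall>y\<in>series_locus K m w. meval q y = 0)"
    using series_locus_vanishing_iff pq by blast
qed

lemma series_locus_descends: "descends K m (series_locus K m w)"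
  unfolding descends_def
proof (intro allI impI, elim conjE)
  fix B P assume B: "lin_indep K B" and P: "\<forall>d\<in>B. P d \<in> mpolys K m"
    and 0: "\<forall>y\<in>series_locus K m w. (\<Sum>d\<in>B. d * meval (P d) y) = 0"
  define p where "p = (\<Sum>d\<in>B. mconst d * P d)"
  have p: "p \<in> mpolys UNIV m" unfolding p_def
    using P by (auto intro!: mpolys_UNIV_closed mpolys_mconst intro: mpolys_UNIV)
  have "\<forall>y\<in>series_locus K m w. meval p y = 0" using 0 unfolding p_def by (simp add: meval_simps)
  hence "ev kap p w = 0" using series_locus_vanishing_iff[OF p] by blast
  hence "(\<Sum>d\<in>B. kap d * ev kap (P d) w) = 0"
    unfolding p_def by (simp add: ev_sum[OF kap_hom] ev_mult[OF kap_hom] ev_single[OF kap_hom])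
  hence "ev kap (P d) w = 0" if "d \<in> B" for d using series_locus_component[OF B, of P d] P that by blast
  thus "\<forall>d\<in>B. \<forall>y\<in>series_locus K m w. meval (P d) y = 0"
    using P by (auto simp: series_locus_def zero_set_def)
qed

end

text \<open>The PAC property is applied to the locus of \<open>w\<close> with the projection to the
  first \<open>r\<close> coordinates. Its generic point must lie in the coordinate field and not in
  a series ring; it is obtained by sending the parameters to the independent elements
  \<open>t\<close> and extending injectively over the algebraic series \<open>w i\<close>.\<close>

theorem pac_series_point:
  fixes K\<^sub>0 K :: "'a::alg_closed_field set"
  assumes pac: "pac_in_domain K\<^sub>0 K" and K: "is_subfield K" and r: "1 \<le> r" "r \<le> m"
    and t: "alg_independent K r t" and b: "\<And>i. i < r \<Longrightarrow> b i \<in> K"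
    and w: "\<And>i. i < m \<Longrightarrow> w i \<in> series_over K" "\<And>i. i < r \<Longrightarrow> w i = shifted_var b i"
    and sep: "\<And>i. i < m \<Longrightarrow> simple_root (gen (kap ` K \<union> shifted_var b ` {..<r})) (w i)"
  shows "\<exists>a. (\<forall>i. a i \<in> K) \<and> (\<forall>i<r. a i \<in> K\<^sub>0) \<and>
    (\<forall>p\<in>mpolys UNIV m. ev kap p w = 0 \<longrightarrow> meval p a = 0)"
proof -
  note R = subfield_is_subring[OF K]
  define V where "V = series_locus K m w"
  have irr: "abs_irreducible m V" unfolding V_def by (rule series_locus_irreducible[OF K w(1)])
  have desc: "descends K m V" unfolding V_def by (rule series_locus_descends[OF K w(1)])
  have van: "(\<forall>a\<in>V. meval p a = 0) \<longleftrightarrow> ev kap p w = 0" if "p \<in> mpolys UNIV m" for p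
    unfolding V_def by (rule series_locus_vanishing_iff[OF K w(1) that])
  define A where "A = gen (kap ` K \<union> shifted_var b ` {..<r})"
  have A: "is_subring A" unfolding A_def by (rule is_subring_gen)
  have A_eq: "A = (\<lambda>p. ev kap p (shifted_var b)) ` mpolys K r"
    unfolding A_def by (rule ev_image_eq_gen[OF R kap_hom, symmetric])
  have "hom_on (mpolys K r) (\<lambda>p. meval p t)" unfolding meval_eq_ev by (rule ev_hom_on[OF id_hom])
  from hom_on_from_relation[OF is_subring_mpolys[OF R] ev_hom_on[OF kap_hom] this]
  obtain \<phi> where \<phi>: "hom_on A \<phi>" "\<And>p. p \<in> mpolys K r \<Longrightarrow> \<phi> (ev kap p (shifted_var b)) = meval p t"
    unfolding A_eq using shifted_var_independent by (metis meval_simps(1,4))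
  have \<phi>_inj: "a = 0" if "a \<in> A" "\<phi> a = 0" for a
    using that \<phi>(2) t unfolding A_eq alg_independent_def by (auto simp: ev_zero[OF kap_hom])
  have \<phi>_kap: "\<phi> (kap c) = c" if "c \<in> K" for c
    using \<phi>(2)[OF mpolys_mconst[OF that]] by (simp add: ev_single[OF kap_hom] meval_simps)
  have \<phi>_var: "\<phi> (shifted_var b i) = t i" if "i < r" for i
    using \<phi>(2)[OF mpolys_mvar[OF subring_one[OF R] that]] by (simp add: ev_mvar[OF kap_hom] meval_simps)
  have "algebraic_on A y" if "y \<in> w ` {..<m}" for y
    using sep that by (auto simp: A_def intro: simple_root_algebraic)
  hence "\<exists>\<psi>. hom_on (gen (w ` {..<m} \<union> A)) \<psi> \<and> (\<forall>a\<in>A. \<psi> a = \<phi> a) \<and>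
      (\<forall>a\<in>gen (w ` {..<m} \<union> A). \<psi> a = 0 \<longrightarrow> a = 0)"
    by (intro injective_hom_extension[OF A _ _ \<phi>(1) \<phi>_inj]) auto
  then obtain \<psi> where \<psi>: "hom_on (gen (w ` {..<m} \<union> A)) \<psi>" "\<And>a. a \<in> A \<Longrightarrow> \<psi> a = \<phi> a"
      "\<And>a. a \<in> gen (w ` {..<m} \<union> A) \<Longrightarrow> \<psi> a = 0 \<Longrightarrow> a = 0" by blast
  define E where "E = gen (w ` {..<m} \<union> A)"
  have E_sup: "w ` {..<m} \<union> A \<subseteq> E" unfolding E_def by (rule gen_superset)
  have E: "is_subring E" "A \<subseteq> E" "\<And>i. i < m \<Longrightarrow> w i \<in> E"
    using E_sup is_subring_gen[of "w ` {..<m} \<union> A", folded E_def] by auto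
  note \<psi> = \<psi>[folded E_def]
  have kapA: "kap c \<in> A" if "c \<in> K" for c
    using gen_superset[of "kap ` K \<union> shifted_var b ` {..<r}", folded A_def] that by blast
  \<comment> \<open>Injectivity of \<open>\<psi>\<close> gives \<open>x\<close> exactly the
    relations over \<open>K\<close> that \<open>w\<close> has, so \<open>x\<close> is
    generic.\<close>
  define x where "x = (\<lambda>i. if i < m then \<psi> (w i) else 0)"
  have ev_x: "meval p x = \<psi> (ev kap p w)" "ev kap p w \<in> E" if p: "p \<in> mpolys K m" for p
  proof -
    have "\<psi> (ev kap p w) = ev (\<lambda>c. \<psi> (kap c)) p (\<lambda>i. \<psi> (w i))"
      by (rule hom_on_ev[OF E(1) \<psi>(1) p]) (use E(2,3) kapA in blast)+
    also have "\<dots> = meval p x" unfolding meval_eq_ev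
      by (rule ev_cong[OF p]) (auto simp: x_def \<psi>(2) kapA \<phi>_kap)
    finally show "meval p x = \<psi> (ev kap p w)" by simp
    show "ev kap p w \<in> E" by (rule ev_in_subring[OF E(1) p]) (use E(2,3) kapA in blast)+
  qed
  have x_t: "x i = t i" if "i < r" for i
    using that r w(2) \<phi>_var[OF that] \<psi>(2)[of "shifted_var b i"] gen_superset[of "kap ` K \<union> shifted_var b ` {..<r}"]
    by (auto simp: x_def A_def)
  have gen_x: "generic_point K m V x" unfolding generic_point_def
  proof (intro conjI ballI impI)
    have "x \<in> affine_space m" by (simp add: x_def affine_space_def)
    thus "x \<in> V" unfolding V_def series_locus_def zero_set_def
      using ev_x hom_on_zero[OF E(1) \<psi>(1)] by auto
    fix p y assume p: "p \<in> mpolys K m" "meval p x = 0" and y: "y \<in> V"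
    have "ev kap p w = 0" using ev_x[OF p(1)] p(2) \<psi>(3) by auto
    thus "meval p y = 0" using van[OF mpolys_UNIV[OF p(1)]] y by blast
  qed
  \<comment> \<open>The projection, written as fractions with denominator 1, so that it is defined
    everywhere and its values are coordinates.\<close>
  define \<nu> :: "nat \<Rightarrow> 'a mpoly \<times> 'a mpoly" where "\<nu> = (\<lambda>i. (mvar i, 1))"
  have \<nu>_ev: "meval (fst (\<nu> i)) y = y i" "meval (snd (\<nu> i)) y = 1" for i y
    by (simp_all add: \<nu>_def meval_simps)
  have rat: "rational_map K m V r \<nu>"
  proof -
    have "x \<in> V" using gen_x by (simp add: generic_point_def)
    hence "snd (\<nu> i) \<notin> vanishing_ideal K m V" for i by (auto simp: vanishing_ideal_def \<nu>_ev)
    thus ?thesis unfolding rational_map_def using r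
      by (auto simp: \<nu>_def intro!: mpolys_mvar subring_one[OF R] subring_one[OF is_subring_mpolys[OF R]])
  qed
  have x_ind: "alg_independent K r x"
  proof -
    have "meval p x = meval p t" if "p \<in> mpolys K r" for p by (rule meval_cong[OF that]) (rule x_t)
    thus ?thesis using t by (simp add: alg_independent_def)
  qed
  have dom: "dominating m V r \<nu>"
    by (rule dominatingI[OF K desc gen_x rat]) (simp add: \<nu>_ev x_ind)
  have sepx: "separable_algebraic_extension (adjoin K (x ` {..<r})) (function_field K m x)"
    unfolding separable_algebraic_extension_def field_extension_def subfield_type_algebra function_field_def
  proof (intro conjI is_subfield_adjoin ballI)
    show "adjoin K (x ` {..<r}) \<subseteq> adjoin K (x ` {..<m})" using r by (intro adjoin_mono) auto
    fix y assume "y \<in> adjoin K (x ` {..<m})"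
    then obtain p q where pq: "p \<in> gen (K \<union> x ` {..<m})" "q \<in> gen (K \<union> x ` {..<m})" "q \<noteq> 0" "y = p / q"
      using adjoin_fraction by blast
    define A' where "A' = gen (K \<union> x ` {..<r})"
    have A': "is_subring A'" unfolding A'_def by (rule is_subring_gen)
    have \<psi>A: "\<psi> a \<in> A'" if a: "a \<in> A" for a
    proof -
      obtain p where p: "p \<in> mpolys K r" "a = ev kap p (shifted_var b)" using a A_eq by blast
      have "\<psi> a = meval p t" using \<psi>(2)[OF a] \<phi>(2)[OF p(1)] p(2) by simp
      also have "\<dots> = meval p x" by (rule meval_cong[OF p(1)]) (simp add: x_t)
      finally show ?thesis unfolding A'_def using meval_image_eq_gen[OF R, of x r] p(1) by auto
    qed
    \<comment> \<open>Applying \<open>\<psi>\<close> to the coefficients of a simple relation of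
      \<open>w i\<close> gives one for the coordinate; injectivity keeps the derivative
      nonzero.\<close>
    have root: "simple_root A' z" if z: "z \<in> x ` {..<m}" for z
    proof -
      obtain i where i: "i < m" "z = \<psi> (w i)" using z by (auto simp: x_def)
      obtain g where g: "g \<in> pol A" "poly g (w i) = 0" "poly (pderiv g) (w i) \<noteq> 0"
        using sep[OF i(1)] by (auto simp: simple_root_def A_def)
      have gE: "g \<in> pol E" using g(1) pol_mono[OF E(2)] by blast
      have "map_poly \<psi> g \<in> pol A'"
        by (rule polI) (simp add: coeff_map_poly_hom[OF E(1) \<psi>(1)] \<psi>A polD[OF g(1)])
      moreover have "poly (map_poly \<psi> g) z = 0"
        using hom_on_poly[OF E(1) \<psi>(1) gE E(3)[OF i(1)]] g(2) hom_on_zero[OF E(1) \<psi>(1)] i by simp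
      moreover have "poly (pderiv (map_poly \<psi> g)) z \<noteq> 0"
      proof -
        have "poly (pderiv (map_poly \<psi> g)) z = \<psi> (poly (pderiv g) (w i))"
          using hom_on_poly[OF E(1) \<psi>(1) pol_pderiv[OF E(1) gE] E(3)[OF i(1)]] i
          by (simp add: map_poly_hom_pderiv[OF E(1) \<psi>(1) gE])
        thus ?thesis using \<psi>(3)[OF poly_in_subring[OF E(1) pol_pderiv[OF E(1) gE] E(3)[OF i(1)]]] g(3) by auto
      qed
      ultimately show ?thesis unfolding simple_root_def by blast
    qed
    have "gen (K \<union> x ` {..<m}) \<subseteq> gen (x ` {..<m} \<union> A')"
      by (rule gen_least[OF is_subring_gen])
         (use gen_superset[of "x ` {..<m} \<union> A'"] gen_superset[of "K \<union> x ` {..<r}"] in \<open>auto simp: A'_def\<close>)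
    hence "simple_root A' y"
      using pq by (intro simple_root_generated[OF A' _ root, of "x ` {..<m}" p q]) auto
    moreover have "A' \<subseteq> adjoin K (x ` {..<r})" unfolding A'_def by (rule gen_subset_adjoin)
    ultimately show "separable_over (adjoin K (x ` {..<r})) y"
      by (intro simple_root_imp_separable_over[OF is_subfield_adjoin]) (rule simple_root_mono)
  qed
  have "has_dimension K m V r"
    unfolding has_dimension_def using gen_x separable_has_trdeg[OF x_ind sepx] by blast
  moreover have "separable_map K m V r \<nu>"
    unfolding separable_map_def using gen_x sepx by (auto simp: \<nu>_ev)
  ultimately obtain a c where a: "a \<in> rational_points K V" "rational_map_at m V r \<nu> a c"
    "\<And>i. i < r \<Longrightarrow> c i \<in> K\<^sub>0"
    using pac r irr descends_imp_defined_over[OF K desc] rat dom unfolding pac_in_domain_def by blast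
  have aV: "a \<in> V" using a by (simp add: rational_points_def)
  have "a i \<in> K\<^sub>0" if "i < r" for i
  proof -
    have "rational_fun_at m V (\<nu> i) a (c i)" using a(2) that by (simp add: rational_map_at_def)
    from rational_fun_at_value[OF this aV] have "c i = a i" by (simp add: \<nu>_ev)
    thus ?thesis using a(3)[OF that] by simp
  qed
  moreover have "meval p a = 0" if "p \<in> mpolys UNIV m" "ev kap p w = 0" for p
    using van[OF that(1)] that(2) aV by blast
  moreover have "a i \<in> K" for i using a by (simp add: rational_points_def)
  ultimately show ?thesis by blast
qed

section \<open>Restriction of scalars for power series\<close>

context
  fixes K :: "'a::alg_closed_field set" and \<theta> :: 'a and \<mu> :: "'a poly"
  assumes K: "is_subfield K" and \<theta>: "simple_root K \<theta>" and \<mu>: "least_vanishing K \<theta> \<mu>"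
begin

text \<open>If \<open>h\<close> is nonzero, it does not vanish at \<theta> by minimality, and the
  Bezout identity for \<open>h\<close> and \<mu> would become \<open>0 = c\<close> at the common
  root \<beta>.\<close>

lemma conjugate_independent:
  assumes \<beta>: "poly \<mu> \<beta> = 0" and h: "h \<in> pol K" "poly h \<beta> = 0" "Polynomial.degree h < Polynomial.degree \<mu>"
  shows "h = 0"
proof (rule ccontr)
  assume nz: "h \<noteq> 0"
  hence "poly h \<theta> \<noteq> 0" using \<mu> h by (force simp: least_vanishing_def)
  from least_vanishing_bezout[OF subfield_is_subring[OF K] \<mu> h(1) this] obtain a b c where
    "c \<noteq> 0" "a * h + b * \<mu> = [:c:]" by blast
  from arg_cong[OF this(2), of "\<lambda>p. poly p \<beta>"] this(1) \<beta> h show False by simp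
qed

text \<open>The Bezout identity for \<mu> and its derivative shows that every root of \<mu> is
  simple, so the linear factors are distinct. Interpolation below needs as many conjugates as there
  are basis elements.\<close>

lemma card_conjugates: "card {\<beta>. poly \<mu> \<beta> = 0} = Polynomial.degree \<mu>"
proof -
  note R = subfield_is_subring[OF K]
  have \<mu>': "\<mu> \<in> pol K" "\<mu> \<noteq> 0" using \<mu> by (auto simp: least_vanishing_def)
  from least_vanishing_bezout[OF R \<mu> pol_pderiv[OF R \<mu>'(1)] least_vanishing_simple[OF R \<theta> \<mu>]]
  obtain a b c where abc: "c \<noteq> 0" "a * pderiv \<mu> + b * \<mu> = [:c:]" by blast
  have simple: "poly (pderiv \<mu>) \<beta> \<noteq> 0" if "poly \<mu> \<beta> = 0" for \<beta>
    using arg_cong[OF abc(2), of "\<lambda>p. poly p \<beta>"] abc(1) that by auto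
  obtain A where A: "size A = Polynomial.degree \<mu>" "\<mu> = smult (lead_coeff \<mu>) (\<Prod>x\<in>#A. [:-x, 1:])"
    using alg_closed_imp_factorization[OF \<mu>'(2)] by blast
  have root: "poly \<mu> \<beta> = 0 \<longleftrightarrow> \<beta> \<in># A" for \<beta>
    by (subst A(2)) (use \<mu>'(2) in \<open>auto simp: poly_prod_mset prod_mset_zero_iff image_iff\<close>)
  have "count A x \<le> 1" for x
  proof (rule ccontr)
    assume "\<not> count A x \<le> 1"
    hence "{#x, x#} \<subseteq># A" by (simp add: subseteq_mset_def)
    then obtain A' where "A = {#x, x#} + A'" by (metis subset_mset.le_iff_add)
    hence A': "A = add_mset x (add_mset x A')" by simp
    have "(\<Prod>x\<in>#A. [:-x, 1:]) = [:-x, 1:] * ([:-x, 1:] * (\<Prod>x\<in>#A'. [:-x, 1:]))"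
      unfolding A' by (simp only: image_mset_add_mset prod_mset.add_mset)
    hence "\<mu> = [:-x, 1:] * ([:-x, 1:] * smult (lead_coeff \<mu>) (\<Prod>x\<in>#A'. [:-x, 1:]))"
      using A(2) by (simp only: mult_smult_right)
    then obtain q where q: "\<mu> = [:-x, 1:] * ([:-x, 1:] * q)" by blast
    have "poly \<mu> x = 0" by (subst q) simp
    moreover have "poly (pderiv \<mu>) x = 0" by (subst q) (simp only: pderiv_mult poly_add poly_mult, simp)
    ultimately show False using simple by blast
  qed
  hence "count A x = (if x \<in># A then 1 else 0)" for x
    using le_antisym[of "count A x" 1] by (simp add: not_in_iff Suc_le_eq)
  hence "A = mset_set (set_mset A)"
    by (intro multiset_eqI) (simp add: count_mset_set')
  hence "size A = card (set_mset A)" by (metis size_mset_set)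
  moreover have "{\<beta>. poly \<mu> \<beta> = 0} = set_mset A" using root by auto
  ultimately show ?thesis using A(1) by simp
qed

lemma simple_extension_basis:
  assumes "l \<in> gen (insert \<theta> K)"
  shows "\<exists>k. (\<forall>j. k j \<in> K) \<and> l = (\<Sum>j<Polynomial.degree \<mu>. k j * \<theta> ^ j)"
proof -
  note R = subfield_is_subring[OF K]
  have \<mu>': "\<mu> \<in> pol K" "\<mu> \<noteq> 0" "poly \<mu> \<theta> = 0" using \<mu> by (auto simp: least_vanishing_def)
  obtain q where q: "q \<in> pol K" "l = poly q \<theta>" using assms gen_insert_eq[OF R] by blast
  from pseudo_division[OF R \<mu>'(1,2) q(1)] obtain e s p where
    *: "s \<in> pol K" "p \<in> pol K" "smult (lead_coeff \<mu> ^ e) q = \<mu> * s + p"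
       "p = 0 \<or> Polynomial.degree p < Polynomial.degree \<mu>" by blast
  let ?l = "lead_coeff \<mu> ^ e"
  have lK: "?l \<in> K" "?l \<noteq> 0" using subring_power[OF R polD[OF \<mu>'(1)]] \<mu>'(2) by auto
  have "?l * l = poly p \<theta>" using arg_cong[OF *(3), of "\<lambda>p. poly p \<theta>"] \<mu>' q by simp
  also have "poly p \<theta> = (\<Sum>j<Polynomial.degree \<mu>. poly.coeff p j * \<theta> ^ j)"
  proof (cases "p = 0")
    case False
    hence "Polynomial.degree p < Polynomial.degree \<mu>" using * by blast
    thus ?thesis unfolding poly_altdef
      by (intro sum.mono_neutral_left) (auto simp: coeff_eq_0)
  qed auto
  finally have "l = (\<Sum>j<Polynomial.degree \<mu>. poly.coeff p j * \<theta> ^ j) / ?l"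
    using lK by (simp add: field_simps)
  also have "\<dots> = (\<Sum>j<Polynomial.degree \<mu>. (poly.coeff p j / ?l) * \<theta> ^ j)"
    by (simp add: sum_divide_distrib)
  finally show ?thesis
    using subfield_divide[OF K polD[OF *(2)] lK(1)] by (intro exI[of _ "\<lambda>j. poly.coeff p j / ?l"]) auto
qed

lemma series_extension_basis:
  assumes y: "y \<in> series_over (gen (insert \<theta> K))"
  shows "\<exists>\<eta>. (\<forall>j. \<eta> j \<in> series_over K) \<and> y = (\<Sum>j<Polynomial.degree \<mu>. \<eta> j * kap \<theta> ^ j)"
proof -
  note R = subfield_is_subring[OF K]
  have "\<forall>l\<in>gen (insert \<theta> K). \<exists>k. (\<forall>j. k j \<in> K) \<and> l = (\<Sum>j<Polynomial.degree \<mu>. k j * \<theta> ^ j)"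
    using simple_extension_basis by blast
  from bchoice[OF this] obtain k where k: "\<And>l j. l \<in> gen (insert \<theta> K) \<Longrightarrow> k l j \<in> K"
    "\<And>l. l \<in> gen (insert \<theta> K) \<Longrightarrow> l = (\<Sum>j<Polynomial.degree \<mu>. k l j * \<theta> ^ j)" by blast
  have yc: "coef (fps_nth y n) m \<in> gen (insert \<theta> K)" for n m using y by (simp add: series_over_def)
  \<comment> \<open>Only monomials occurring in \<open>y\<close> are expanded. This keeps every
    coefficient a polynomial and does not presume that the chosen expansion of 0 is trivial.\<close>
  define \<eta> where "\<eta> = (\<lambda>j. Abs_fps (\<lambda>n. \<Sum>m\<in>Poly_Mapping.keys (fps_nth y n).
    Poly_Mapping.single m (k (coef (fps_nth y n) m) j)))"
  have \<eta>: "coef (fps_nth (\<eta> j) n) m =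
    (if m \<in> Poly_Mapping.keys (fps_nth y n) then k (coef (fps_nth y n) m) j else 0)" for j n m
    by (auto simp: \<eta>_def lookup_sum lookup_single when_def)
  have "\<eta> j \<in> series_over K" for j
    using k(1)[OF yc] subring_zero[OF R] by (auto simp: series_over_def \<eta>)
  moreover have "y = (\<Sum>j<Polynomial.degree \<mu>. \<eta> j * kap \<theta> ^ j)"
  proof (intro fps_ext poly_mapping_eqI)
    fix n m
    have "coef (fps_nth (\<Sum>j<Polynomial.degree \<mu>. \<eta> j * kap \<theta> ^ j) n) m =
      (\<Sum>j<Polynomial.degree \<mu>. \<theta> ^ j * coef (fps_nth (\<eta> j) n) m)"
      unfolding fps_sum_nth lookup_sum
      by (intro sum.cong refl) (simp only: mult.commute[of "\<eta> _"] kap_simps(7)[symmetric] coef_kap_mult)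
    also have "\<dots> = coef (fps_nth y n) m"
    proof (cases "m \<in> Poly_Mapping.keys (fps_nth y n)")
      case True
      hence "(\<Sum>j<Polynomial.degree \<mu>. \<theta> ^ j * coef (fps_nth (\<eta> j) n) m) =
        (\<Sum>j<Polynomial.degree \<mu>. k (coef (fps_nth y n) m) j * \<theta> ^ j)" by (simp add: \<eta> mult.commute)
      also have "\<dots> = coef (fps_nth y n) m" by (rule k(2)[OF yc, symmetric])
      finally show ?thesis .
    next
      case False
      thus ?thesis by (simp add: \<eta> in_keys_iff)
    qed
    finally show "coef (fps_nth y n) m = coef (fps_nth (\<Sum>j<Polynomial.degree \<mu>. \<eta> j * kap \<theta> ^ j) n) m" by simp
  qed
  ultimately show ?thesis by blast
qed

text \<open>Fixing a power of \<open>s\<close> and a monomial, the corresponding coefficients of the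
  coefficients of \<open>g\<close> form a polynomial over \<open>K\<close> of small degree vanishing
  at \<beta>, which is 0 by \<open>conjugate_independent\<close>.\<close>

lemma series_conjugate_independent:
  assumes \<beta>: "poly \<mu> \<beta> = 0" and g: "g \<in> pol (series_over K)" "poly g (kap \<beta>) = 0"
    "Polynomial.degree g < Polynomial.degree \<mu>"
  shows "g = 0"
proof (rule poly_eqI)
  fix i
  note R = subfield_is_subring[OF K]
  have "coef (fps_nth (poly.coeff g i) n) m = 0" for n m
  proof -
    define h where "h = (\<Sum>j\<le>Polynomial.degree g. monom (coef (fps_nth (poly.coeff g j) n) m) j)"
    have cK: "coef (fps_nth (poly.coeff g j) n) m \<in> K" for j
      using polD[OF g(1), of j] by (simp add: series_over_def)
    have "h \<in> pol K" unfolding h_def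
      by (intro subring_sum[OF is_subring_pol[OF R]] pol_monom[OF R] cK)
    moreover have "Polynomial.degree h < Polynomial.degree \<mu>"
    proof -
      have "Polynomial.degree h \<le> Polynomial.degree g" unfolding h_def
        by (rule degree_sum_le) (auto intro: order.trans[OF degree_monom_le])
      thus ?thesis using g by simp
    qed
    moreover have "poly h \<beta> = 0"
    proof -
      have "poly h \<beta> = (\<Sum>j\<le>Polynomial.degree g. \<beta> ^ j * coef (fps_nth (poly.coeff g j) n) m)"
        by (simp add: h_def poly_sum poly_monom mult.commute)
      also have "\<dots> = coef (fps_nth (poly g (kap \<beta>)) n) m"
        unfolding poly_altdef fps_sum_nth lookup_sum
        by (intro sum.cong refl) (simp only: mult.commute[of "poly.coeff g _"] kap_simps(7)[symmetric] coef_kap_mult)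
      finally show ?thesis using g by simp
    qed
    ultimately have "h = 0" by (intro conjugate_independent[OF \<beta>])
    hence "poly.coeff h i = 0" by simp
    thus ?thesis by (cases "i \<le> Polynomial.degree g") (auto simp: h_def coeff_sum coeff_eq_0)
  qed
  thus "poly.coeff g i = poly.coeff 0 i" by (auto intro!: fps_ext poly_mapping_eqI)
qed

text \<open>Adjoining series over \<open>K\<close> to the coefficients does not create a shorter
  relation for \<theta>: this is the case \<beta> = \<theta> of the independence of powers.\<close>

lemma kap_least_vanishing: "least_vanishing (series_over K) (kap \<theta>) (map_poly kap \<mu>)"
proof -
  note R = subfield_is_subring[OF K]
  have \<mu>': "\<mu> \<in> pol K" "\<mu> \<noteq> 0" "poly \<mu> \<theta> = 0" using \<mu> by (auto simp: least_vanishing_def)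
  have c: "poly.coeff (map_poly kap \<mu>) i = kap (poly.coeff \<mu> i)" for i
    by (rule coeff_map_poly) (simp add: kap_simps)
  have deg: "Polynomial.degree (map_poly kap \<mu>) = Polynomial.degree \<mu>"
    by (rule degree_map_poly) simp
  have "poly (map_poly kap \<mu>) (kap \<theta>) = kap (poly \<mu> \<theta>)"
    by (rule hom_on_poly[OF is_subring_UNIV kap_hom, symmetric]) (auto simp: pol_def)
  moreover have "map_poly kap \<mu> \<in> pol (series_over K)"
    by (rule polI) (simp add: c kap_series_over[OF R] polD[OF \<mu>'(1)])
  moreover have "map_poly kap \<mu> \<noteq> 0"
    using \<mu>'(2) c[of "Polynomial.degree \<mu>"] by auto
  moreover have "Polynomial.degree \<mu> \<le> Polynomial.degree g"
    if "g \<in> pol (series_over K)" "g \<noteq> 0" "poly g (kap \<theta>) = 0" for g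
    using series_conjugate_independent[OF \<mu>'(3) that(1,3)] that(2) by force
  ultimately show ?thesis unfolding least_vanishing_def using \<mu>'(3) by (auto simp: deg kap_simps)
qed

lemma series_over_extension_subset:
  "series_over (gen (insert \<theta> K)) \<subseteq> gen (insert (kap \<theta>) (series_over K))"
proof
  fix y assume "y \<in> series_over (gen (insert \<theta> K))"
  then obtain \<eta> where \<eta>: "\<And>j. \<eta> j \<in> series_over K" "y = (\<Sum>j<Polynomial.degree \<mu>. \<eta> j * kap \<theta> ^ j)"
    using series_extension_basis by blast
  have "\<eta> j \<in> gen (insert (kap \<theta>) (series_over K))" "kap \<theta> \<in> gen (insert (kap \<theta>) (series_over K))" for j
    using \<eta>(1) gen_superset[of "insert (kap \<theta>) (series_over K)"] by auto
  thus "y \<in> gen (insert (kap \<theta>) (series_over K))"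
    unfolding \<eta>(2) by (intro subring_sum[OF is_subring_gen] subring_mult[OF is_subring_gen] subring_power[OF is_subring_gen])
qed

text \<open>The action of the conjugation from \<theta> to \<beta> on coefficients. An element of
  the kernel has a pseudo-remainder vanishing at \<open>kap \<beta>\<close>, which is 0 by
  independence; the resulting injectivity is needed to preserve simple roots.\<close>

lemma series_conjugation:
  assumes \<beta>: "poly \<mu> \<beta> = 0"
  shows "\<exists>\<sigma>. hom_on (gen (insert (kap \<theta>) (series_over K))) \<sigma> \<and> (\<forall>g\<in>series_over K. \<sigma> g = g) \<and>
    \<sigma> (kap \<theta>) = kap \<beta> \<and> (\<forall>e\<in>gen (insert (kap \<theta>) (series_over K)). \<sigma> e = 0 \<longrightarrow> e = 0)"
proof -
  note R = subfield_is_subring[OF K]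
  note S = is_subring_series_over[OF R]
  define f where "f = map_poly kap \<mu>"
  have f: "least_vanishing (series_over K) (kap \<theta>) f" unfolding f_def by (rule kap_least_vanishing)
  hence f': "f \<in> pol (series_over K)" "f \<noteq> 0" "poly f (kap \<theta>) = 0" by (auto simp: least_vanishing_def)
  have id: "map_poly (\<lambda>g. g) p = p" for p :: "'a mpoly fps poly" by (rule poly_eqI) (simp add: coeff_map_poly)
  have "poly f (kap \<beta>) = kap (poly \<mu> \<beta>)" unfolding f_def
    by (rule hom_on_poly[OF is_subring_UNIV kap_hom, symmetric]) (auto simp: pol_def)
  hence f\<beta>: "poly f (kap \<beta>) = 0" using \<beta> by (simp add: kap_simps)
  have "\<exists>\<sigma>. hom_on (gen (insert (kap \<theta>) (series_over K))) \<sigma> \<and>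
    (\<forall>p\<in>pol (series_over K). \<sigma> (poly p (kap \<theta>)) = poly (map_poly (\<lambda>g. g) p) (kap \<beta>)) \<and>
    (\<forall>a\<in>series_over K. \<sigma> a = a) \<and> \<sigma> (kap \<theta>) = kap \<beta>"
    by (rule extend_hom_algebraic[OF S id_hom f]) (use f'(2) f\<beta> in \<open>auto simp: id\<close>)
  then obtain \<sigma> where \<sigma>: "hom_on (gen (insert (kap \<theta>) (series_over K))) \<sigma>"
    "\<And>p. p \<in> pol (series_over K) \<Longrightarrow> \<sigma> (poly p (kap \<theta>)) = poly p (kap \<beta>)"
    "\<And>a. a \<in> series_over K \<Longrightarrow> \<sigma> a = a" "\<sigma> (kap \<theta>) = kap \<beta>" unfolding id by blast
  have "e = 0" if e: "e \<in> gen (insert (kap \<theta>) (series_over K))" "\<sigma> e = 0" for e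
  proof -
    obtain p where p: "p \<in> pol (series_over K)" "e = poly p (kap \<theta>)" using e gen_insert_eq[OF S] by blast
    from pseudo_division[OF S f'(1,2) p(1)] obtain k q s where
      *: "q \<in> pol (series_over K)" "s \<in> pol (series_over K)" "smult (lead_coeff f ^ k) p = f * q + s"
         "s = 0 \<or> Polynomial.degree s < Polynomial.degree f" by blast
    have "poly s (kap \<beta>) = 0"
      using arg_cong[OF *(3), of "\<lambda>p. poly p (kap \<beta>)"] f\<beta> e \<sigma>(2)[OF p(1)] p(2) by simp
    moreover have "Polynomial.degree f = Polynomial.degree \<mu>" unfolding f_def by (rule degree_map_poly) simp
    ultimately have "s = 0" using series_conjugate_independent[OF \<beta> *(2)] *(4) by auto
    thus "e = 0" using arg_cong[OF *(3), of "\<lambda>p. poly p (kap \<theta>)"] f' p(2) by simp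
  qed
  thus ?thesis using \<sigma> by blast
qed

end

section \<open>Lagrange interpolation and descent of constants\<close>

lemma lagrange_basis:
  fixes Z :: "'a::field set"
  assumes Z: "finite Z" "\<beta> \<in> Z"
  shows "\<exists>l. Polynomial.degree l < card Z \<and> (\<forall>\<gamma>\<in>Z. poly l \<gamma> = (if \<gamma> = \<beta> then 1 else 0))"
proof -
  define l where "l = (\<Prod>\<gamma>\<in>Z - {\<beta>}. smult (1 / (\<beta> - \<gamma>)) [:- \<gamma>, 1:])"
  have "Polynomial.degree l \<le> (\<Sum>\<gamma>\<in>Z - {\<beta>}. Polynomial.degree (smult (1 / (\<beta> - \<gamma>)) [:- \<gamma>, 1:]))"
    unfolding l_def using degree_prod_sum_le[of "Z - {\<beta>}" "\<lambda>\<gamma>. smult (1 / (\<beta> - \<gamma>)) [:- \<gamma>, 1:]"] Z(1)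
    by (simp add: o_def)
  also have "\<dots> \<le> (\<Sum>\<gamma>\<in>Z - {\<beta>}. 1)" by (intro sum_mono) (auto intro: order.trans[OF degree_smult_le])
  also have "\<dots> = card Z - 1" using Z by simp
  also have "\<dots> < card Z" using Z card_gt_0_iff[of Z] by (intro diff_less) auto
  finally have "Polynomial.degree l < card Z" .
  moreover have "poly l \<gamma> = (if \<gamma> = \<beta> then 1 else 0)" if "\<gamma> \<in> Z" for \<gamma>
    using Z that by (auto simp: l_def poly_prod diff_divide_distrib[symmetric] intro!: prod.neutral)
  ultimately show ?thesis by blast
qed

lemma poly_zero_if_many_roots:
  fixes p :: "'a::idom poly"
  assumes "Polynomial.degree p < card Z" "\<And>z. z \<in> Z \<Longrightarrow> poly p z = 0"
  shows "p = 0"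
proof (rule ccontr)
  assume nz: "p \<noteq> 0"
  have "card Z \<le> card {x. poly p x = 0}"
    using assms(2) by (intro card_mono poly_roots_finite nz) auto
  also have "\<dots> \<le> Polynomial.degree p" by (rule card_poly_roots_bound[OF nz])
  finally show False using assms by simp
qed

text \<open>A polynomial of degree below \<open>d\<close> with coefficients \<open>\<eta> i\<close>
  equals its interpolation at the \<open>d\<close> points of \<open>Z\<close>, because the
  difference has too many roots. The multipliers \<open>l \<beta>\<close> are the
  \<open>j\<close>-th coefficients of the Lagrange basis polynomials and hence constants.\<close>

lemma series_lagrange:
  fixes \<eta> :: "nat \<Rightarrow> 'a::field mpoly fps"
  assumes Z: "finite Z" "card Z = d" and j: "j < d"
  shows "\<exists>l :: 'a \<Rightarrow> 'a. \<eta> j = (\<Sum>\<beta>\<in>Z. (\<Sum>i<d. \<eta> i * kap \<beta> ^ i) * kap (l \<beta>))"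
proof -
  from lagrange_basis[OF Z(1)] obtain L where
    L: "\<And>\<beta>. \<beta> \<in> Z \<Longrightarrow> Polynomial.degree (L \<beta>) < d"
       "\<And>\<beta> \<gamma>. \<beta> \<in> Z \<Longrightarrow> \<gamma> \<in> Z \<Longrightarrow> poly (L \<beta>) \<gamma> = (if \<gamma> = \<beta> then 1 else 0)"
    unfolding Z(2) by metis
  define v where "v = (\<lambda>\<beta>. \<Sum>i<d. \<eta> i * kap \<beta> ^ i)"
  define p where "p = (\<Sum>i<d. monom (\<eta> i) i) - (\<Sum>\<beta>\<in>Z. smult (v \<beta>) (map_poly kap (L \<beta>)))"
  have degL: "Polynomial.degree (map_poly kap (L \<beta>)) < d" if "\<beta> \<in> Z" for \<beta>
    using L(1)[OF that] degree_map_poly[of kap "L \<beta>"] by simp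
  have d0: "0 < d" using j by simp
  have "Polynomial.degree p \<le> d - 1" unfolding p_def
  proof (intro degree_diff_le degree_sum_le)
    show "finite Z" by (fact Z)
    fix \<beta> assume "\<beta> \<in> Z"
    thus "Polynomial.degree (smult (v \<beta>) (map_poly kap (L \<beta>))) \<le> d - 1"
      using degL[of \<beta>] degree_smult_le[of "v \<beta>" "map_poly kap (L \<beta>)"] by linarith
  next
    fix i assume "i \<in> {..<d}"
    thus "Polynomial.degree (monom (\<eta> i) i) \<le> d - 1"
      using degree_monom_le[of "\<eta> i" i] by simp
  qed simp
  moreover have inj: "inj_on kap Z"
  proof (rule inj_onI)
    fix x y :: 'a assume "kap x = kap y"
    hence "kap (x - y) = 0" by (simp add: kap_simps)
    thus "x = y" by simp
  qed
  ultimately have "Polynomial.degree p < card (kap ` Z)" using Z d0 by (simp add: card_image)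
  moreover have "poly p z = 0" if z: "z \<in> kap ` Z" for z
  proof -
    obtain \<gamma> where \<gamma>: "\<gamma> \<in> Z" "z = kap \<gamma>" using z by blast
    have "poly (map_poly kap (L \<beta>)) z = kap (poly (L \<beta>) \<gamma>)" for \<beta>
      unfolding \<gamma>(2) by (rule hom_on_poly[OF is_subring_UNIV kap_hom, symmetric]) (auto simp: pol_def)
    hence "poly (\<Sum>\<beta>\<in>Z. smult (v \<beta>) (map_poly kap (L \<beta>))) z = (\<Sum>\<beta>\<in>Z. if \<gamma> = \<beta> then v \<beta> else 0)"
      unfolding poly_sum by (intro sum.cong) (auto simp: L(2) \<gamma>(1) kap_simps)
    also have "\<dots> = v \<gamma>" using Z \<gamma> by simp
    also have "\<dots> = poly (\<Sum>i<d. monom (\<eta> i) i) z"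
      by (simp add: v_def poly_sum poly_monom \<gamma>(2))
    finally show ?thesis by (simp add: p_def)
  qed
  ultimately have "p = 0" by (rule poly_zero_if_many_roots)
  hence "poly.coeff (\<Sum>i<d. monom (\<eta> i) i) j = poly.coeff (\<Sum>\<beta>\<in>Z. smult (v \<beta>) (map_poly kap (L \<beta>))) j"
    by (simp add: p_def)
  hence "\<eta> j = (\<Sum>\<beta>\<in>Z. v \<beta> * kap (poly.coeff (L \<beta>) j))"
    using j by (simp add: coeff_sum coeff_map_poly kap_simps)
  thus ?thesis unfolding v_def by (intro exI[of _ "\<lambda>\<beta>. poly.coeff (L \<beta>) j"])
qed

text \<open>A relation with ambient constants is split over a \<open>K\<close>-independent set. As
  \<open>\<eta>\<close> has coefficients in \<open>K\<close>, linear disjointness makes every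
  component vanish at \<open>\<eta>\<close>; as the derivative of the whole does not vanish there,
  that of some component does not either.\<close>

lemma simple_root_descent:
  fixes K :: "'a::alg_closed_field set"
  assumes K: "is_subfield K" and b: "\<And>i. i < r \<Longrightarrow> b i \<in> K" and \<eta>: "\<eta> \<in> series_over K"
    and root: "simple_root (gen (range kap \<union> shifted_var b ` {..<r})) \<eta>"
  shows "simple_root (gen (kap ` K \<union> shifted_var b ` {..<r})) \<eta>"
proof -
  note R = subfield_is_subring[OF K]
  define A where "A = gen (kap ` K \<union> shifted_var b ` {..<r})"
  have A_eq: "A = (\<lambda>p. ev kap p (shifted_var b)) ` mpolys K r"
    unfolding A_def by (rule ev_image_eq_gen[OF R kap_hom, symmetric])
  have A: "is_subring A" unfolding A_def by (rule is_subring_gen)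
  have AS: "A \<subseteq> series_over K" unfolding A_def
    by (rule gen_least[OF is_subring_series_over[OF R]])
       (use b kap_series_over[OF R] shifted_var_series_over[OF R] in auto)
  obtain g where g: "g \<in> pol (gen (range kap \<union> shifted_var b ` {..<r}))" "poly g \<eta> = 0" "poly (pderiv g) \<eta> \<noteq> 0"
    using root by (auto simp: simple_root_def)
  have "\<forall>i. \<exists>p. p \<in> mpolys UNIV r \<and> poly.coeff g i = ev kap p (shifted_var b)"
    using polD[OF g(1)] unfolding ev_image_eq_gen[OF is_subring_UNIV kap_hom, symmetric] by blast
  then obtain p where p: "\<And>i. p i \<in> mpolys UNIV r" "\<And>i. poly.coeff g i = ev kap (p i) (shifted_var b)" by metis
  define n where "n = Polynomial.degree g"
  have "finite (p ` {..n})" "p ` {..n} \<subseteq> mpolys UNIV r" using p(1) by auto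
  from mpoly_decompose[OF K lin_indep_empty this] obtain B where B: "lin_indep K B"
    "\<forall>q\<in>p ` {..n}. \<exists>P. (\<forall>d\<in>B. P d \<in> mpolys K r) \<and> q = (\<Sum>d\<in>B. mconst d * P d)" by blast
  hence "\<forall>i\<in>{..n}. \<exists>P. (\<forall>d\<in>B. P d \<in> mpolys K r) \<and> p i = (\<Sum>d\<in>B. mconst d * P d)" by blast
  from bchoice[OF this] obtain P where P: "\<And>i d. i \<le> n \<Longrightarrow> d \<in> B \<Longrightarrow> P i d \<in> mpolys K r"
    "\<And>i. i \<le> n \<Longrightarrow> p i = (\<Sum>d\<in>B. mconst d * P i d)" by auto
  define G where "G = (\<lambda>d. \<Sum>i\<le>n. monom (ev kap (P i d) (shifted_var b)) i)"
  have G: "G d \<in> pol A" if "d \<in> B" for d unfolding G_def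
    using P(1) that by (intro subring_sum[OF is_subring_pol[OF A]] pol_monom[OF A]) (auto simp: A_eq)
  have gG: "g = (\<Sum>d\<in>B. smult (kap d) (G d))"
  proof (rule poly_eqI)
    fix i
    have cG: "poly.coeff (G d) i = (if i \<le> n then ev kap (P i d) (shifted_var b) else 0)" for d
      by (simp add: G_def coeff_sum)
    show "poly.coeff g i = poly.coeff (\<Sum>d\<in>B. smult (kap d) (G d)) i"
    proof (cases "i \<le> n")
      case True
      have "poly.coeff g i = (\<Sum>d\<in>B. kap d * ev kap (P i d) (shifted_var b))"
        unfolding p(2) P(2)[OF True]
        by (simp add: ev_sum[OF kap_hom] ev_mult[OF kap_hom] ev_single[OF kap_hom])
      thus ?thesis using True by (simp add: coeff_sum cG)
    next
      case False
      thus ?thesis by (simp add: coeff_sum cG n_def coeff_eq_0)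
    qed
  qed
  note fin = lin_indep_finite[OF B(1)]
  have "(\<Sum>d\<in>B. kap d * poly (G d) \<eta>) = 0" using g(2) unfolding gG by (simp add: poly_sum)
  moreover have "poly (G d) \<eta> \<in> series_over K" if "d \<in> B" for d
    using G[OF that] pol_mono[OF AS] by (intro poly_in_subring[OF is_subring_series_over[OF R] _ \<eta>]) blast
  ultimately have 0: "poly (G d) \<eta> = 0" if "d \<in> B" for d
    using series_lin_indep[OF B(1), of "\<lambda>d. poly (G d) \<eta>" d] that by blast
  have pd: "pderiv (\<Sum>d\<in>B'. smult (kap d) (G d)) = (\<Sum>d\<in>B'. smult (kap d) (pderiv (G d)))" if "finite B'" for B'
    using that by induction (auto simp: pderiv_add pderiv_smult)
  have "\<exists>d\<in>B. poly (pderiv (G d)) \<eta> \<noteq> 0"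
  proof (rule ccontr)
    assume "\<not> ?thesis"
    hence "poly (pderiv g) \<eta> = 0" unfolding gG pd[OF fin] by (simp add: poly_sum)
    thus False using g(3) by blast
  qed
  thus ?thesis unfolding simple_root_def A_def[symmetric] using G 0 by blast
qed

text \<open>Conjugating the coefficients of \<open>y\<close> over \<open>K\<close> gives the values of \<open>\<Sum>j. \<eta> j * Y ^ j\<close> at the
  conjugates of \<open>\<theta>\<close>, from which the \<open>\<eta> j\<close> are recovered by Lagrange interpolation.\<close>

theorem series_restriction:
  fixes K :: "'a::alg_closed_field set"
  assumes K: "is_subfield K" and \<theta>: "simple_root K \<theta>" and \<mu>: "least_vanishing K \<theta> \<mu>"
    and b: "\<And>i. i < r \<Longrightarrow> b i \<in> K"
    and y: "y \<in> series_over (gen (insert \<theta> K))"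
    and root: "simple_root (gen (kap ` gen (insert \<theta> K) \<union> shifted_var b ` {..<r})) y"
  shows "\<exists>\<eta>. (\<forall>j<Polynomial.degree \<mu>. \<eta> j \<in> series_over K \<and>
      simple_root (gen (kap ` K \<union> shifted_var b ` {..<r})) (\<eta> j)) \<and>
    y = (\<Sum>j<Polynomial.degree \<mu>. \<eta> j * kap \<theta> ^ j)"
proof -
  note R = subfield_is_subring[OF K]
  note S = is_subring_series_over[OF R]
  obtain \<eta> where \<eta>: "\<And>j. \<eta> j \<in> series_over K" "y = (\<Sum>j<Polynomial.degree \<mu>. \<eta> j * kap \<theta> ^ j)"
    using series_extension_basis[OF K \<theta> \<mu> y] by blast
  define L where "L = gen (insert \<theta> K)"
  have L: "is_subring L" unfolding L_def by (rule is_subring_gen)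
  define C where "C = gen (kap ` L \<union> shifted_var b ` {..<r})"
  define DT where "DT = gen (range kap \<union> shifted_var b ` {..<r})"
  have DT: "is_subring DT" "range kap \<subseteq> DT" "\<And>i. i < r \<Longrightarrow> shifted_var b i \<in> DT"
    using is_subring_gen[of "range kap \<union> shifted_var b ` {..<r}", folded DT_def]
      gen_superset[of "range kap \<union> shifted_var b ` {..<r}", folded DT_def] by auto
  define G where "G = gen (insert (kap \<theta>) (series_over K))"
  have G: "is_subring G" "series_over K \<subseteq> G" "kap \<theta> \<in> G"
    using is_subring_gen[of "insert (kap \<theta>) (series_over K)", folded G_def]
      gen_superset[of "insert (kap \<theta>) (series_over K)", folded G_def] by auto
  have LG: "series_over L \<subseteq> G" unfolding L_def G_def by (rule series_over_extension_subset[OF K \<theta> \<mu>])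
  have TS: "shifted_var b i \<in> series_over K" if "i < r" for i
    using shifted_var_series_over[OF R] b that by blast
  have KG: "kap l \<in> G" if "l \<in> L" for l using LG kap_series_over[OF L that] by blast
  have CG: "C \<subseteq> G" unfolding C_def
    by (rule gen_least[OF G(1)]) (use KG TS G(2) in auto)
  have yG: "y \<in> G" using y LG by (auto simp: L_def)
  \<comment> \<open>Conjugation maps a simple relation for \<open>y\<close> to one for the conjugate
    of \<open>y\<close>: it fixes the parameters, moves constants to constants and is
    injective.\<close>
  have conj_root: "simple_root DT (\<Sum>j<Polynomial.degree \<mu>. \<eta> j * kap \<beta> ^ j)" if \<beta>: "poly \<mu> \<beta> = 0" for \<beta>
  proof -
    obtain \<sigma> where \<sigma>: "hom_on G \<sigma>" "\<And>g. g \<in> series_over K \<Longrightarrow> \<sigma> g = g" "\<sigma> (kap \<theta>) = kap \<beta>"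
      "\<And>e. e \<in> G \<Longrightarrow> \<sigma> e = 0 \<Longrightarrow> e = 0"
      using series_conjugation[OF K \<theta> \<mu> \<beta>] unfolding G_def by blast
    have \<sigma>_sum: "\<sigma> (\<Sum>j<Polynomial.degree \<mu>. e j * kap \<theta> ^ j) = (\<Sum>j<Polynomial.degree \<mu>. e j * kap \<beta> ^ j)"
      if e: "\<And>j. e j \<in> series_over K" for e
    proof -
      have eG: "e j \<in> G" for j using e G(2) by blast
      show ?thesis
        by (simp add: hom_on_sum[OF G(1) \<sigma>(1)] hom_on_mult[OF G(1) \<sigma>(1)] hom_on_power[OF G(1) \<sigma>(1)]
            subring_mult[OF G(1)] subring_power[OF G(1)] G(3) eG \<sigma>(2)[OF e] \<sigma>(3))
    qed
    have \<sigma>y: "\<sigma> y = (\<Sum>j<Polynomial.degree \<mu>. \<eta> j * kap \<beta> ^ j)"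
      unfolding \<eta>(2) by (rule \<sigma>_sum) (rule \<eta>)
    have \<sigma>kap: "\<sigma> (kap l) \<in> DT" if l: "l \<in> L" for l
    proof -
      obtain k where k: "\<And>j. k j \<in> K" "l = (\<Sum>j<Polynomial.degree \<mu>. k j * \<theta> ^ j)"
        using simple_extension_basis[OF K \<theta> \<mu>] l unfolding L_def by blast
      have ks: "kap (\<Sum>j<Polynomial.degree \<mu>. k j * \<gamma> ^ j) = (\<Sum>j<Polynomial.degree \<mu>. kap (k j) * kap \<gamma> ^ j)" for \<gamma>
        by (simp add: kap_simps hom_on_sum[OF is_subring_UNIV kap_hom])
      have "\<sigma> (kap l) = kap (\<Sum>j<Polynomial.degree \<mu>. k j * \<beta> ^ j)"
        unfolding k(2) ks by (rule \<sigma>_sum) (rule kap_series_over[OF R k(1)])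
      thus ?thesis using DT(2) by auto
    qed
    have \<sigma>C: "\<sigma> c \<in> DT" if c: "c \<in> C" for c
    proof -
      have "c \<in> (\<lambda>p. ev kap p (shifted_var b)) ` mpolys L r"
        using c ev_image_eq_gen[OF L kap_hom, of "shifted_var b" r] by (simp add: C_def)
      then obtain p where p: "p \<in> mpolys L r" "c = ev kap p (shifted_var b)" by blast
      have "\<sigma> c = ev (\<lambda>l. \<sigma> (kap l)) p (\<lambda>i. \<sigma> (shifted_var b i))"
        unfolding p(2) by (rule hom_on_ev[OF G(1) \<sigma>(1) p(1)]) (use KG TS G(2) in blast)+
      also have "\<dots> \<in> DT"
        by (rule ev_in_subring[OF DT(1) p(1)]) (simp_all add: \<sigma>kap DT(3) \<sigma>(2)[OF TS])
      finally show ?thesis .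
    qed
    obtain g where g: "g \<in> pol C" "poly g y = 0" "poly (pderiv g) y \<noteq> 0"
      using root unfolding simple_root_def C_def L_def by blast
    have gG: "g \<in> pol G" using g(1) pol_mono[OF CG] by blast
    have "map_poly \<sigma> g \<in> pol DT"
      by (rule polI) (simp add: coeff_map_poly_hom[OF G(1) \<sigma>(1)] \<sigma>C polD[OF g(1)])
    moreover have "poly (map_poly \<sigma> g) (\<sigma> y) = 0"
      using hom_on_poly[OF G(1) \<sigma>(1) gG yG] g(2) hom_on_zero[OF G(1) \<sigma>(1)] by simp
    moreover have "poly (pderiv (map_poly \<sigma> g)) (\<sigma> y) \<noteq> 0"
    proof -
      have "poly (pderiv (map_poly \<sigma> g)) (\<sigma> y) = \<sigma> (poly (pderiv g) y)"
        using hom_on_poly[OF G(1) \<sigma>(1) pol_pderiv[OF G(1) gG] yG]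
        by (simp add: map_poly_hom_pderiv[OF G(1) \<sigma>(1) gG])
      thus ?thesis using \<sigma>(4)[OF poly_in_subring[OF G(1) pol_pderiv[OF G(1) gG] yG]] g(3) by auto
    qed
    ultimately show ?thesis unfolding simple_root_def \<sigma>y[symmetric] by blast
  qed
  have "simple_root (gen (kap ` K \<union> shifted_var b ` {..<r})) (\<eta> j)" if j: "j < Polynomial.degree \<mu>" for j
  proof (rule simple_root_descent[OF K b \<eta>(1)])
    define Z where "Z = {\<beta>. poly \<mu> \<beta> = 0}"
    have "\<mu> \<noteq> 0" using \<mu> by (simp add: least_vanishing_def)
    hence finZ: "finite Z" unfolding Z_def by (rule poly_roots_finite)
    have cardZ: "card Z = Polynomial.degree \<mu>" unfolding Z_def by (rule card_conjugates[OF K \<theta> \<mu>])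
    define v where "v = (\<lambda>\<beta>. \<Sum>i<Polynomial.degree \<mu>. \<eta> i * kap \<beta> ^ i)"
    obtain l where l: "\<eta> j = (\<Sum>\<beta>\<in>Z. v \<beta> * kap (l \<beta>))"
      using series_lagrange[OF finZ cardZ j, of \<eta>] unfolding v_def by blast
    \<comment> \<open>By interpolation \<open>\<eta> j\<close> is a combination, with constant
      multipliers, of the conjugates \<open>v \<beta>\<close>, so it inherits separability from
      them.\<close>
    have "v \<beta> \<in> gen (v ` Z \<union> DT)" "kap (l \<beta>) \<in> gen (v ` Z \<union> DT)" if "\<beta> \<in> Z" for \<beta>
      using that gen_superset[of "v ` Z \<union> DT"] DT(2) by auto
    hence \<eta>G: "\<eta> j \<in> gen (v ` Z \<union> DT)" unfolding l
      by (intro subring_sum[OF is_subring_gen] subring_mult[OF is_subring_gen])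
    have "simple_root DT z" if z: "z \<in> v ` Z" for z
    proof -
      obtain \<beta> where "poly \<mu> \<beta> = 0" "z = v \<beta>" using z unfolding Z_def by blast
      thus ?thesis unfolding v_def using conj_root by blast
    qed
    from simple_root_generated[OF DT(1) finite_imageI[OF finZ, of v] this \<eta>G subring_one[OF is_subring_gen] one_neq_zero]
    show "simple_root (gen (range kap \<union> shifted_var b ` {..<r})) (\<eta> j)"
      unfolding DT_def[symmetric] by simp
  qed
  thus ?thesis using \<eta> by blast
qed

section \<open>Embedding the function field into power series\<close>

text \<open>The least relation of \<open>1 / u\<close> is the linear polynomial
  \<open>u X - 1\<close>, and an inverse \<iota> of \<open>\<rho> u\<close> is a root of its
  image.\<close>

lemma extend_hom_inverse:
  fixes B :: "'a::field set" and \<rho> :: "'a \<Rightarrow> 'b::idom"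
  assumes B: "is_subring B" and \<rho>: "hom_on B \<rho>" and u: "u \<in> B" "u \<noteq> 0" and \<iota>: "\<rho> u * \<iota> = 1"
  shows "\<exists>\<rho>'. hom_on (gen (insert (1 / u) B)) \<rho>' \<and> (\<forall>a\<in>B. \<rho>' a = \<rho> a) \<and> \<rho>' (1 / u) = \<iota>"
proof -
  define f where "f = [:- 1, u:]"
  have fB: "f \<in> pol B" unfolding f_def
    by (intro pol_pCons pol_const[OF B] u subring_uminus[OF B] subring_one[OF B])
  have f: "least_vanishing B (1 / u) f" unfolding least_vanishing_def
  proof (intro conjI ballI impI fB)
    show "f \<noteq> 0" "poly f (1 / u) = 0" using u by (auto simp: f_def)
    fix g assume g: "g \<noteq> 0 \<and> poly g (1 / u) = 0"
    have "Polynomial.degree g \<noteq> 0"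
    proof
      assume "Polynomial.degree g = 0"
      then obtain c where "g = [:c:]" by (rule degree_eq_zeroE)
      thus False using g by simp
    qed
    thus "Polynomial.degree f \<le> Polynomial.degree g" by (simp add: f_def)
  qed
  have "map_poly \<rho> f = [:- 1, \<rho> u:]"
    unfolding f_def using u
    by (simp add: map_poly_hom_pCons[OF B \<rho>] pol_const[OF B] subring_uminus[OF B] subring_one[OF B]
        subring_zero[OF is_subring_pol[OF B]] hom_on_uminus[OF B \<rho>] hom_on_one[OF B \<rho>])
  hence root: "poly (map_poly \<rho> f) \<iota> = 0" using \<iota> by (simp add: mult.commute)
  have "lead_coeff f = u" using u by (simp add: f_def)
  moreover have "\<rho> u \<noteq> 0" using \<iota> by auto
  ultimately show ?thesis using extend_hom_algebraic[OF B \<rho> f _ root] by auto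
qed

lemma common_denominator:
  fixes K :: "'a::field set"
  assumes C: "finite C" "C \<subseteq> adjoin K S"
  shows "\<exists>q\<in>gen (K \<union> S). q \<noteq> 0 \<and> (\<forall>c\<in>C. q * c \<in> gen (K \<union> S))"
  using C
proof (induction C rule: finite_induct)
  case empty
  show ?case by (intro bexI[of _ 1] subring_one[OF is_subring_gen]) auto
next
  case (insert c C)
  then obtain q where q: "q \<in> gen (K \<union> S)" "q \<noteq> 0" "\<And>c. c \<in> C \<Longrightarrow> q * c \<in> gen (K \<union> S)" by auto
  obtain p d where pd: "p \<in> gen (K \<union> S)" "d \<in> gen (K \<union> S)" "d \<noteq> 0" "c = p / d"
    using adjoin_fraction insert.prems by blast
  note G = is_subring_gen[of "K \<union> S"]
  have "d * q * c = q * p" using pd by simp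
  hence 1: "d * q * c \<in> gen (K \<union> S)" using subring_mult[OF G q(1) pd(1)] by metis
  have 2: "d * q * e \<in> gen (K \<union> S)" if "e \<in> C" for e
    using subring_mult[OF G pd(2) q(3)[OF that]] by (simp add: mult.assoc)
  show ?case
    using 1 2 q(1,2) pd(2,3) subring_mult[OF G] by (intro bexI[of _ "d * q"]) auto
qed

lemma finite_range_coeff: "finite (range (poly.coeff p))"
proof (rule finite_subset)
  show "range (poly.coeff p) \<subseteq> insert 0 (poly.coeff p ` {..Polynomial.degree p})"
  proof (rule image_subsetI)
    fix i
    show "poly.coeff p i \<in> insert 0 (poly.coeff p ` {..Polynomial.degree p})"
      by (cases "i \<le> Polynomial.degree p") (auto simp: coeff_eq_0)
  qed
qed simp

lemma alg_independent_nonconstant: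
  assumes K: "is_subring K" and t: "alg_independent K r t" and i: "i < r"
  shows "t i \<notin> K"
proof
  assume ti: "t i \<in> K"
  have "mvar i - mconst (t i) \<in> mpolys K r"
    by (intro subring_diff[OF is_subring_mpolys[OF K]] mpolys_mvar mpolys_mconst subring_one[OF K] i ti)
  moreover have "meval (mvar i - mconst (t i)) t = 0" by (simp add: meval_simps)
  ultimately have "mvar i - mconst (t i) = 0" using t unfolding alg_independent_def by blast
  hence "meval (mvar i - mconst (t i)) (\<lambda>_. t i + 1) = meval 0 (\<lambda>_. t i + 1)" by (rule arg_cong)
  thus False by (simp add: meval_simps)
qed

section \<open>Places and power series expansions from rational points\<close>

context
  fixes K\<^sub>1 K\<^sub>2 :: "'a::alg_closed_field set" and n r :: nat and V :: "(nat \<Rightarrow> 'a) set"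
    and \<nu> :: "nat \<Rightarrow> 'a mpoly \<times> 'a mpoly" and x t :: "nat \<Rightarrow> 'a"
  assumes pac: "pac_in_domain K\<^sub>1 K\<^sub>2" and K\<^sub>2: "is_subfield K\<^sub>2" and r: "r \<ge> 1"
    and V: "abs_irreducible n V" "defined_over K\<^sub>2 n V" and \<nu>: "rational_map K\<^sub>2 n V r \<nu>" "dominating n V r \<nu>"
    and x: "generic_point K\<^sub>2 n V x"
    and t: "t = (\<lambda>i. meval (fst (\<nu> i)) x / meval (snd (\<nu> i)) x)"
    and sep: "separable_algebraic_extension (adjoin K\<^sub>2 (t ` {..<r})) (function_field K\<^sub>2 n x)"
begin

lemma parameters_independent: "alg_independent K\<^sub>2 r t"
  unfolding t by (rule dominatingD[OF K\<^sub>2 V(1) x \<nu>])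

text \<open>Evaluation at the point supplied by \<open>pac_specialization\<close>, extended to a
  localization of the coordinate ring containing \<open>z\<close>, \<open>s\<close> and the
  parameters. The nonzero element \<open>s\<close> is the means of excluding a closed
  subset.\<close>

lemma pac_place:
  assumes z: "z \<in> function_field K\<^sub>2 n x" and s: "s \<in> function_field K\<^sub>2 n x" "s \<noteq> 0"
  shows "\<exists>B \<rho>. is_subring B \<and> hom_on B \<rho> \<and> K\<^sub>2 \<subseteq> B \<and> (\<forall>k\<in>K\<^sub>2. \<rho> k = k) \<and>
    (\<forall>i<r. t i \<in> B \<and> \<rho> (t i) \<in> K\<^sub>1) \<and> z \<in> B \<and> \<rho> z \<in> K\<^sub>2 \<and> s \<in> B \<and> \<rho> s \<noteq> 0"
proof -
  note R = subfield_is_subring[OF K\<^sub>2]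
  note MP = is_subring_mpolys[OF R, of n]
  have frac: "\<exists>p q. p \<in> mpolys K\<^sub>2 n \<and> q \<in> mpolys K\<^sub>2 n \<and> meval q x \<noteq> 0 \<and> e = meval p x / meval q x"
    if "e \<in> function_field K\<^sub>2 n x" for e
    using adjoin_fraction[OF that[unfolded function_field_def]]
    unfolding meval_image_eq_gen[OF R, symmetric] by blast
  obtain pz qz where z': "pz \<in> mpolys K\<^sub>2 n" "qz \<in> mpolys K\<^sub>2 n" "meval qz x \<noteq> 0" "z = meval pz x / meval qz x"
    using frac[OF z] by blast
  obtain ps qs where s': "ps \<in> mpolys K\<^sub>2 n" "qs \<in> mpolys K\<^sub>2 n" "meval qs x \<noteq> 0" "s = meval ps x / meval qs x"
    using frac[OF s(1)] by blast
  have psx: "meval ps x \<noteq> 0" using s(2) s'(4) by auto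
  have \<nu>': "fst (\<nu> i) \<in> mpolys K\<^sub>2 n" "snd (\<nu> i) \<in> mpolys K\<^sub>2 n" "meval (snd (\<nu> i)) x \<noteq> 0" if "i < r" for i
    using \<nu> that generic_point_nonzero[OF x] by (auto simp: rational_map_def)
  \<comment> \<open>The denominators \<open>qz\<close> and \<open>qs\<close> must not vanish for
    \<open>z\<close> and \<open>s\<close> to have values; the numerator \<open>ps\<close> is added
    to make the value of \<open>s\<close> nonzero.\<close>
  have "qz * qs * ps \<in> mpolys K\<^sub>2 n" using z' s' by (intro subring_mult[OF MP])
  moreover have "meval (qz * qs * ps) x \<noteq> 0" using z' s' psx by (simp add: meval_mult)
  ultimately have "\<exists>a\<in>V. (\<forall>i. a i \<in> K\<^sub>2) \<and> meval (qz * qs * ps) a \<noteq> 0 \<and>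
    (\<forall>i<r. meval (snd (\<nu> i)) a \<noteq> 0 \<and> meval (fst (\<nu> i)) a / meval (snd (\<nu> i)) a \<in> K\<^sub>1)"
    by (rule pac_specialization[OF pac K\<^sub>2 r V \<nu> x sep[unfolded t]])
  then obtain a where a: "a \<in> V" "\<And>i. a i \<in> K\<^sub>2" "meval (qz * qs * ps) a \<noteq> 0"
    "\<And>i. i < r \<Longrightarrow> meval (snd (\<nu> i)) a \<noteq> 0"
    "\<And>i. i < r \<Longrightarrow> meval (fst (\<nu> i)) a / meval (snd (\<nu> i)) a \<in> K\<^sub>1" by blast
  have a_nz: "meval qz a \<noteq> 0" "meval qs a \<noteq> 0" "meval ps a \<noteq> 0" using a(3) by (auto simp: meval_mult)
  have a_in: "meval p a \<in> K\<^sub>2" if "p \<in> mpolys K\<^sub>2 n" for p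
    unfolding meval_eq_ev by (rule ev_in_subring[OF R that]) (use a(2) in auto)
  define B\<^sub>0 where "B\<^sub>0 = gen (K\<^sub>2 \<union> x ` {..<n})"
  have B\<^sub>0_eq: "B\<^sub>0 = (\<lambda>p. meval p x) ` mpolys K\<^sub>2 n" unfolding B\<^sub>0_def by (rule meval_image_eq_gen[OF R, symmetric])
  have B\<^sub>0: "is_subring B\<^sub>0" unfolding B\<^sub>0_def by (rule is_subring_gen)
  have hom: "hom_on (mpolys K\<^sub>2 n) (\<lambda>p. meval p y)" for y unfolding meval_eq_ev by (rule ev_hom_on[OF id_hom])
  have "\<exists>\<rho>. hom_on B\<^sub>0 \<rho> \<and> (\<forall>p\<in>mpolys K\<^sub>2 n. \<rho> (meval p x) = meval p a)"
    unfolding B\<^sub>0_eq by (rule hom_on_from_relation[OF MP hom hom])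
      (use x a(1) in \<open>simp add: generic_point_def\<close>)
  then obtain \<rho>\<^sub>0 where \<rho>\<^sub>0: "hom_on B\<^sub>0 \<rho>\<^sub>0" "\<And>p. p \<in> mpolys K\<^sub>2 n \<Longrightarrow> \<rho>\<^sub>0 (meval p x) = meval p a" by blast
  \<comment> \<open>The product of the denominators alone; its single inverse makes all the required
    fractions available.\<close>
  define w where "w = qz * qs * (\<Prod>i<r. snd (\<nu> i))"
  have w: "w \<in> mpolys K\<^sub>2 n" unfolding w_def
    using z' s' \<nu>' by (intro subring_mult[OF MP] subring_prod[OF MP]) auto
  have w_ev: "meval w y = meval qz y * meval qs y * (\<Prod>i<r. meval (snd (\<nu> i)) y)" for y
    by (simp add: w_def meval_simps)
  have wx: "meval w x \<noteq> 0" using z' s' \<nu>' by (simp add: w_ev)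
  have wa: "meval w a \<noteq> 0" using a_nz a(4) by (simp add: w_ev)
  have "\<rho>\<^sub>0 (meval w x) * (1 / meval w a) = 1" using \<rho>\<^sub>0(2)[OF w] wa by simp
  moreover have "meval w x \<in> B\<^sub>0" using w B\<^sub>0_eq by blast
  ultimately obtain \<rho> where \<rho>: "hom_on (gen (insert (1 / meval w x) B\<^sub>0)) \<rho>" "\<And>e. e \<in> B\<^sub>0 \<Longrightarrow> \<rho> e = \<rho>\<^sub>0 e"
    using extend_hom_inverse[OF B\<^sub>0 \<rho>\<^sub>0(1) _ wx] by blast
  define B where "B = gen (insert (1 / meval w x) B\<^sub>0)"
  have B: "is_subring B" "B\<^sub>0 \<subseteq> B" "1 / meval w x \<in> B"
    using is_subring_gen[of "insert (1 / meval w x) B\<^sub>0", folded B_def]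
      gen_superset[of "insert (1 / meval w x) B\<^sub>0", folded B_def] by auto
  note \<rho> = \<rho>[folded B_def]
  have mB: "meval p x \<in> B" "\<rho> (meval p x) = meval p a" if "p \<in> mpolys K\<^sub>2 n" for p
  proof -
    have "meval p x \<in> B\<^sub>0" using that B\<^sub>0_eq by blast
    thus "meval p x \<in> B" "\<rho> (meval p x) = meval p a" using B(2) \<rho>(2) \<rho>\<^sub>0(2)[OF that] by auto
  qed
  have fracB: "meval p x / meval q x \<in> B \<and> \<rho> (meval p x / meval q x) = meval p a / meval q a"
    if p: "p \<in> mpolys K\<^sub>2 n" and q: "q \<in> mpolys K\<^sub>2 n" "meval q x \<noteq> 0" "meval q a \<noteq> 0"
      and q': "q' \<in> mpolys K\<^sub>2 n" "w = q * q'" for p q q'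
  proof -
    have "meval w x = meval q x * meval q' x" by (simp add: q'(2) meval_mult)
    hence "meval p x / meval q x = meval p x * meval q' x * (1 / meval w x)"
      using q wx by (auto simp: field_simps)
    also have "\<dots> \<in> B" using mB p q' B by (intro subring_mult[OF B(1)]) auto
    finally have 1: "meval p x / meval q x \<in> B" .
    have "\<rho> (meval p x / meval q x * meval q x) = \<rho> (meval p x / meval q x) * \<rho> (meval q x)"
      by (rule hom_on_mult[OF B(1) \<rho>(1) 1 mB(1)[OF q(1)]])
    hence "\<rho> (meval p x / meval q x) * meval q a = meval p a" using q mB(2) p by simp
    thus ?thesis using 1 q by (simp add: field_simps)
  qed
  have zB: "z \<in> B \<and> \<rho> z = meval pz a / meval qz a" unfolding z'(4)
    by (rule fracB[OF z'(1,2,3) a_nz(1), of "qs * (\<Prod>i<r. snd (\<nu> i))"])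
       (use s' \<nu>' in \<open>auto simp: w_def mult.assoc intro!: subring_mult[OF MP] subring_prod[OF MP]\<close>)
  have sB: "s \<in> B \<and> \<rho> s = meval ps a / meval qs a" unfolding s'(4)
    by (rule fracB[OF s'(1,2,3) a_nz(2), of "qz * (\<Prod>i<r. snd (\<nu> i))"])
       (use z' \<nu>' in \<open>auto simp: w_def mult_ac intro!: subring_mult[OF MP] subring_prod[OF MP]\<close>)
  have tB: "t i \<in> B \<and> \<rho> (t i) = meval (fst (\<nu> i)) a / meval (snd (\<nu> i)) a" if i: "i < r" for i
    unfolding t
  proof (rule fracB[OF \<nu>'[OF i] a(4)[OF i], of "qz * qs * (\<Prod>j\<in>{..<r} - {i}. snd (\<nu> j))"])
    show "qz * qs * (\<Prod>j\<in>{..<r} - {i}. snd (\<nu> j)) \<in> mpolys K\<^sub>2 n"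
      using z' s' \<nu>' by (intro subring_mult[OF MP] subring_prod[OF MP]) auto
    have "(\<Prod>j<r. snd (\<nu> j)) = snd (\<nu> i) * (\<Prod>j\<in>{..<r} - {i}. snd (\<nu> j))"
      by (rule prod.remove) (use i in auto)
    thus "w = snd (\<nu> i) * (qz * qs * (\<Prod>j\<in>{..<r} - {i}. snd (\<nu> j)))" unfolding w_def by (simp only: mult_ac)
  qed
  have kB: "k \<in> B \<and> \<rho> k = k" if "k \<in> K\<^sub>2" for k
    using mB[OF mpolys_mconst[OF that]] by (simp add: meval_simps)
  have "\<rho> z \<in> K\<^sub>2" using zB a_in z' by (auto intro!: subfield_divide[OF K\<^sub>2])
  moreover have "\<rho> s \<noteq> 0" using sB a_nz by simp
  ultimately show ?thesis using B(1) \<rho>(1) kB tB a(5) zB sB by (intro exI[of _ B] exI[of _ \<rho>]) auto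
qed

lemma parameters_in_function_field: "adjoin K\<^sub>2 (t ` {..<r}) \<subseteq> function_field K\<^sub>2 n x"
  using sep by (simp add: separable_algebraic_extension_def field_extension_def)

text \<open>Otherwise the product of all \<open>t 0 - k\<close> with \<open>k\<close> in
  \<open>K\<^sub>1\<close> would be a nonzero element of the function field, since
  \<open>t 0\<close> lies outside \<open>K\<^sub>2\<close>. A place not killing it contradicts that
  the value of \<open>t 0\<close> is one of these \<open>k\<close>. The primitive element theorem
  relies on this.\<close>

lemma pac_base_infinite:
  assumes K\<^sub>1: "K\<^sub>1 \<subseteq> K\<^sub>2"
  shows "infinite K\<^sub>1"
proof
  note R = subfield_is_subring[OF K\<^sub>2]
  assume fin: "finite K\<^sub>1"
  define s where "s = (\<Prod>k\<in>K\<^sub>1. t 0 - k)"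
  have "t 0 \<notin> K\<^sub>2" using alg_independent_nonconstant[OF R parameters_independent] r by simp
  hence nz: "s \<noteq> 0" unfolding s_def using fin K\<^sub>1 by (auto simp: prod_zero_iff)
  have "t 0 \<in> adjoin K\<^sub>2 (t ` {..<r})" using adjoin_generators[of "t ` {..<r}" K\<^sub>2] r by auto
  hence t0: "t 0 \<in> function_field K\<^sub>2 n x" using parameters_in_function_field by blast
  have ff: "is_subring (function_field K\<^sub>2 n x)" "K\<^sub>2 \<subseteq> function_field K\<^sub>2 n x"
    unfolding function_field_def by (rule subfield_is_subring[OF is_subfield_adjoin], rule adjoin_base)
  have "s \<in> function_field K\<^sub>2 n x" unfolding s_def
    by (intro subring_prod[OF ff(1)] subring_diff[OF ff(1)] t0) (use K\<^sub>1 ff(2) in blast)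
  from pac_place[OF t0 this nz] obtain B \<rho> where B: "is_subring B" "hom_on B \<rho>" "K\<^sub>2 \<subseteq> B"
    "\<And>k. k \<in> K\<^sub>2 \<Longrightarrow> \<rho> k = k" "\<And>i. i < r \<Longrightarrow> t i \<in> B \<and> \<rho> (t i) \<in> K\<^sub>1" "\<rho> s \<noteq> 0" by blast
  have t0B: "t 0 \<in> B" "\<rho> (t 0) \<in> K\<^sub>1" using B(5)[of 0] r by auto
  have "\<rho> s = (\<Prod>k\<in>K\<^sub>1. \<rho> (t 0 - k))" unfolding s_def
    using t0B B(3) K\<^sub>1 by (intro hom_on_prod[OF B(1,2)] subring_diff[OF B(1)]) auto
  also have "\<dots> = 0"
  proof (rule prod_zero[OF fin])
    have c: "\<rho> (t 0) \<in> K\<^sub>2" using t0B(2) K\<^sub>1 by blast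
    have "\<rho> (t 0 - \<rho> (t 0)) = \<rho> (t 0) - \<rho> (\<rho> (t 0))"
      by (rule hom_on_diff[OF B(1,2) t0B(1) subsetD[OF B(3) c]])
    hence "\<rho> (t 0 - \<rho> (t 0)) = 0" using B(4)[OF c] by simp
    thus "\<exists>k\<in>K\<^sub>1. \<rho> (t 0 - k) = 0" using t0B(2) by (intro bexI[of _ "\<rho> (t 0)"]) auto
  qed
  finally show False using B(6) by simp
qed

text \<open>A primitive element \<open>z\<close> of the function field over
  \<open>K\<^sub>2(t)\<close> reduces everything to one root of one polynomial \<open>f\<close> over
  \<open>K\<^sub>2[t]\<close>. Where the place keeps \<open>f'(z)\<close> nonzero, Hensel's lemma
  lifts the value of \<open>z\<close> to a series. Only finitely many constants of
  \<open>K\<^sub>2\<close> occur, so one \<theta> suffices.\<close>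

theorem pac_embedding:
  fixes N :: nat and y :: "nat \<Rightarrow> 'a"
  assumes K\<^sub>1: "is_subfield K\<^sub>1" "K\<^sub>1 \<subseteq> K\<^sub>2" "\<And>k. k \<in> K\<^sub>2 \<Longrightarrow> simple_root K\<^sub>1 k"
    and y: "\<And>i. i < N \<Longrightarrow> y i \<in> function_field K\<^sub>2 n x"
  shows "\<exists>b \<theta> M \<Phi>. (\<forall>i<r. b i \<in> K\<^sub>1) \<and> \<theta> \<in> K\<^sub>2 \<and> is_subring M \<and> hom_on M \<Phi> \<and> K\<^sub>2 \<subseteq> M \<and>
    (\<forall>k\<in>K\<^sub>2. \<Phi> k = kap k) \<and> (\<forall>i<r. t i \<in> M \<and> \<Phi> (t i) = shifted_var b i) \<and>
    (\<forall>i<N. y i \<in> M \<and> \<Phi> (y i) \<in> series_over (gen (insert \<theta> K\<^sub>1)) \<and>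
      simple_root (gen (kap ` gen (insert \<theta> K\<^sub>1) \<union> shifted_var b ` {..<r})) (\<Phi> (y i)))"
proof -
  note R = subfield_is_subring[OF K\<^sub>2]
  note ind = parameters_independent
  define F where "F = adjoin K\<^sub>2 (t ` {..<r})"
  define E\<^sub>0 where "E\<^sub>0 = function_field K\<^sub>2 n x"
  have F: "is_subfield F" "K\<^sub>2 \<subseteq> F" "t ` {..<r} \<subseteq> F"
    unfolding F_def by (rule is_subfield_adjoin, rule adjoin_base, rule adjoin_generators)
  note FR = subfield_is_subring[OF F(1)]
  have E\<^sub>0: "is_subfield E\<^sub>0" "K\<^sub>2 \<subseteq> E\<^sub>0" "x ` {..<n} \<subseteq> E\<^sub>0"
    unfolding E\<^sub>0_def function_field_def by (rule is_subfield_adjoin, rule adjoin_base, rule adjoin_generators)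
  note E\<^sub>0R = subfield_is_subring[OF E\<^sub>0(1)]
  have FE\<^sub>0: "F \<subseteq> E\<^sub>0" unfolding F_def E\<^sub>0_def by (rule parameters_in_function_field)
  have E\<^sub>0sep: "simple_root F e" if "e \<in> E\<^sub>0" for e
  proof (rule separable_over_imp_simple_root)
    show "separable_over F e"
      using sep that by (simp add: separable_algebraic_extension_def F_def E\<^sub>0_def)
  qed
  have K\<^sub>1inf: "infinite K\<^sub>1" by (rule pac_base_infinite[OF K\<^sub>1(2)])
  hence Finf: "infinite F" using finite_subset[of K\<^sub>1 F] F(2) K\<^sub>1(2) by blast
  have "\<exists>z\<in>gen (x ` {..<n} \<union> F). x ` {..<n} \<subseteq> gen (insert z F)"
    by (rule primitive_element[OF F(1) Finf finite_imageI[OF finite_lessThan] E\<^sub>0sep[OF subsetD[OF E\<^sub>0(3)]]])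
  then obtain z where z: "z \<in> gen (x ` {..<n} \<union> F)" "x ` {..<n} \<subseteq> gen (insert z F)" by blast
  have "gen (x ` {..<n} \<union> F) \<subseteq> E\<^sub>0" by (rule gen_least[OF E\<^sub>0R]) (use E\<^sub>0(3) FE\<^sub>0 in blast)
  hence zE\<^sub>0: "z \<in> E\<^sub>0" using z(1) by blast
  have "is_subfield (gen (insert z F))"
    by (rule is_subfield_simple_extension[OF F(1) simple_root_algebraic[OF E\<^sub>0sep[OF zE\<^sub>0]]])
  moreover have "K\<^sub>2 \<subseteq> gen (insert z F)" using F(2) gen_superset[of "insert z F"] by blast
  ultimately have E\<^sub>0z: "E\<^sub>0 \<subseteq> gen (insert z F)"
    unfolding E\<^sub>0_def function_field_def using z(2) by (rule adjoin_least)
  have "\<forall>i\<in>{..<N}. \<exists>P. P \<in> pol F \<and> y i = poly P z"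
  proof
    fix i assume "i \<in> {..<N}"
    hence "y i \<in> gen (insert z F)" using y[of i] E\<^sub>0z unfolding E\<^sub>0_def by blast
    thus "\<exists>P. P \<in> pol F \<and> y i = poly P z" unfolding gen_insert_eq[OF FR] by blast
  qed
  from bchoice[OF this] obtain P where P: "\<And>i. i < N \<Longrightarrow> P i \<in> pol F" "\<And>i. i < N \<Longrightarrow> y i = poly (P i) z" by blast
  obtain g where g: "g \<in> pol F" "poly g z = 0" "poly (pderiv g) z \<noteq> 0"
    using E\<^sub>0sep[OF zE\<^sub>0] unfolding simple_root_def by blast
  define A where "A = gen (K\<^sub>2 \<union> t ` {..<r})"
  have A: "is_subring A" unfolding A_def by (rule is_subring_gen)
  have A_eq: "A = (\<lambda>p. meval p t) ` mpolys K\<^sub>2 r" unfolding A_def by (rule meval_image_eq_gen[OF R, symmetric])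
  have AF: "A \<subseteq> F" unfolding A_def F_def by (rule gen_subset_adjoin)
  have KA: "K\<^sub>2 \<subseteq> A" "\<And>i. i < r \<Longrightarrow> t i \<in> A"
    using gen_superset[of "K\<^sub>2 \<union> t ` {..<r}", folded A_def] by auto
  \<comment> \<open>The relation \<open>g\<close> of \<open>z\<close> and the expressions
    \<open>P i\<close> of \<open>y i\<close> in terms of \<open>z\<close> have coefficients in
    \<open>K\<^sub>2(t)\<close>; one denominator \<open>q\<close> moves all of them into
    \<open>K\<^sub>2[t]\<close>.\<close>
  have "finite (range (poly.coeff g) \<union> (\<Union>i<N. range (poly.coeff (P i))))"
    by (intro finite_UnI finite_range_coeff finite_UN_I finite_lessThan)
  moreover have "range (poly.coeff g) \<union> (\<Union>i<N. range (poly.coeff (P i))) \<subseteq> adjoin K\<^sub>2 (t ` {..<r})"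
    unfolding F_def[symmetric] using polD[OF g(1)] polD[OF P(1)] by auto
  ultimately obtain q where q: "q \<in> A" "q \<noteq> 0"
    "\<And>c. c \<in> range (poly.coeff g) \<union> (\<Union>i<N. range (poly.coeff (P i))) \<Longrightarrow> q * c \<in> A"
    using common_denominator unfolding A_def by meson
  define Q where "Q = (\<lambda>i. smult q (P i))"
  have Q: "Q i \<in> pol A" if "i < N" for i
    unfolding Q_def by (rule polI, unfold coeff_smult, rule q(3)) (use that in blast)
  have qg: "smult q g \<in> pol A" by (rule polI, unfold coeff_smult, rule q(3)) blast
  have "simple_root A z" unfolding simple_root_def
    by (rule bexI[OF _ qg]) (use g q(2) in \<open>auto simp: pderiv_smult\<close>)
  then obtain f where f: "least_vanishing A z f" and f'z: "poly (pderiv f) z \<noteq> 0"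
    using algebraic_on_least_vanishing[OF simple_root_algebraic] least_vanishing_simple[OF A] by blast
  have fA: "f \<in> pol A" "f \<noteq> 0" "poly f z = 0" using f by (auto simp: least_vanishing_def)
  \<comment> \<open>A place that does not kill \<open>s\<close> makes the denominator
    \<open>q\<close> invertible as a series and the Hensel slope nonzero at the same time.\<close>
  define s where "s = q * poly (pderiv f) z"
  have AE\<^sub>0: "A \<subseteq> E\<^sub>0" using AF FE\<^sub>0 by blast
  have s: "s \<in> E\<^sub>0" "s \<noteq> 0"
  proof -
    have "poly (pderiv f) z \<in> E\<^sub>0"
      by (rule poly_in_subring[OF E\<^sub>0R _ zE\<^sub>0]) (use pol_pderiv[OF A fA(1)] pol_mono[OF AE\<^sub>0] in blast)
    thus "s \<in> E\<^sub>0" unfolding s_def using q(1) AE\<^sub>0 by (intro subring_mult[OF E\<^sub>0R]) auto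
    show "s \<noteq> 0" using q(2) f'z by (simp add: s_def)
  qed
  from pac_place[OF zE\<^sub>0[unfolded E\<^sub>0_def] s(1)[unfolded E\<^sub>0_def] s(2)] obtain B \<rho> where
    B: "is_subring B" "hom_on B \<rho>" "K\<^sub>2 \<subseteq> B" and \<rho>K: "\<And>k. k \<in> K\<^sub>2 \<Longrightarrow> \<rho> k = k"
    and \<rho>t: "\<And>i. i < r \<Longrightarrow> t i \<in> B \<and> \<rho> (t i) \<in> K\<^sub>1" and zB: "z \<in> B" "\<rho> z \<in> K\<^sub>2" and \<rho>s: "\<rho> s \<noteq> 0"
    by blast
  have AB: "A \<subseteq> B" unfolding A_def by (rule gen_least[OF B(1)]) (use B(3) \<rho>t in auto)
  have \<rho>s': "\<rho> q \<noteq> 0" "\<rho> (poly (pderiv f) z) \<noteq> 0"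
  proof -
    have "poly (pderiv f) z \<in> B"
      by (rule poly_in_subring[OF B(1) _ zB(1)]) (use pol_pderiv[OF A fA(1)] pol_mono[OF AB] in blast)
    moreover have "q \<in> B" using q(1) AB by blast
    ultimately have "\<rho> s = \<rho> q * \<rho> (poly (pderiv f) z)" unfolding s_def by (intro hom_on_mult[OF B(1,2)])
    thus "\<rho> q \<noteq> 0" "\<rho> (poly (pderiv f) z) \<noteq> 0" using \<rho>s by auto
  qed
  define b where "b = (\<lambda>i. \<rho> (t i))"
  have b: "b i \<in> K\<^sub>1" if "i < r" for i using \<rho>t[OF that] by (simp add: b_def)
  have hom_t: "hom_on (mpolys K\<^sub>2 r) (\<lambda>p. meval p t)" unfolding meval_eq_ev by (rule ev_hom_on[OF id_hom])
  have "\<exists>\<phi>. hom_on A \<phi> \<and> (\<forall>p\<in>mpolys K\<^sub>2 r. \<phi> (meval p t) = ev kap p (shifted_var b))"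
    unfolding A_eq
  proof (rule hom_on_from_relation[OF is_subring_mpolys[OF R] hom_t ev_hom_on[OF kap_hom]])
    fix p assume "p \<in> mpolys K\<^sub>2 r" "meval p t = 0"
    hence "p = 0" using ind unfolding alg_independent_def by blast
    thus "ev kap p (shifted_var b) = 0" by (simp add: ev_zero[OF kap_hom])
  qed
  then obtain \<phi> where \<phi>: "hom_on A \<phi>" "\<And>p. p \<in> mpolys K\<^sub>2 r \<Longrightarrow> \<phi> (meval p t) = ev kap p (shifted_var b)" by blast
  have \<phi>_inj: "a = 0" if "a \<in> A" "\<phi> a = 0" for a
  proof -
    obtain p where p: "p \<in> mpolys K\<^sub>2 r" "a = meval p t" using \<open>a \<in> A\<close> A_eq by blast
    hence "p = 0" using \<phi>(2)[OF p(1)] \<open>\<phi> a = 0\<close> by (intro shifted_var_independent[of p b]) simp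
    thus ?thesis using p(2) by (simp add: meval_simps)
  qed
  have \<phi>K: "\<phi> k = kap k" if "k \<in> K\<^sub>2" for k
    using \<phi>(2)[OF mpolys_mconst[OF that]] by (simp add: meval_simps ev_single[OF kap_hom])
  have \<phi>t: "\<phi> (t i) = shifted_var b i" if "i < r" for i
    using \<phi>(2)[OF mpolys_mvar[OF subring_one[OF R] that]] by (simp add: meval_simps ev_mvar[OF kap_hom])
  \<comment> \<open>Both sides fix the constants of \<open>K\<^sub>2\<close> and send
    \<open>t i\<close> to \<open>b i\<close>: the constant term of the expansion is the
    place.\<close>
  have nth_\<phi>: "fps_nth (\<phi> a) 0 = mconst (\<rho> a)" if "a \<in> A" for a
  proof -
    obtain p where p: "p \<in> mpolys K\<^sub>2 r" "a = meval p t" using \<open>a \<in> A\<close> A_eq by blast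
    have "\<rho> a = ev (\<lambda>k. \<rho> k) p (\<lambda>i. \<rho> (t i))"
      unfolding p(2) meval_eq_ev by (rule hom_on_ev[OF B(1,2) p(1)]) (use B(3) \<rho>t in auto)
    also have "\<dots> = meval p b" unfolding meval_eq_ev by (rule ev_cong[OF p(1)]) (auto simp: b_def \<rho>K)
    finally show ?thesis unfolding p(2) \<phi>(2)[OF p(1)] nth_0_ev_shifted_var by simp
  qed
  have nth_eval: "fps_nth (poly (map_poly \<phi> p) w) 0 = mconst (\<rho> (poly p z))"
    if p: "p \<in> pol A" and w: "fps_nth w 0 = mconst (\<rho> z)" for p w
  proof -
    have "fps_nth (poly (map_poly \<phi> p) w) 0 = poly (map_poly (\<lambda>g. fps_nth g 0) (map_poly \<phi> p)) (fps_nth w 0)"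
      by (rule hom_on_poly[OF is_subring_UNIV nth_0_hom]) (auto simp: pol_def)
    also have "map_poly (\<lambda>g. fps_nth g 0) (map_poly \<phi> p) = map_poly (\<lambda>a. mconst (\<rho> a)) p"
      by (rule poly_eqI)
         (simp add: coeff_map_poly hom_on_zero[OF A \<phi>(1)] hom_on_zero[OF B(1,2)] nth_\<phi> polD[OF p])
    also have "poly (map_poly (\<lambda>a. mconst (\<rho> a)) p) (fps_nth w 0) = mconst (\<rho> (poly p z))"
      unfolding w
      by (rule hom_on_poly[OF B(1) hom_on_comp[OF B(2) subset_UNIV mconst_hom] _ zB(1), symmetric])
         (use p pol_mono[OF AB] in blast)
    finally show ?thesis .
  qed
  \<comment> \<open>The finitely many elements of \<open>K\<^sub>2[t]\<close> whose expansions enter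
    the construction: the coefficients of \<open>f\<close> and of all \<open>Q i\<close>, and the
    denominator \<open>q\<close>.\<close>
  define FA where "FA = insert q (range (poly.coeff f) \<union> (\<Union>i<N. range (poly.coeff (Q i))))"
  have "finite FA" unfolding FA_def
    by (intro finite.insertI finite_UnI finite_range_coeff finite_UN_I finite_lessThan)
  have FA: "FA \<subseteq> A" unfolding FA_def using q(1) polD[OF fA(1)] polD[OF Q] by auto
  have "\<forall>a\<in>FA. \<exists>p. p \<in> mpolys K\<^sub>2 r \<and> a = meval p t" using FA A_eq by blast
  from bchoice[OF this] obtain rp where rp: "\<And>a. a \<in> FA \<Longrightarrow> rp a \<in> mpolys K\<^sub>2 r"
    "\<And>a. a \<in> FA \<Longrightarrow> a = meval (rp a) t" by blast
  \<comment> \<open>Besides the constants occurring in \<open>FA\<close>, the value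
    \<open>\<rho> z\<close> is included, since it is the starting point of the Hensel iteration over
    \<open>L\<close>.\<close>
  define C where "C = insert (\<rho> z) (\<Union>a\<in>FA. coef (rp a) ` Poly_Mapping.keys (rp a))"
  have C: "finite C" "C \<subseteq> K\<^sub>2"
    unfolding C_def using \<open>finite FA\<close> zB(2) mpolys_coef[OF subring_zero[OF R] rp(1)] by auto
  have "\<exists>\<theta>\<in>gen (C \<union> K\<^sub>1). C \<subseteq> gen (insert \<theta> K\<^sub>1)"
    by (rule primitive_element[OF K\<^sub>1(1) K\<^sub>1inf C(1)]) (use C(2) K\<^sub>1(3) in blast)
  then obtain \<theta> where \<theta>: "\<theta> \<in> gen (C \<union> K\<^sub>1)" "C \<subseteq> gen (insert \<theta> K\<^sub>1)" by blast
  have "gen (C \<union> K\<^sub>1) \<subseteq> K\<^sub>2" by (rule gen_least[OF R]) (use C(2) K\<^sub>1(2) in blast)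
  hence \<theta>K: "\<theta> \<in> K\<^sub>2" using \<theta>(1) by blast
  define L where "L = gen (insert \<theta> K\<^sub>1)"
  have L: "is_subfield L" unfolding L_def
    by (rule is_subfield_simple_extension[OF K\<^sub>1(1) simple_root_algebraic[OF K\<^sub>1(3)[OF \<theta>K]]])
  note LR = subfield_is_subring[OF L]
  have K\<^sub>1L: "K\<^sub>1 \<subseteq> L" unfolding L_def using gen_superset[of "insert \<theta> K\<^sub>1"] by blast
  have CL: "C \<subseteq> L" unfolding L_def by (rule \<theta>(2))
  note S = is_subring_series_over[OF LR]
  define D where "D = gen (kap ` L \<union> shifted_var b ` {..<r})"
  have D: "is_subring D" unfolding D_def by (rule is_subring_gen)
  have D_eq: "D = (\<lambda>p. ev kap p (shifted_var b)) ` mpolys L r"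
    unfolding D_def by (rule ev_image_eq_gen[OF LR kap_hom, symmetric])
  have TL: "shifted_var b i \<in> series_over L" if "i < r" for i
    using shifted_var_series_over[OF LR, of b i] b[OF that] K\<^sub>1L by blast
  have DS: "D \<subseteq> series_over L" unfolding D_def
    by (rule gen_least[OF S]) (use kap_series_over[OF LR] TL in auto)
  have \<phi>FA: "\<phi> a \<in> D" if a: "a \<in> FA" for a
  proof -
    have "rp a \<in> mpolys L r"
    proof -
      have "coef (rp a) k \<in> L" if "k \<in> Poly_Mapping.keys (rp a)" for k
        using CL a that unfolding C_def by blast
      thus ?thesis using rp(1)[OF a] by (simp add: mpolys_def)
    qed
    thus ?thesis using rp(2)[OF a] \<phi>(2)[OF rp(1)[OF a]] D_eq by auto
  qed
  have fD: "map_poly \<phi> f \<in> pol D"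
    by (rule polI) (simp add: coeff_map_poly_hom[OF A \<phi>(1)] \<phi>FA FA_def)
  have QD: "map_poly \<phi> (Q i) \<in> pol D" if "i < N" for i
  proof (rule polI)
    fix j
    have "poly.coeff (Q i) j \<in> FA" unfolding FA_def using that by blast
    thus "poly.coeff (map_poly \<phi> (Q i)) j \<in> D" by (simp add: coeff_map_poly_hom[OF A \<phi>(1)] \<phi>FA)
  qed
  have qD: "\<phi> q \<in> D" by (rule \<phi>FA) (simp add: FA_def)
  \<comment> \<open>Shows that scalars such as the Hensel slope lie in \<open>L\<close>: each is the
    constant term of a series over \<open>L\<close>.\<close>
  have inL: "u \<in> L" if "g \<in> series_over L" "fps_nth g 0 = mconst u" for g u
  proof -
    have "coef (fps_nth g 0) 0 \<in> L" using that(1) by (simp add: series_over_def)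
    thus ?thesis by (simp add: that(2))
  qed
  have \<rho>zL: "\<rho> z \<in> L" using CL by (auto simp: C_def)
  have kap0: "fps_nth (kap c) 0 = mconst c" for c :: 'a by (simp add: kap_def)
  have fS: "map_poly \<phi> f \<in> pol (series_over L)" using fD pol_mono[OF DS] by blast
  have pderiv_f: "pderiv (map_poly \<phi> f) = map_poly \<phi> (pderiv f)"
    by (rule map_poly_hom_pderiv[OF A \<phi>(1) fA(1), symmetric])
  have "\<exists>\<zeta>\<in>series_over L. poly (map_poly \<phi> f) \<zeta> = 0 \<and> fps_nth \<zeta> 0 = mconst (\<rho> z)"
  proof (rule series_hensel[OF L fS \<rho>zL])
    show "fps_nth (poly (map_poly \<phi> f) (kap (\<rho> z))) 0 = 0"
      using nth_eval[OF fA(1) kap0] fA(3) hom_on_zero[OF B(1,2)] by simp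
    show d: "fps_nth (poly (pderiv (map_poly \<phi> f)) (kap (\<rho> z))) 0 = mconst (\<rho> (poly (pderiv f) z))"
      unfolding pderiv_f by (rule nth_eval[OF pol_pderiv[OF A fA(1)] kap0])
    show "\<rho> (poly (pderiv f) z) \<in> L"
      by (rule inL[OF poly_in_subring[OF S pol_pderiv[OF S fS] kap_series_over[OF LR \<rho>zL]] d])
    show "\<rho> (poly (pderiv f) z) \<noteq> 0" by (rule \<rho>s')
  qed
  then obtain \<zeta> where \<zeta>: "\<zeta> \<in> series_over L" "poly (map_poly \<phi> f) \<zeta> = 0" "fps_nth \<zeta> 0 = mconst (\<rho> z)" by blast
  have \<zeta>sep: "simple_root D \<zeta>"
  proof -
    have "fps_nth (poly (pderiv (map_poly \<phi> f)) \<zeta>) 0 = mconst (\<rho> (poly (pderiv f) z))"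
      unfolding pderiv_f by (rule nth_eval[OF pol_pderiv[OF A fA(1)] \<zeta>(3)])
    moreover have "mconst (\<rho> (poly (pderiv f) z)) \<noteq> 0"
    proof
      assume "mconst (\<rho> (poly (pderiv f) z)) = 0"
      hence "coef (mconst (\<rho> (poly (pderiv f) z))) 0 = coef 0 0" by (rule arg_cong)
      thus False using \<rho>s'(2) by simp
    qed
    ultimately have "poly (pderiv (map_poly \<phi> f)) \<zeta> \<noteq> 0" by auto
    thus ?thesis unfolding simple_root_def using fD \<zeta>(2) by blast
  qed
  \<comment> \<open>Hensel's lemma for the linear polynomial \<open>\<phi> q * X - 1\<close>
    produces the inverse of \<open>\<phi> q\<close> with coefficients in \<open>L\<close>.\<close>
  have "\<exists>\<iota>\<in>series_over L. poly [:- 1, \<phi> q:] \<iota> = 0 \<and> fps_nth \<iota> 0 = mconst (1 / \<rho> q)"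
  proof (rule series_hensel[OF L])
    have qS: "\<phi> q \<in> series_over L" using qD DS by blast
    show "[:- 1, \<phi> q:] \<in> pol (series_over L)"
      by (intro pol_pCons pol_const[OF S] qS subring_uminus[OF S] subring_one[OF S])
    have n: "fps_nth (\<phi> q) 0 = mconst (\<rho> q)" by (rule nth_\<phi>[OF q(1)])
    show \<rho>qL: "\<rho> q \<in> L" by (rule inL[OF qS n])
    show "1 / \<rho> q \<in> L" by (rule subfield_divide[OF L subring_one[OF LR] \<rho>qL])
    show "fps_nth (poly [:- 1, \<phi> q:] (kap (1 / \<rho> q))) 0 = 0"
      using \<rho>s'(1) by (simp add: fps_mult_nth kap0 n mult_single)
    show "fps_nth (poly (pderiv [:- 1, \<phi> q:]) (kap (1 / \<rho> q))) 0 = mconst (\<rho> q)"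
      by (simp add: pderiv_pCons n)
    show "\<rho> q \<noteq> 0" by (rule \<rho>s')
  qed
  then obtain \<iota> where \<iota>: "\<iota> \<in> series_over L" "\<phi> q * \<iota> = 1" by (auto simp: mult.commute)
  have "\<phi> (lead_coeff f) \<noteq> 0" using \<phi>_inj[OF polD[OF fA(1)]] fA(2) by force
  from extend_hom_algebraic[OF A \<phi>(1) f this \<zeta>(2)] obtain \<psi> where
    \<psi>: "hom_on (gen (insert z A)) \<psi>" "\<And>p. p \<in> pol A \<Longrightarrow> \<psi> (poly p z) = poly (map_poly \<phi> p) \<zeta>"
      "\<And>a. a \<in> A \<Longrightarrow> \<psi> a = \<phi> a" by blast
  have zA: "A \<subseteq> gen (insert z A)" using gen_superset[of "insert z A"] by blast
  have "\<psi> q * \<iota> = 1" using \<psi>(3)[OF q(1)] \<iota>(2) by simp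
  from extend_hom_inverse[OF is_subring_gen \<psi>(1) subsetD[OF zA q(1)] q(2) this] obtain \<Phi> where
    \<Phi>: "hom_on (gen (insert (1 / q) (gen (insert z A)))) \<Phi>" "\<And>a. a \<in> gen (insert z A) \<Longrightarrow> \<Phi> a = \<psi> a"
      "\<Phi> (1 / q) = \<iota>" by blast
  \<comment> \<open>The ring \<open>K\<^sub>2[t][z, 1 / q]\<close>, which contains every
    \<open>y i\<close> as \<open>poly (Q i) z * (1 / q)\<close>.\<close>
  define M where "M = gen (insert (1 / q) (gen (insert z A)))"
  have M: "is_subring M" "gen (insert z A) \<subseteq> M" "1 / q \<in> M"
    using is_subring_gen[of "insert (1 / q) (gen (insert z A))", folded M_def]
      gen_superset[of "insert (1 / q) (gen (insert z A))", folded M_def] by auto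
  note \<Phi> = \<Phi>[folded M_def]
  have AM: "a \<in> M" "\<Phi> a = \<phi> a" if "a \<in> A" for a
    using that zA M(2) \<Phi>(2) \<psi>(3) by auto
  have yM: "y i \<in> M \<and> \<Phi> (y i) = poly (map_poly \<phi> (Q i)) \<zeta> * \<iota>" if i: "i < N" for i
  proof -
    have e: "poly (Q i) z \<in> gen (insert z A)" unfolding gen_insert_eq[OF A] using Q[OF i] by blast
    have "y i = poly (Q i) z * (1 / q)" using P(2)[OF i] q(2) by (simp add: Q_def)
    moreover have "\<Phi> (poly (Q i) z * (1 / q)) = \<Phi> (poly (Q i) z) * \<Phi> (1 / q)"
      using e M by (intro hom_on_mult[OF M(1) \<Phi>(1)]) auto
    moreover have "poly (Q i) z * (1 / q) \<in> M" using e M by (intro subring_mult[OF M(1)]) auto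
    ultimately show ?thesis using \<Phi>(2)[OF e] \<Phi>(3) \<psi>(2)[OF Q[OF i]] by simp
  qed
  have "\<Phi> (y i) \<in> series_over L" if i: "i < N" for i
  proof -
    have "map_poly \<phi> (Q i) \<in> pol (series_over L)" using QD[OF i] pol_mono[OF DS] by blast
    thus ?thesis using yM[OF i] \<zeta>(1) \<iota>(1) by (auto intro!: subring_mult[OF S] poly_in_subring[OF S])
  qed
  \<comment> \<open>The expansion of \<open>y i\<close> is a quotient of elements of
    \<open>D[\<zeta>]\<close> with denominator \<open>\<phi> q\<close>, so it inherits simplicity
    from the single series \<zeta>.\<close>
  moreover have "simple_root D (\<Phi> (y i))" if i: "i < N" for i
  proof (rule simple_root_generated[OF D, of "{\<zeta>}"])
    have sup: "D \<subseteq> gen ({\<zeta>} \<union> D)" "\<zeta> \<in> gen ({\<zeta>} \<union> D)" using gen_superset[of "{\<zeta>} \<union> D"] by auto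
    show "poly (map_poly \<phi> (Q i)) \<zeta> \<in> gen ({\<zeta>} \<union> D)"
      by (rule poly_in_subring[OF is_subring_gen _ sup(2)]) (use QD[OF i] pol_mono[OF sup(1)] in blast)
    show "\<phi> q \<in> gen ({\<zeta>} \<union> D)" using qD sup(1) by blast
    show "\<phi> q \<noteq> 0" using \<iota>(2) by auto
    have "\<Phi> (y i) * \<phi> q = poly (map_poly \<phi> (Q i)) \<zeta> * (\<phi> q * \<iota>)" using yM[OF i] by (simp only: mult_ac)
    thus "\<Phi> (y i) * \<phi> q = poly (map_poly \<phi> (Q i)) \<zeta>" using \<iota>(2) by simp
  qed (use \<zeta>sep in auto)
  moreover have "k \<in> M \<and> \<Phi> k = kap k" if "k \<in> K\<^sub>2" for k
    using AM[of k] KA(1) \<phi>K[OF that] that by auto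
  moreover have "t i \<in> M \<and> \<Phi> (t i) = shifted_var b i" if "i < r" for i
    using AM[OF KA(2)[OF that]] \<phi>t[OF that] by simp
  ultimately show ?thesis
    using b \<theta>K M(1) \<Phi>(1) yM unfolding L_def D_def
    by (intro exI[of _ b] exI[of _ \<theta>] exI[of _ M] exI[of _ \<Phi>]) blast
qed

end

section \<open>Transitivity\<close>

lemma simple_root_self:
  assumes "is_subring A" "a \<in> A"
  shows "simple_root A a"
  unfolding simple_root_def
  by (rule bexI[of _ "[:- a, 1:]"])
     (auto simp: pderiv_pCons intro!: pol_pCons pol_const subring_closed assms)

text \<open>The point is the image of the generic point of \<open>V\<close> under the composition of
  the expansion \<open>\<Phi>\<close> with a specialization \<open>\<Psi>\<close> of the series.
  Homomorphisms preserve the equations of \<open>V\<close> and the relation between \<open>x\<close>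
  and \<open>t\<close>, while \<open>\<Psi>\<close> sends the parameters into
  \<open>K\<^sub>0\<close>.\<close>

theorem pac_in_domain_trans:
  fixes K\<^sub>0 K\<^sub>1 K\<^sub>2 :: "'a::alg_closed_field set"
  assumes K\<^sub>1: "is_subfield K\<^sub>1" and K\<^sub>2: "is_subfield K\<^sub>2" and K\<^sub>12: "K\<^sub>1 \<subseteq> K\<^sub>2"
    and sep12: "\<And>k. k \<in> K\<^sub>2 \<Longrightarrow> simple_root K\<^sub>1 k"
    and pac12: "pac_in_domain K\<^sub>1 K\<^sub>2" and pac01: "pac_in_domain K\<^sub>0 K\<^sub>1"
  shows "pac_in_domain K\<^sub>0 K\<^sub>2"
  unfolding pac_in_domain_def
proof (intro allI impI, elim conjE)
  fix n V r and \<nu> :: "nat \<Rightarrow> 'a mpoly \<times> 'a mpoly"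
  assume r: "r \<ge> 1" and V: "abs_irreducible n V" "defined_over K\<^sub>2 n V"
    and \<nu>: "rational_map K\<^sub>2 n V r \<nu>" "dominating n V r \<nu>" and sepm: "separable_map K\<^sub>2 n V r \<nu>"
  note R\<^sub>1 = subfield_is_subring[OF K\<^sub>1] and R\<^sub>2 = subfield_is_subring[OF K\<^sub>2]
  obtain x where x: "generic_point K\<^sub>2 n V x" and sep: "separable_algebraic_extension
       (adjoin K\<^sub>2 ((\<lambda>i. meval (fst (\<nu> i)) x / meval (snd (\<nu> i)) x) ` {..<r})) (function_field K\<^sub>2 n x)"
    using sepm unfolding separable_map_def by blast
  define t where "t = (\<lambda>i. meval (fst (\<nu> i)) x / meval (snd (\<nu> i)) x)"
  note sep = sep[folded t_def]
  note setting = pac12 K\<^sub>2 r V \<nu> x t_def sep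
  have ind: "alg_independent K\<^sub>2 r t" by (rule parameters_independent[OF setting])
  hence ind\<^sub>1: "alg_independent K\<^sub>1 r t"
    using mpolys_mono[OF K\<^sub>12, of r r] unfolding alg_independent_def by blast
  have \<nu>': "fst (\<nu> i) \<in> mpolys K\<^sub>2 n" "snd (\<nu> i) \<in> mpolys K\<^sub>2 n" "meval (snd (\<nu> i)) x \<noteq> 0" if "i < r" for i
    using \<nu> that generic_point_nonzero[OF x] by (auto simp: rational_map_def)
  define den where "den = (\<Prod>i<r. snd (\<nu> i))"
  have den: "den \<in> mpolys K\<^sub>2 n" unfolding den_def
    using \<nu>' by (intro subring_prod[OF is_subring_mpolys[OF R\<^sub>2]]) auto
  have den_ev: "meval den z = (\<Prod>i<r. meval (snd (\<nu> i)) z)" for z by (simp add: den_def meval_simps)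
  have denx: "meval den x \<noteq> 0" using \<nu>' by (simp add: den_ev)
  \<comment> \<open>The additional coordinate, the inverse of the common denominator, is carried
    along to keep the denominators of the map nonzero at the resulting point.\<close>
  define y where "y = x(n := 1 / meval den x)"
  have "function_field K\<^sub>2 (Suc n) y = function_field K\<^sub>2 n x"
    unfolding y_def by (rule open_part_function_field[OF K\<^sub>2 den])
  hence yff: "y i \<in> function_field K\<^sub>2 n x" if "i < Suc n" for i
    using that adjoin_generators[of "y ` {..<Suc n}" K\<^sub>2] unfolding function_field_def by auto
  have "\<exists>b \<theta> M \<Phi>. (\<forall>i<r. b i \<in> K\<^sub>1) \<and> \<theta> \<in> K\<^sub>2 \<and> is_subring M \<and> hom_on M \<Phi> \<and> K\<^sub>2 \<subseteq> M \<and>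
    (\<forall>k\<in>K\<^sub>2. \<Phi> k = kap k) \<and> (\<forall>i<r. t i \<in> M \<and> \<Phi> (t i) = shifted_var b i) \<and>
    (\<forall>i<Suc n. y i \<in> M \<and> \<Phi> (y i) \<in> series_over (gen (insert \<theta> K\<^sub>1)) \<and>
      simple_root (gen (kap ` gen (insert \<theta> K\<^sub>1) \<union> shifted_var b ` {..<r})) (\<Phi> (y i)))"
    by (rule pac_embedding[OF setting K\<^sub>1 K\<^sub>12]) (fact sep12, fact yff)
  then obtain b \<theta> M \<Phi> where emb: "\<forall>i<r. b i \<in> K\<^sub>1" and \<theta>: "\<theta> \<in> K\<^sub>2" and M: "is_subring M"
    and \<Phi>: "hom_on M \<Phi>" and KM: "K\<^sub>2 \<subseteq> M" and emb': "\<forall>k\<in>K\<^sub>2. \<Phi> k = kap k"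
      "\<forall>i<r. t i \<in> M \<and> \<Phi> (t i) = shifted_var b i"
      "\<forall>i<Suc n. y i \<in> M \<and> \<Phi> (y i) \<in> series_over (gen (insert \<theta> K\<^sub>1)) \<and>
        simple_root (gen (kap ` gen (insert \<theta> K\<^sub>1) \<union> shifted_var b ` {..<r})) (\<Phi> (y i))"
    by (elim exE conjE)
  have b: "b i \<in> K\<^sub>1" if "i < r" for i using emb that by blast
  have KM: "K\<^sub>2 \<subseteq> M" "\<And>k. k \<in> K\<^sub>2 \<Longrightarrow> \<Phi> k = kap k" using KM emb'(1) by blast+
  have tM: "t i \<in> M" "\<Phi> (t i) = shifted_var b i" if "i < r" for i using emb'(2) that by blast+
  have yM: "y i \<in> M" "\<Phi> (y i) \<in> series_over (gen (insert \<theta> K\<^sub>1))"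
    "simple_root (gen (kap ` gen (insert \<theta> K\<^sub>1) \<union> shifted_var b ` {..<r})) (\<Phi> (y i))"
    if "i < Suc n" for i using emb'(3) that by blast+
  obtain \<mu> where \<mu>: "least_vanishing K\<^sub>1 \<theta> \<mu>"
    using algebraic_on_least_vanishing[OF simple_root_algebraic[OF sep12[OF \<theta>]]] ..
  define d where "d = Polynomial.degree \<mu>"
  have d: "0 < d" using least_vanishing_degree[OF \<mu>] by (simp add: d_def)
  define A where "A = gen (kap ` K\<^sub>1 \<union> shifted_var b ` {..<r})"
  have "\<forall>i\<in>{..<Suc n}. \<exists>\<eta>. (\<forall>j<d. \<eta> j \<in> series_over K\<^sub>1 \<and> simple_root A (\<eta> j)) \<and>
    \<Phi> (y i) = (\<Sum>j<d. \<eta> j * kap \<theta> ^ j)"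
    unfolding d_def A_def
    by (intro ballI series_restriction[OF K\<^sub>1 sep12[OF \<theta>] \<mu> b]) (auto intro: yM)
  from bchoice[OF this] obtain \<eta> where
    \<eta>: "\<And>i j. i < Suc n \<Longrightarrow> j < d \<Longrightarrow> \<eta> i j \<in> series_over K\<^sub>1"
       "\<And>i j. i < Suc n \<Longrightarrow> j < d \<Longrightarrow> simple_root A (\<eta> i j)"
       "\<And>i. i < Suc n \<Longrightarrow> \<Phi> (y i) = (\<Sum>j<d. \<eta> i j * kap \<theta> ^ j)" by blast
  define m where "m = r + Suc n * d"
  \<comment> \<open>The \<open>r\<close> parameters come first; then the component of coordinate
    \<open>i\<close> at the power \<open>j\<close> of \<theta> sits at index
    \<open>r + (i * d + j)\<close>.\<close>
  define w where "w = (\<lambda>k. if k < r then shifted_var b k else \<eta> ((k - r) div d) ((k - r) mod d))"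
  have w_\<eta>: "w (r + (i * d + j)) = \<eta> i j" if "j < d" for i j using that d by (simp add: w_def)
  have idx: "r + (i * d + j) < m" if "i < Suc n" "j < d" for i j
  proof -
    have "i * d + j < i * d + d" using that by simp
    also have "\<dots> = Suc i * d" by simp
    also have "\<dots> \<le> Suc n * d" using that by (intro mult_le_mono1) simp
    finally show ?thesis by (simp add: m_def)
  qed
  have w_cases: "P (w k)" if k: "k < m" and "\<And>i. i < r \<Longrightarrow> P (shifted_var b i)"
    "\<And>i j. i < Suc n \<Longrightarrow> j < d \<Longrightarrow> P (\<eta> i j)" for P k
  proof (cases "k < r")
    case False
    have "k - r < Suc n * d" using k False by (simp add: m_def)
    hence "(k - r) div d < Suc n" by (rule less_mult_imp_div_less)
    thus ?thesis using that(3) d False by (simp add: w_def)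
  qed (use that(2) in \<open>simp add: w_def\<close>)
  have wS: "w k \<in> series_over K\<^sub>1" if "k < m" for k
    by (rule w_cases[OF that, of "\<lambda>g. g \<in> series_over K\<^sub>1"]) (use shifted_var_series_over[OF R\<^sub>1] b \<eta>(1) in blast)+
  have A: "is_subring A" "\<And>i. i < r \<Longrightarrow> shifted_var b i \<in> A"
    using is_subring_gen[of "kap ` K\<^sub>1 \<union> shifted_var b ` {..<r}", folded A_def]
      gen_superset[of "kap ` K\<^sub>1 \<union> shifted_var b ` {..<r}", folded A_def] by auto
  have wsep: "simple_root A (w k)" if "k < m" for k
    by (rule w_cases[OF that, of "simple_root A"]) (use simple_root_self[OF A(1)] A(2) \<eta>(2) in blast)+
  have w_r: "w i = shifted_var b i" if "i < r" for i using that by (simp add: w_def)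
  have rm: "r \<le> m" by (simp add: m_def)
  have "\<exists>a. (\<forall>i. a i \<in> K\<^sub>1) \<and> (\<forall>i<r. a i \<in> K\<^sub>0) \<and> (\<forall>p\<in>mpolys UNIV m. ev kap p w = 0 \<longrightarrow> meval p a = 0)"
    by (rule pac_series_point[OF pac01 K\<^sub>1 r rm ind\<^sub>1 b wS w_r wsep[unfolded A_def]])
  then obtain a where a: "\<And>i. a i \<in> K\<^sub>1" "\<And>i. i < r \<Longrightarrow> a i \<in> K\<^sub>0"
    "\<And>p. p \<in> mpolys UNIV m \<Longrightarrow> ev kap p w = 0 \<Longrightarrow> meval p a = 0" by blast
  \<comment> \<open>All ambient constants are included: \<open>a\<close> satisfies the relations of
    \<open>w\<close> over the whole field, so the specialization may fix every constant, in
    particular \<theta> and the coefficients from \<open>K\<^sub>2\<close>.\<close>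
  define S where "S = gen (range kap \<union> w ` {..<m})"
  have S: "is_subring S" "\<And>c. kap c \<in> S" "\<And>k. k < m \<Longrightarrow> w k \<in> S"
    using is_subring_gen[of "range kap \<union> w ` {..<m}", folded S_def]
      gen_superset[of "range kap \<union> w ` {..<m}", folded S_def] by auto
  have S_eq: "S = (\<lambda>p. ev kap p w) ` mpolys UNIV m"
    unfolding S_def by (rule ev_image_eq_gen[OF is_subring_UNIV kap_hom, symmetric])
  have hom_a: "hom_on (mpolys UNIV m) (\<lambda>p. meval p a)" unfolding meval_eq_ev by (rule ev_hom_on[OF id_hom])
  have "\<exists>\<Psi>. hom_on S \<Psi> \<and> (\<forall>p\<in>mpolys UNIV m. \<Psi> (ev kap p w) = meval p a)"
    unfolding S_eq
    by (rule hom_on_from_relation[OF is_subring_mpolys[OF is_subring_UNIV] ev_hom_on[OF kap_hom] hom_a])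
       (rule a(3))
  then obtain \<Psi> where \<Psi>: "hom_on S \<Psi>" "\<And>p. p \<in> mpolys UNIV m \<Longrightarrow> \<Psi> (ev kap p w) = meval p a" by blast
  have \<Psi>_kap: "\<Psi> (kap c) = c" for c
    using \<Psi>(2)[OF mpolys_mconst[of c UNIV m]] by (simp add: meval_simps ev_single[OF kap_hom])
  have \<Psi>_w: "\<Psi> (w k) = a k" if "k < m" for k
    using \<Psi>(2)[OF mpolys_mvar[OF _ that]] by (simp add: meval_simps ev_mvar[OF kap_hom])
  have yS: "\<Phi> (y i) \<in> S \<and> \<Psi> (\<Phi> (y i)) \<in> K\<^sub>2" if i: "i < Suc n" for i
  proof -
    have \<eta>S: "\<eta> i j \<in> S" "\<Psi> (\<eta> i j) \<in> K\<^sub>2" if j: "j < d" for j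
      using S(3)[OF idx[OF i j]] \<Psi>_w[OF idx[OF i j]] a(1) K\<^sub>12 unfolding w_\<eta>[OF j] by auto
    have summand: "\<eta> i j * kap \<theta> ^ j \<in> S" if j: "j < d" for j
      by (intro subring_mult[OF S(1)] subring_power[OF S(1)] \<eta>S(1)[OF j] S(2))
    have "\<Psi> (\<Phi> (y i)) = (\<Sum>j<d. \<Psi> (\<eta> i j * kap \<theta> ^ j))"
      unfolding \<eta>(3)[OF i] by (rule hom_on_sum[OF S(1) \<Psi>(1)]) (use summand in auto)
    also have "\<dots> = (\<Sum>j<d. \<Psi> (\<eta> i j) * \<theta> ^ j)"
    proof (rule sum.cong[OF refl])
      fix j assume "j \<in> {..<d}"
      hence j: "j < d" by simp
      show "\<Psi> (\<eta> i j * kap \<theta> ^ j) = \<Psi> (\<eta> i j) * \<theta> ^ j"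
        using \<eta>S(1)[OF j] S(2)
        by (simp add: hom_on_mult[OF S(1) \<Psi>(1)] hom_on_power[OF S(1) \<Psi>(1)] subring_power[OF S(1)] \<Psi>_kap)
    qed
    also have "\<dots> \<in> K\<^sub>2"
      using \<eta>S(2) \<theta> by (intro subring_sum[OF R\<^sub>2] subring_mult[OF R\<^sub>2] subring_power[OF R\<^sub>2]) auto
    finally have "\<Psi> (\<Phi> (y i)) \<in> K\<^sub>2" .
    moreover have "\<Phi> (y i) \<in> S" unfolding \<eta>(3)[OF i] using summand by (intro subring_sum[OF S(1)]) auto
    ultimately show ?thesis by blast
  qed
  define e where "e = (\<lambda>i. if i < n then \<Psi> (\<Phi> (y i)) else 0)"
  have eval: "meval p x \<in> M \<and> \<Phi> (meval p x) \<in> S \<and> meval p e = \<Psi> (\<Phi> (meval p x))"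
    if p: "p \<in> mpolys K\<^sub>2 n" for p
  proof -
    have px: "meval p x = ev (\<lambda>c. c) p y"
      unfolding meval_eq_ev by (rule ev_cong[OF p]) (auto simp: y_def)
    have inM: "ev (\<lambda>c. c) p y \<in> M" by (rule ev_in_subring[OF M p]) (use KM(1) yM(1) in auto)
    have "\<Phi> (ev (\<lambda>c. c) p y) = ev \<Phi> p (\<lambda>i. \<Phi> (y i))"
      by (rule hom_on_ev[OF M \<Phi> p]) (use KM(1) yM(1) in auto)
    also have "\<dots> = ev kap p (\<lambda>i. \<Phi> (y i))" by (rule ev_cong[OF p]) (auto simp: KM(2))
    finally have 1: "\<Phi> (meval p x) = ev kap p (\<lambda>i. \<Phi> (y i))" by (simp add: px)
    have 2: "ev kap p (\<lambda>i. \<Phi> (y i)) \<in> S" by (rule ev_in_subring[OF S(1) p]) (use S(2) yS in auto)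
    have "\<Psi> (ev kap p (\<lambda>i. \<Phi> (y i))) = ev (\<lambda>c. \<Psi> (kap c)) p (\<lambda>i. \<Psi> (\<Phi> (y i)))"
      by (rule hom_on_ev[OF S(1) \<Psi>(1) p]) (use S(2) yS in auto)
    also have "\<dots> = meval p e" unfolding meval_eq_ev by (rule ev_cong[OF p]) (auto simp: \<Psi>_kap e_def)
    finally show ?thesis using inM 1 2 px by simp
  qed
  have \<Phi>0: "\<Phi> 0 = 0" "\<Psi> 0 = 0" by (rule hom_on_zero[OF M \<Phi>], rule hom_on_zero[OF S(1) \<Psi>(1)])
  have "e \<in> V"
  proof -
    obtain T where T: "T \<subseteq> mpolys UNIV n" "V = zero_set n T"
      using V(1) by (auto simp: abs_irreducible_def zariski_closed_def)
    have "meval p e = 0" if p: "p \<in> T" for p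
    proof -
      \<comment> \<open>The equations of \<open>V\<close> may have ambient coefficients, on which
        \<open>\<Phi>\<close> says nothing; definedness over \<open>K\<^sub>2\<close> replaces them
        by generators over \<open>K\<^sub>2\<close>, for which \<open>eval\<close> applies.\<close>
      have "p \<in> vanishing_ideal UNIV n V" using p T by (auto simp: vanishing_ideal_def zero_set_def)
      hence "p \<in> generated_ideal n (vanishing_ideal K\<^sub>2 n V)" using V(2) by (simp add: defined_over_def)
      then obtain G c where G: "G \<subseteq> vanishing_ideal K\<^sub>2 n V" "p = (\<Sum>g\<in>G. c g * g)"
        unfolding generated_ideal_def by blast
      have "meval g e = 0" if "g \<in> G" for g
      proof -
        have g: "g \<in> mpolys K\<^sub>2 n" "meval g x = 0"
          using that G(1) x by (auto simp: vanishing_ideal_def generic_point_def)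
        thus ?thesis using eval[OF g(1)] \<Phi>0 by simp
      qed
      thus ?thesis unfolding G(2) by (simp add: meval_simps)
    qed
    moreover have "e \<in> affine_space n" by (simp add: e_def affine_space_def)
    ultimately show ?thesis using T by (simp add: zero_set_def)
  qed
  have yn: "y n \<in> M" "\<Phi> (y n) \<in> S" using yM(1)[of n] yS[of n] by auto
  \<comment> \<open>The equation \<open>meval den x * y n = 1\<close> survives both homomorphisms,
    so the image of \<open>den\<close> is invertible.\<close>
  have den_e: "meval den e \<noteq> 0"
  proof
    assume 0: "meval den e = 0"
    have "meval den x * y n = 1" using denx by (simp add: y_def)
    hence "\<Phi> (meval den x) * \<Phi> (y n) = 1"
      using hom_on_mult[OF M \<Phi> _ yn(1), of "meval den x"] eval[OF den] hom_on_one[OF M \<Phi>] by simp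
    hence "\<Psi> (\<Phi> (meval den x)) * \<Psi> (\<Phi> (y n)) = 1"
      using hom_on_mult[OF S(1) \<Psi>(1) _ yn(2), of "\<Phi> (meval den x)"] eval[OF den] hom_on_one[OF S(1) \<Psi>(1)] by simp
    thus False using 0 eval[OF den] by simp
  qed
  have snd_e: "meval (snd (\<nu> i)) e \<noteq> 0" if "i < r" for i using den_e that by (auto simp: den_ev)
  have quot_e: "meval (fst (\<nu> i)) e / meval (snd (\<nu> i)) e = a i" if i: "i < r" for i
  proof -
    note f = eval[OF \<nu>'(1)[OF i]] and s = eval[OF \<nu>'(2)[OF i]]
    have "meval (fst (\<nu> i)) x = t i * meval (snd (\<nu> i)) x" using \<nu>'(3)[OF i] by (simp add: t_def)
    hence "\<Phi> (meval (fst (\<nu> i)) x) = \<Phi> (t i) * \<Phi> (meval (snd (\<nu> i)) x)"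
      using hom_on_mult[OF M \<Phi> tM(1)[OF i], of "meval (snd (\<nu> i)) x"] s by simp
    moreover have "\<Phi> (t i) = w i" using tM(2)[OF i] i by (simp add: w_def)
    moreover have "i < m" using i rm by simp
    ultimately have "\<Psi> (\<Phi> (meval (fst (\<nu> i)) x)) = a i * \<Psi> (\<Phi> (meval (snd (\<nu> i)) x))"
      using hom_on_mult[OF S(1) \<Psi>(1) S(3), of i "\<Phi> (meval (snd (\<nu> i)) x)"] \<Psi>_w[of i] s by simp
    thus ?thesis using f s snd_e[OF i] by (simp add: field_simps)
  qed
  \<comment> \<open>Padding by 0 from index \<open>r\<close> on is what membership in
    \<open>affine_space r\<close> demands; below \<open>r\<close> the values are the first entries
    of \<open>a\<close>.\<close>
  define c where "c = (\<lambda>i. if i < r then a i else 0)"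
  have "rational_map_at n V r \<nu> e c" unfolding rational_map_at_def
  proof (intro conjI allI impI \<open>e \<in> V\<close>)
    show "c \<in> affine_space r" by (simp add: c_def affine_space_def)
    fix i assume i: "i < r"
    from rational_fun_at_denominator[OF mpolys_UNIV[OF \<nu>'(1)[OF i]] mpolys_UNIV[OF \<nu>'(2)[OF i]] snd_e[OF i], of V]
    show "rational_fun_at n V (\<nu> i) e (c i)" using i by (simp add: quot_e c_def)
  qed
  moreover have "e \<in> rational_points K\<^sub>2 V"
    using \<open>e \<in> V\<close> yS subring_zero[OF R\<^sub>2] by (auto simp: rational_points_def e_def)
  moreover have "\<forall>i<r. c i \<in> K\<^sub>0" using a(2) by (simp add: c_def)
  ultimately show "\<exists>a\<in>rational_points K\<^sub>2 V. \<exists>c. rational_map_at n V r \<nu> a c \<and> (\<forall>i<r. c i \<in> K\<^sub>0)" by blast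
qed

section \<open>Passage to the universal domain\<close>

lemma to_domain_hom:
  "to_domain 0 = 0" "to_domain 1 = 1" "to_domain (a - b) = to_domain a - to_domain b"
  "to_domain (a * b) = to_domain a * to_domain b"
  by (simp_all add: to_domain_def Zero_fract_def[symmetric] One_fract_def[symmetric] single_diff mult_single
      flip: to_ac_diff to_ac_mult)

lemma to_domain_eq_0_iff: "to_domain a = 0 \<longleftrightarrow> a = 0"
proof
  assume "to_domain a = 0"
  hence "mconst a = 0" by (simp add: to_domain_def Zero_fract_def eq_fract)
  hence "coef (mconst a) 0 = coef 0 0" by (rule arg_cong)
  thus "a = 0" by simp
qed (simp add: to_domain_hom)

lemma is_subfield_to_domain:
  assumes K: "is_subfield K"
  shows "is_subfield (to_domain ` K)"
  unfolding is_subfield_def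
proof (intro conjI ballI)
  note R = subfield_is_subring[OF K]
  show "is_subring (to_domain ` K)"
  proof (rule is_subringI)
    show "1 \<in> to_domain ` K" using subring_one[OF R] to_domain_hom(2) by (metis image_eqI)
    fix a b assume "a \<in> to_domain ` K" "b \<in> to_domain ` K"
    then obtain c d where "c \<in> K" "d \<in> K" "a = to_domain c" "b = to_domain d" by blast
    thus "a - b \<in> to_domain ` K" "a * b \<in> to_domain ` K"
      using subring_diff[OF R] subring_mult[OF R] by (auto simp flip: to_domain_hom)
  qed
  fix a assume a: "a \<in> to_domain ` K"
  then obtain c where c: "c \<in> K" "a = to_domain c" by blast
  show "inverse a \<in> to_domain ` K"
  proof (cases "c = 0")
    case True
    hence "inverse a = a" using c(2) by (simp add: to_domain_hom)
    thus ?thesis using a by simp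
  next
    case False
    hence "a * to_domain (inverse c) = 1" using c by (simp add: to_domain_hom flip: to_domain_hom(4))
    hence "inverse a = to_domain (inverse c)" by (rule inverse_unique)
    thus ?thesis using subfield_inverse[OF K c(1)] by simp
  qed
qed

lemma simple_root_to_domain:
  fixes K :: "'a::field set"
  assumes "simple_root K a"
  shows "simple_root (to_domain ` K) (to_domain a)"
proof -
  obtain g where g: "g \<in> pol K" "poly g a = 0" "poly (pderiv g) a \<noteq> 0"
    using assms by (auto simp: simple_root_def)
  have h: "hom_on UNIV (to_domain :: 'a \<Rightarrow> _)" by (rule hom_onI) (simp_all add: to_domain_hom)
  have U: "p \<in> pol UNIV" for p :: "'a poly" by (simp add: pol_def)
  note ev = hom_on_poly[OF is_subring_UNIV h U UNIV_I]
  have "poly (map_poly to_domain g) (to_domain a) = 0" using ev[of g a] g by (simp add: to_domain_hom)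
  moreover have "poly (pderiv (map_poly to_domain g)) (to_domain a) \<noteq> 0"
    using ev[of "pderiv g" a] g(3) to_domain_eq_0_iff[of "poly (pderiv g) a"]
    unfolding map_poly_hom_pderiv[OF is_subring_UNIV h U] by simp
  moreover have "map_poly to_domain g \<in> pol (to_domain ` K)"
    by (rule polI) (use polD[OF g(1)] in \<open>auto simp: coeff_map_poly to_domain_hom\<close>)
  ultimately show ?thesis unfolding simple_root_def by blast
qed

theorem theorem5:
  fixes K\<^sub>0 K\<^sub>1 K\<^sub>2 :: "'a::field set"
  assumes "separable_algebraic_extension K\<^sub>0 K\<^sub>1"
    and "separable_algebraic_extension K\<^sub>1 K\<^sub>2"
    and "pac_extension K\<^sub>1 K\<^sub>2"
    and "pac_extension K\<^sub>0 K\<^sub>1"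
  shows "pac_extension K\<^sub>0 K\<^sub>2"
proof -
  have ext: "is_subfield K\<^sub>0" "is_subfield K\<^sub>1" "is_subfield K\<^sub>2" "K\<^sub>0 \<subseteq> K\<^sub>1" "K\<^sub>1 \<subseteq> K\<^sub>2"
    using assms(1,2)
    by (auto simp: separable_algebraic_extension_def field_extension_def subfield_type_algebra)
  have "simple_root K\<^sub>1 k" if "k \<in> K\<^sub>2" for k
    using assms(2) that by (simp add: separable_algebraic_extension_def separable_over_imp_simple_root)
  hence sep: "simple_root (to_domain ` K\<^sub>1) k" if "k \<in> to_domain ` K\<^sub>2" for k
    using that simple_root_to_domain by blast
  have "pac_in_domain (to_domain ` K\<^sub>1) (to_domain ` K\<^sub>2)" "pac_in_domain (to_domain ` K\<^sub>0) (to_domain ` K\<^sub>1)"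
    using assms(3,4) by (simp_all add: pac_extension_def)
  from pac_in_domain_trans[OF is_subfield_to_domain[OF ext(2)] is_subfield_to_domain[OF ext(3)]
      image_mono[OF ext(5)] sep this]
  have "pac_in_domain (to_domain ` K\<^sub>0) (to_domain ` K\<^sub>2)" .
  thus ?thesis using ext by (auto simp: pac_extension_def field_extension_def subfield_type_algebra)
qed

end
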